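(* Let $c>0$ and $p>1$ be constants and $a_k=\lfloor ck^p\rfloor$, $k\ge1$. Assume $\mathbb E X_i=0$, $X_i\in\mathcal L^2$, and for some $q\in(0,1]$, $$\sum_{j=0}^\infty j^q\,\omega(j)<\infty .$$ Then $\mathbb EV_n-v_n\sigma^2=O\big(n^{1+(1-q)(1-1/p)}\big)$. Consequently, if in addition $X_i\in\mathcal L^\alpha$ and $\sum_{j=0}^\infty\delta_\alpha(j)<\infty$ for some $\alpha\in(2,4]$, then $$\|V_n-v_n\sigma^2\|_{\alpha/2}=O(n^{\phi}),\qquad \phi=\max\Big(\tfrac32-\tfrac{3}{2p}+\tfrac2\alpha,\ 1+(1-q)(1-\tfrac1p)\Big).$$
   Context: Let $(\varepsilon_i)_{i\in\mathbb Z}$ be i.i.d. random variables, $\mathcal F_i$ the $\sigma$-field generated by $(\ldots,\varepsilon_{i-1},\varepsilon_i)$, and $X_i=g(\ldots,\varepsilon_{i-1},\varepsilon_i)$ for a measurable $g$ such that $X_i$ is well defined. $\|\xi\|_p=(\mathbb E|\xi|^p)^{1/p}$, $\xi\in\mathcal L^p$ means $\|\xi\|_p<\infty$. Projection operator: $\mathcal P_i\xi=\mathbb E(\xi\mid\mathcal F_i)-\mathbb E(\xi\mid\mathcal F_{i-1})$. Let $\varepsilon_0'$ have the law of $\varepsilon_0$ and be independent of $(\varepsilon_j)$, $\mathcal F_0'=(\ldots,\varepsilon_{-1},\varepsilon_0')$, and for $i\ge0$, $X_i'=g(\ldots,\varepsilon_{-1},\varepsilon_0',\varepsilon_1,\ldots,\varepsilon_i)$.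 Physical dependence measure: $\delta_p(i)=\|X_i-X_i'\|_p$. Predictive dependence measure: $\omega_p(i)=\|\mathbb E(X_i\mid\mathcal F_0)-\mathbb E(X_i'\mid\mathcal F_0')\|_p$ (i.e. $g_i(\mathcal F_0)-g_i(\mathcal F_0')$ with $g_i(\mathcal F_0)=\mathbb E[X_i\mid\mathcal F_0]$), and $\omega(i)=\omega_2(i)$. $D_k=\sum_{i\ge k}\mathcal P_kX_i$ (convergent in $\mathcal L^2$ under the hypotheses) and $\sigma=\|D_0\|_2$; equivalently $\sigma^2=\sum_{k\in\mathbb Z}\mathrm{cov}(X_0,X_k)$. Given an integer sequence $(a_k)$ with $a_k\to\infty$, define for $i\ge1$: $t_i=\max(\{1\}\cup\{a_k:k\ge1,\ a_k\le i\})$, $W_i=X_{t_i}+\cdots+X_i$, $l_i=i-t_i+1$, $V_n=\sum_{i=1}^nW_i^2$, $v_n=\sum_{i=1}^nl_i$. *)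

theory Defs
  imports "HOL-Probability.Probability" "HOL-Library.Landau_Symbols"
begin

definition Lnorm :: "'a measure \<Rightarrow> real \<Rightarrow> ('a \<Rightarrow> real) \<Rightarrow> real" where
  "Lnorm M p f = (\<integral>x. \<bar>f x\<bar> powr p \<partial>M) powr (1 / p)"

definition past_sa :: "'a measure \<Rightarrow> 'b measure \<Rightarrow> (int \<Rightarrow> 'a \<Rightarrow> 'b) \<Rightarrow> int \<Rightarrow> 'a measure" where
  "past_sa M N e i = sigma (space M) {e j -` A \<inter> space M | j A. j \<le> i \<and> A \<in> sets N}"

definition bshift :: "((nat \<Rightarrow> 'b) \<Rightarrow> real) \<Rightarrow> (int \<Rightarrow> 'a \<Rightarrow> 'b) \<Rightarrow> int \<Rightarrow> 'a \<Rightarrow> real" where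
  "bshift g e i w = g (\<lambda>k. e (i - int k) w)"

definition coupled :: "(int \<Rightarrow> 'a \<Rightarrow> 'b) \<Rightarrow> ('a \<Rightarrow> 'b) \<Rightarrow> int \<Rightarrow> 'a \<Rightarrow> 'b" where
  "coupled e e0' j = (if j = 0 then e0' else e j)"

definition phys_dep :: "'a measure \<Rightarrow> ((nat \<Rightarrow> 'b) \<Rightarrow> real) \<Rightarrow> (int \<Rightarrow> 'a \<Rightarrow> 'b) \<Rightarrow> ('a \<Rightarrow> 'b) \<Rightarrow> real \<Rightarrow> nat \<Rightarrow> real" where
  "phys_dep M g e e0' p i =
     Lnorm M p (\<lambda>w. bshift g e (int i) w - bshift g (coupled e e0') (int i) w)"

definition pred_dep :: "'a measure \<Rightarrow> 'b measure \<Rightarrow> ((nat \<Rightarrow> 'b) \<Rightarrow> real) \<Rightarrow> (int \<Rightarrow> 'a \<Rightarrow> 'b) \<Rightarrow> ('a \<Rightarrow> 'b) \<Rightarrow> real \<Rightarrow> nat \<Rightarrow> real" where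
  "pred_dep M N g e e0' p i =
     Lnorm M p (\<lambda>w. real_cond_exp M (past_sa M N e 0) (bshift g e (int i)) w
                 - real_cond_exp M (past_sa M N (coupled e e0') 0) (bshift g (coupled e e0') (int i)) w)"

definition lrvar :: "'a measure \<Rightarrow> (int \<Rightarrow> 'a \<Rightarrow> real) \<Rightarrow> real" where
  "lrvar M X = (\<Sum>\<^sub>\<infinity>k::int. (\<integral>w. (X 0 w - (\<integral>v. X 0 v \<partial>M)) * (X k w - (\<integral>v. X k v \<partial>M)) \<partial>M))"

definition blk_start :: "(nat \<Rightarrow> int) \<Rightarrow> nat \<Rightarrow> int" where
  "blk_start a i = Max ({1} \<union> {a k | k. k \<ge> 1 \<and> a k \<le> int i})"

definition blk_sum :: "(nat \<Rightarrow> int) \<Rightarrow> (int \<Rightarrow> 'a \<Rightarrow> real) \<Rightarrow> nat \<Rightarrow> 'a \<Rightarrow> real" where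
  "blk_sum a X i w = (\<Sum>j\<in>{blk_start a i..int i}. X j w)"

definition blk_len :: "(nat \<Rightarrow> int) \<Rightarrow> nat \<Rightarrow> real" where
  "blk_len a i = real_of_int (int i - blk_start a i + 1)"

definition Vn :: "(nat \<Rightarrow> int) \<Rightarrow> (int \<Rightarrow> 'a \<Rightarrow> real) \<Rightarrow> nat \<Rightarrow> 'a \<Rightarrow> real" where
  "Vn a X n w = (\<Sum>i=1..n. (blk_sum a X i w)\<^sup>2)"

definition vn :: "(nat \<Rightarrow> int) \<Rightarrow> nat \<Rightarrow> real" where
  "vn a n = (\<Sum>i=1..n. blk_len a i)"

end

theory Submission
  imports Defs
begin

text \<open>
  The innovations are transferred to the product space over the integers, where conditioning on the
  coordinates in \<open>S\<close> means integrating out the others, so that tower property, stationarity and the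
  coupling inequality \<open>\<parallel>\<P>\<^sub>j f\<parallel>\<^sub>p \<le> \<parallel>f - f\<^sup>(\<^sup>j\<^sup>)\<parallel>\<^sub>p\<close> (coordinate \<open>j\<close> replaced by an independent copy) are
  all pointwise identities combined with Fubini and Jensen.

  Expectation: \<open>\<parallel>\<P>\<^sub>0 X\<^sub>i\<parallel>\<^sub>2 \<le> \<omega>(i)\<close>, and orthogonality of the projections gives
  \<open>\<bar>\<gamma>(k)\<bar> \<le> (\<Sum>i. \<omega>(i) \<omega>(i + k))\<close>, so \<open>k\<^sup>q \<gamma>(k)\<close> is summable. Since
  \<open>l \<sigma>\<^sup>2 - E S\<^sub>l\<^sup>2 = (\<Sum>k. min \<bar>k\<bar> l * \<gamma>(k))\<close> and \<open>min k l \<le> k\<^sup>q l\<^sup>1\<^sup>-\<^sup>q\<close>, each block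
  contributes an error \<open>O(l\<^sup>1\<^sup>-\<^sup>q)\<close>, with \<open>l\<close> at most a multiple of \<open>n\<^sup>1\<^sup>-\<^sup>1\<^sup>/\<^sup>p\<close>.

  Deviation: Rio's martingale inequality bounds \<open>\<parallel>W\<^sub>i\<parallel>\<^sub>\<alpha>\<close> by a multiple of \<open>sqrt l\<^sub>i\<close>. By Hoelder,
  replacing one innovation then changes \<open>V\<^sub>n\<close> in \<open>L\<^sup>\<alpha>\<^sup>/\<^sup>2\<close> by at most a multiple of
  \<open>l\<^sup>3\<^sup>/\<^sup>2 (\<Sum>i\<le>n. \<delta>(i - j))\<close>, \<open>l\<close> being the largest block length, and the von Bahr-Esseen inequality
  sums these contributions over \<open>j\<close>.
\<close>

section \<open>\<open>L\<^sup>p\<close> norms\<close>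

text \<open>The predictive measure compares conditional expectations with respect to two different
  sigma-algebras, each fixed only up to null sets. On the product space both become one function
  evaluated at two coupled sequences, which is why the innovations are moved there. The obstacle is
  the infinite past. Finitely many projections sum to f minus its conditional expectation given a
  remote past, not to f minus its mean. A zero-one law removes that remainder: with Fatou's lemma in
  the moment bounds, with a truncation for the covariances. The range of \<alpha> comes from r =
  \<alpha>/2: von Bahr-Esseen serves 1 < r \<le> 2 for V_n, Rio serves 2r > 2 for the block sums.
  Blocks have length at most a multiple of n^(1-1/p), and l^(3/2) n^(1/r) then yields the exponent
  3/2 - 3/(2p) + 2/\<alpha>. Only orders of growth are claimed, so constants are chosen for short
  proofs: a factor 2 in Hoelder's inequality, one common constant \<open>mart_const\<close> in both
  martingale inequalities.\<close>

lemma powr_weighted_le: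
  fixes a b s t p :: real
  assumes "p \<ge> 1" "a \<ge> 0" "b \<ge> 0" "s \<ge> 0" "t \<ge> 0" "s + t = 1"
  shows "(s * a + t * b) powr p \<le> s * a powr p + t * b powr p"
proof -
  \<comment> \<open>\<open>powr_convex\<close> speaks of the open half-line; an argument equal to 0
    is handled by u^p \<le> u on [0,1].\<close>
  have scale: "(u * c) powr p \<le> u * c powr p" if "0 \<le> u" "u \<le> 1" "c \<ge> 0" for u c :: real
  proof -
    have "u powr p \<le> u" using that assms(1) powr_mono'[of 1 p u] by (cases "u = 0") auto
    then show ?thesis using that by (simp add: powr_mult mult_right_mono)
  qed
  show ?thesis
  proof (cases "a = 0 \<or> b = 0")
    case True
    then show ?thesis using scale[of s a] scale[of t b] assms by auto
  next
    case False
    then have "convex_on {0<..} (\<lambda>x. x powr p)" "a \<in> {0<..}" "b \<in> {0<..}"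
      using assms powr_convex by auto
    then show ?thesis using assms unfolding convex_on_def by fastforce
  qed
qed

lemma convex_on_abs_powr:
  fixes p :: real
  assumes "p \<ge> 1"
  shows "convex_on UNIV (\<lambda>x::real. \<bar>x\<bar> powr p)"
proof (rule convex_onI)
  fix t x y :: real assume t: "0 < t" "t < 1"
  have "\<bar>(1 - t) *\<^sub>R x + t *\<^sub>R y\<bar> \<le> (1 - t) * \<bar>x\<bar> + t * \<bar>y\<bar>"
    using t abs_triangle_ineq[of "(1 - t) * x" "t * y"] by (simp add: abs_mult)
  then have "\<bar>(1 - t) *\<^sub>R x + t *\<^sub>R y\<bar> powr p \<le> ((1 - t) * \<bar>x\<bar> + t * \<bar>y\<bar>) powr p"
    using assms by (intro powr_mono2) auto
  also have "\<dots> \<le> (1 - t) * \<bar>x\<bar> powr p + t * \<bar>y\<bar> powr p"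
    using t assms by (intro powr_weighted_le) auto
  finally show "\<bar>(1 - t) *\<^sub>R x + t *\<^sub>R y\<bar> powr p \<le> (1 - t) * \<bar>x\<bar> powr p + t * \<bar>y\<bar> powr p" .
qed simp

text \<open>Both bases are replaced by the larger of u and v: a Young inequality without weights, at
  the price of a factor 2 after normalisation.\<close>

lemma powr_mult_le_add_powr:
  fixes u v a b :: real
  assumes "u \<ge> 0" "v \<ge> 0" "a \<ge> 0" "b \<ge> 0"
  shows "u powr a * v powr b \<le> u powr (a + b) + v powr (a + b)"
proof -
  have "u powr a * v powr b \<le> max u v powr a * max u v powr b"
    using assms by (intro mult_mono powr_mono2) auto
  also have "\<dots> = max u v powr (a + b)" by (simp add: powr_add)
  also have "\<dots> \<le> u powr (a + b) + v powr (a + b)" by (auto simp: max_def)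
  finally show ?thesis .
qed

lemma abs_add_powr_le:
  fixes u v p :: real
  assumes "p \<ge> 0"
  shows "\<bar>u + v\<bar> powr p \<le> 2 powr p * (\<bar>u\<bar> powr p + \<bar>v\<bar> powr p)"
proof -
  have "\<bar>u + v\<bar> powr p \<le> (2 * max \<bar>u\<bar> \<bar>v\<bar>) powr p"
    using assms by (intro powr_mono2) auto
  also have "\<dots> = 2 powr p * max \<bar>u\<bar> \<bar>v\<bar> powr p" by (simp add: powr_mult)
  also have "\<dots> \<le> 2 powr p * (\<bar>u\<bar> powr p + \<bar>v\<bar> powr p)"
    by (intro mult_left_mono) (auto simp: max_def)
  finally show ?thesis .
qed

text \<open>\<open>Lnorm\<close> rests on the Bochner integral, which is 0 for a non-integrable
  integrand, so a bound on \<open>Lnorm\<close> alone carries no information; this predicate records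
  that the norm is genuine.\<close>

definition memLp :: "'a measure \<Rightarrow> real \<Rightarrow> ('a \<Rightarrow> real) \<Rightarrow> bool" where
  "memLp M p f \<longleftrightarrow> f \<in> borel_measurable M \<and> integrable M (\<lambda>x. \<bar>f x\<bar> powr p)"

lemma memLp_meas: "memLp M p f \<Longrightarrow> f \<in> borel_measurable M"
  and memLp_int: "memLp M p f \<Longrightarrow> integrable M (\<lambda>x. \<bar>f x\<bar> powr p)"
  by (auto simp: memLp_def)

lemma memLp_add:
  assumes "p \<ge> 0" "memLp M p f" "memLp M p g"
  shows "memLp M p (\<lambda>x. f x + g x)"
proof -
  have [measurable]: "f \<in> borel_measurable M" "g \<in> borel_measurable M"
    using assms by (auto simp: memLp_def)
  have "integrable M (\<lambda>x. 2 powr p * (\<bar>f x\<bar> powr p + \<bar>g x\<bar> powr p))"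
    using assms by (auto simp: memLp_def)
  then have "integrable M (\<lambda>x. \<bar>f x + g x\<bar> powr p)"
    by (rule Bochner_Integration.integrable_bound) (use abs_add_powr_le[OF assms(1)] in auto)
  then show ?thesis by (simp add: memLp_def)
qed

lemma memLp_cmult: "memLp M p f \<Longrightarrow> memLp M p (\<lambda>x. c * f x)"
  by (auto simp: memLp_def abs_mult powr_mult)

lemma memLp_minus: "memLp M p f \<Longrightarrow> memLp M p (\<lambda>x. - f x)"
  using memLp_cmult[of M p f "-1"] by simp

lemma memLp_diff:
  "p \<ge> 0 \<Longrightarrow> memLp M p f \<Longrightarrow> memLp M p g \<Longrightarrow> memLp M p (\<lambda>x. f x - g x)"
  using memLp_add[of p M f "\<lambda>x. - g x"] memLp_minus[of M p g] by simp

lemma memLp_zero: "memLp M p (\<lambda>x. 0)"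
  by (simp add: memLp_def)

lemma memLp_sum:
  assumes "p \<ge> 0" "\<And>i. i \<in> I \<Longrightarrow> memLp M p (f i)"
  shows "memLp M p (\<lambda>x. \<Sum>i\<in>I. f i x)"
  using assms(2) by (induction I rule: infinite_finite_induct)
    (auto intro!: memLp_add assms(1) memLp_zero)

lemma (in finite_measure) memLp_const: "memLp M p (\<lambda>x. c)"
  by (simp add: memLp_def)

lemma (in finite_measure) memLp_mono:
  assumes "0 \<le> p" "p \<le> p'" "memLp M p' f"
  shows "memLp M p f"
proof -
  have [measurable]: "f \<in> borel_measurable M"
    using assms by (auto simp: memLp_def)
  have le: "\<bar>f x\<bar> powr p \<le> 1 + \<bar>f x\<bar> powr p'" for x
  proof (cases "\<bar>f x\<bar> \<le> 1")
    case True
    then have "\<bar>f x\<bar> powr p \<le> 1" using assms by (intro powr_le1) auto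
    then show ?thesis by (smt (verit) powr_ge_zero)
  next
    case False
    then have "\<bar>f x\<bar> powr p \<le> \<bar>f x\<bar> powr p'" using assms by (intro powr_mono) auto
    then show ?thesis by simp
  qed
  have "integrable M (\<lambda>x. 1 + \<bar>f x\<bar> powr p')" using assms by (auto simp: memLp_def)
  then have "integrable M (\<lambda>x. \<bar>f x\<bar> powr p)"
    by (rule Bochner_Integration.integrable_bound) (use le in \<open>auto intro!: AE_I2 order_trans[OF le]\<close>)
  then show ?thesis by (simp add: memLp_def)
qed

lemma (in finite_measure) memLp_integrable:
  assumes "1 \<le> p" "memLp M p f"
  shows "integrable M f"
proof -
  have "memLp M 1 f" using memLp_mono[of 1 p f] assms by simp
  then have "f \<in> borel_measurable M" "integrable M (\<lambda>x. \<bar>f x\<bar>)" by (auto simp: memLp_def)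
  then show ?thesis using integrable_abs_cancel by blast
qed

lemma memLp_powr_mult_integrable:
  assumes "a \<ge> 0" "b \<ge> 0" "p = a + b" "memLp M p f" "memLp M p g"
  shows "integrable M (\<lambda>x. \<bar>f x\<bar> powr a * \<bar>g x\<bar> powr b)"
proof -
  have [measurable]: "f \<in> borel_measurable M" "g \<in> borel_measurable M"
    using assms by (auto simp: memLp_def)
  have "integrable M (\<lambda>x. \<bar>f x\<bar> powr p + \<bar>g x\<bar> powr p)"
    using assms by (auto simp: memLp_def)
  then show ?thesis
    using powr_mult_le_add_powr[of "\<bar>f x\<bar>" "\<bar>g x\<bar>" a b for x] assms
    by (elim Bochner_Integration.integrable_bound) auto
qed

lemma Lnorm_nonneg: "0 \<le> Lnorm M p f"
  by (simp add: Lnorm_def)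

lemma Lnorm_powr: "p > 0 \<Longrightarrow> Lnorm M p f powr p = (\<integral>x. \<bar>f x\<bar> powr p \<partial>M)"
  by (simp add: Lnorm_def powr_powr)

lemma Lnorm_leI:
  assumes "p > 0" "A \<ge> 0" "(\<integral>x. \<bar>f x\<bar> powr p \<partial>M) \<le> A powr p"
  shows "Lnorm M p f \<le> A"
proof -
  have "Lnorm M p f \<le> (A powr p) powr (1 / p)"
    unfolding Lnorm_def using assms by (intro powr_mono2) auto
  then show ?thesis using assms by (simp add: powr_powr)
qed

lemma Lnorm_zero: "Lnorm M p (\<lambda>x. 0) = 0"
  by (simp add: Lnorm_def)

lemma Lnorm_distr:
  assumes [measurable]: "T \<in> M \<rightarrow>\<^sub>M M'" "f \<in> borel_measurable M'"
  shows "Lnorm (distr M M' T) p f = Lnorm M p (\<lambda>x. f (T x))"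
  unfolding Lnorm_def by (subst integral_distr) auto

lemma memLp_distr:
  assumes [measurable]: "T \<in> M \<rightarrow>\<^sub>M M'" "f \<in> borel_measurable M'"
  shows "memLp (distr M M' T) p f \<longleftrightarrow> memLp M p (\<lambda>x. f (T x))"
  unfolding memLp_def by (subst integrable_distr_eq) auto

lemma Lnorm_eq_0_AE:
  assumes "p > 0" "memLp M p f" "Lnorm M p f = 0"
  shows "AE x in M. f x = 0"
proof -
  have "(\<integral>x. \<bar>f x\<bar> powr p \<partial>M) = 0" using Lnorm_powr[OF assms(1), of M f] assms by simp
  then have "AE x in M. \<bar>f x\<bar> powr p = 0"
    using assms by (subst (asm) integral_nonneg_eq_0_iff_AE) (auto simp: memLp_def)
  then show ?thesis by eventually_elim auto
qed

lemma Lnorm_cong_AE: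
  assumes "AE x in M. f x = g x" "f \<in> borel_measurable M" "g \<in> borel_measurable M"
  shows "Lnorm M p f = Lnorm M p g"
proof -
  have "(\<integral>x. \<bar>f x\<bar> powr p \<partial>M) = (\<integral>x. \<bar>g x\<bar> powr p \<partial>M)"
    using assms by (intro integral_cong_AE) auto
  then show ?thesis by (simp add: Lnorm_def)
qed

text \<open>The sum is A + B times a convex combination, with weights A/(A+B) and B/(A+B), of two
  functions of norm one, and |x|^p is convex. If a norm vanishes, its function is 0 almost
  everywhere.\<close>

lemma Lnorm_triangle:
  assumes p: "p \<ge> 1" and f: "memLp M p f" and g: "memLp M p g"
  shows "Lnorm M p (\<lambda>x. f x + g x) \<le> Lnorm M p f + Lnorm M p g"
proof -
  define A B where "A = Lnorm M p f" and "B = Lnorm M p g"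
  have [measurable]: "f \<in> borel_measurable M" "g \<in> borel_measurable M"
    using f g by (auto simp: memLp_def)
  have p0: "p > 0" using p by simp
  consider "A = 0" | "B = 0" | "A > 0" "B > 0"
    using Lnorm_nonneg[of M p f] Lnorm_nonneg[of M p g] unfolding A_def B_def by linarith
  then show ?thesis
  proof cases
    case 1
    then have "AE x in M. f x = 0" using Lnorm_eq_0_AE[OF p0 f] by (simp add: A_def)
    then have "Lnorm M p (\<lambda>x. f x + g x) = Lnorm M p g"
      by (intro Lnorm_cong_AE) auto
    then show ?thesis using Lnorm_nonneg[of M p f] by simp
  next
    case 2
    then have "AE x in M. g x = 0" using Lnorm_eq_0_AE[OF p0 g] by (simp add: B_def)
    then have "Lnorm M p (\<lambda>x. f x + g x) = Lnorm M p f"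
      by (intro Lnorm_cong_AE) auto
    then show ?thesis using Lnorm_nonneg[of M p g] by simp
  next
    case 3
    define s t where "s = A / (A + B)" and "t = B / (A + B)"
    have st: "s \<ge> 0" "t \<ge> 0" "s + t = 1" "s * (A + B) = A" "t * (A + B) = B"
      using 3 by (auto simp: s_def t_def simp flip: add_divide_distrib)
    have pw: "\<bar>f x + g x\<bar> powr p \<le> (A + B) powr p *
        (s * (\<bar>f x\<bar> powr p / A powr p) + t * (\<bar>g x\<bar> powr p / B powr p))" for x
    proof -
      have "\<bar>f x + g x\<bar> \<le> \<bar>f x\<bar> + \<bar>g x\<bar>" by simp
      also have "\<dots> = (A + B) * (s * (\<bar>f x\<bar> / A) + t * (\<bar>g x\<bar> / B))"
        using 3 by (simp add: s_def t_def distrib_left)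
      finally have "\<bar>f x + g x\<bar> powr p \<le> ((A + B) * (s * (\<bar>f x\<bar> / A) + t * (\<bar>g x\<bar> / B))) powr p"
        using p0 by (intro powr_mono2) auto
      also have "\<dots> = (A + B) powr p * (s * (\<bar>f x\<bar> / A) + t * (\<bar>g x\<bar> / B)) powr p"
        using 3 st by (simp add: powr_mult)
      also have "\<dots> \<le> (A + B) powr p * (s * (\<bar>f x\<bar> / A) powr p + t * (\<bar>g x\<bar> / B) powr p)"
        using 3 st p by (intro mult_left_mono powr_weighted_le) auto
      finally show ?thesis using 3 by (simp add: powr_divide)
    qed
    have "(\<integral>x. \<bar>f x + g x\<bar> powr p \<partial>M) \<le> (\<integral>x. (A + B) powr p *
        (s * (\<bar>f x\<bar> powr p / A powr p) + t * (\<bar>g x\<bar> powr p / B powr p)) \<partial>M)"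
      using f g pw by (intro integral_mono memLp_int[OF memLp_add]) (auto simp: memLp_def p0 less_imp_le)
    also have "\<dots> = (A + B) powr p * (s * (A powr p / A powr p) + t * (B powr p / B powr p))"
      using f g p0 by (simp add: memLp_def A_def B_def Lnorm_powr)
    also have "\<dots> = (A + B) powr p" using 3 st by simp
    finally show ?thesis
      unfolding A_def[symmetric] B_def[symmetric] using 3 p0 by (intro Lnorm_leI) auto
  qed
qed

lemma Lnorm_sum_le:
  assumes "p \<ge> 1" "\<And>i. i \<in> I \<Longrightarrow> memLp M p (f i)"
  shows "Lnorm M p (\<lambda>x. \<Sum>i\<in>I. f i x) \<le> (\<Sum>i\<in>I. Lnorm M p (f i))"
  using assms(2)
proof (induction I rule: infinite_finite_induct)
  case (insert i I)
  then have "Lnorm M p (\<lambda>x. f i x + (\<Sum>i\<in>I. f i x)) \<le> Lnorm M p (f i) + Lnorm M p (\<lambda>x. \<Sum>i\<in>I. f i x)"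
    using assms(1) by (intro Lnorm_triangle memLp_sum) auto
  with insert show ?case by auto
qed (auto simp: Lnorm_zero)

text \<open>The crude factor 2 avoids weighted exponents: once both norms are normalised to 1, the
  integrand is dominated by the sum of the two \<open>p\<close>-th powers.\<close>
lemma Holder_crude:
  assumes "a > 0" "b > 0" "p = a + b" "memLp M p f" "memLp M p g"
  shows "(\<integral>x. \<bar>f x\<bar> powr a * \<bar>g x\<bar> powr b \<partial>M) \<le> 2 * Lnorm M p f powr a * Lnorm M p g powr b"
proof -
  define A B where "A = Lnorm M p f" and "B = Lnorm M p g"
  have [measurable]: "f \<in> borel_measurable M" "g \<in> borel_measurable M"
    using assms by (auto simp: memLp_def)
  have p0: "p > 0" using assms by simp
  consider "A = 0 \<or> B = 0" | "A > 0" "B > 0"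
    using Lnorm_nonneg[of M p f] Lnorm_nonneg[of M p g] unfolding A_def B_def by linarith
  then show ?thesis
  proof cases
    case 1
    then have "(AE x in M. f x = 0) \<or> (AE x in M. g x = 0)"
      using Lnorm_eq_0_AE[OF p0] assms by (auto simp: A_def B_def)
    then have "AE x in M. \<bar>f x\<bar> powr a * \<bar>g x\<bar> powr b = 0" by auto
    then have "(\<integral>x. \<bar>f x\<bar> powr a * \<bar>g x\<bar> powr b \<partial>M) = 0"
      by (rule integral_eq_zero_AE)
    then show ?thesis by simp
  next
    case 2
    have pw: "\<bar>f x\<bar> powr a * \<bar>g x\<bar> powr b \<le>
        A powr a * B powr b * (\<bar>f x\<bar> powr p / A powr p + \<bar>g x\<bar> powr p / B powr p)" for x
    proof -
      have "(\<bar>f x\<bar> / A) powr a * (\<bar>g x\<bar> / B) powr b \<le> (\<bar>f x\<bar> / A) powr p + (\<bar>g x\<bar> / B) powr p"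
        unfolding assms(3) using 2 assms by (intro powr_mult_le_add_powr) auto
      then have "A powr a * B powr b * ((\<bar>f x\<bar> / A) powr a * (\<bar>g x\<bar> / B) powr b)
          \<le> A powr a * B powr b * ((\<bar>f x\<bar> / A) powr p + (\<bar>g x\<bar> / B) powr p)"
        by (intro mult_left_mono) auto
      also have "A powr a * B powr b * ((\<bar>f x\<bar> / A) powr a * (\<bar>g x\<bar> / B) powr b)
          = \<bar>f x\<bar> powr a * \<bar>g x\<bar> powr b" using 2 by (simp add: powr_divide)
      finally show ?thesis using 2 by (simp add: powr_divide)
    qed
    have "(\<integral>x. \<bar>f x\<bar> powr a * \<bar>g x\<bar> powr b \<partial>M) \<le>
        (\<integral>x. A powr a * B powr b * (\<bar>f x\<bar> powr p / A powr p + \<bar>g x\<bar> powr p / B powr p) \<partial>M)"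
      using assms pw by (intro integral_mono memLp_powr_mult_integrable) (auto simp: memLp_def)
    also have "\<dots> = A powr a * B powr b * (A powr p / A powr p + B powr p / B powr p)"
      using assms p0 by (simp add: memLp_def A_def B_def Lnorm_powr)
    also have "\<dots> = 2 * A powr a * B powr b" using 2 by simp
    finally show ?thesis unfolding A_def B_def .
  qed
qed

lemma (in prob_space) abs_integral_powr_le:
  assumes "p \<ge> 1" "memLp M p f"
  shows "\<bar>\<integral>x. f x \<partial>M\<bar> powr p \<le> (\<integral>x. \<bar>f x\<bar> powr p \<partial>M)"
  \<comment> \<open>The two \<open>undefined\<close> stand in the places of interval endpoints; the
    interval here is the whole line.\<close>
  using jensens_inequality[of f UNIV undefined undefined "\<lambda>x. \<bar>x\<bar> powr p"]
    memLp_integrable[OF assms] convex_on_abs_powr[OF assms(1)] memLp_int[OF assms(2)] by simp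

lemma memLp_2_iff: "memLp M 2 f \<longleftrightarrow> f \<in> borel_measurable M \<and> integrable M (\<lambda>x. (f x)\<^sup>2)"
  by (simp add: memLp_def)

lemma memLp_2_mult:
  assumes "memLp M 2 f" "memLp M 2 g"
  shows "integrable M (\<lambda>x. f x * g x)"
proof -
  have "integrable M (\<lambda>x. \<bar>f x\<bar> powr 1 * \<bar>g x\<bar> powr 1)"
    using assms by (intro memLp_powr_mult_integrable[of 1 1 2]) auto
  moreover have "f \<in> borel_measurable M" "g \<in> borel_measurable M" using assms by (auto simp: memLp_def)
  ultimately show ?thesis
    by (intro Bochner_Integration.integrable_bound[of M _ "\<lambda>x. f x * g x"]) (auto simp: abs_mult)
qed

text \<open>The integral of (t f + g)^2 is a nonnegative quadratic in t, so its discriminant is not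
  positive.\<close>

lemma Cauchy_Schwarz_Lnorm:
  assumes "memLp M 2 f" "memLp M 2 g"
  shows "\<bar>\<integral>x. f x * g x \<partial>M\<bar> \<le> Lnorm M 2 f * Lnorm M 2 g"
proof -
  define A B I where "A = (\<integral>x. (f x)\<^sup>2 \<partial>M)" and "B = (\<integral>x. (g x)\<^sup>2 \<partial>M)"
    and "I = (\<integral>x. f x * g x \<partial>M)"
  have "0 \<le> A * t\<^sup>2 + 2 * I * t + B" for t
  proof -
    have "0 \<le> (\<integral>x. (t * f x + g x)\<^sup>2 \<partial>M)" by simp
    also have "\<dots> = (\<integral>x. t\<^sup>2 * (f x)\<^sup>2 + 2 * t * (f x * g x) + (g x)\<^sup>2 \<partial>M)"
      by (simp add: power2_eq_square algebra_simps)
    also have "\<dots> = A * t\<^sup>2 + 2 * I * t + B"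
      using assms memLp_2_mult[OF assms] by (simp add: memLp_2_iff A_def B_def I_def)
    finally show ?thesis .
  qed
  note q = this
  have "A \<ge> 0" "B \<ge> 0" by (auto simp: A_def B_def)
  have "I\<^sup>2 \<le> A * B"
  proof (cases "A = 0")
    case True
    have "I = 0"
    proof (rule ccontr)
      assume "I \<noteq> 0"
      \<comment> \<open>With A = 0 the quadratic is linear, and this t gives it the value
        -1.\<close>
      then show False using q[of "- (B + 1) / (2 * I)"] True by simp
    qed
    then show ?thesis using True by simp
  next
    case False
    then have "A > 0" using \<open>A \<ge> 0\<close> by simp
    have "0 \<le> A * (A * (- I / A)\<^sup>2 + 2 * I * (- I / A) + B)"
      using q[of "- I / A"] \<open>A > 0\<close> by (intro mult_nonneg_nonneg) auto
    also have "\<dots> = A * B - I\<^sup>2" using False by (simp add: field_simps power2_eq_square)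
    finally show ?thesis by simp
  qed
  then have "\<bar>I\<bar> \<le> sqrt (A * B)" using real_le_rsqrt[of "\<bar>I\<bar>"] by simp
  also have "\<dots> = Lnorm M 2 f * Lnorm M 2 g"
    using \<open>A \<ge> 0\<close> \<open>B \<ge> 0\<close> by (simp add: Lnorm_def A_def B_def powr_half_sqrt real_sqrt_mult)
  finally show ?thesis by (simp add: I_def)
qed

section \<open>Martingale moment inequalities\<close>

lemma powr_near_1_le:
  fixes u b :: real
  assumes "1 / 2 \<le> u" "u \<le> 3 / 2"
  shows "u powr b \<le> 2 powr \<bar>b\<bar>"
proof (cases "b \<ge> 0")
  case True
  then show ?thesis using assms by (auto intro!: powr_mono2)
next
  case False
  have "u powr b \<le> (1 / 2) powr b" using False assms by (intro powr_mono2') auto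
  also have "\<dots> = 2 powr - b" by (simp add: powr_divide powr_minus field_simps)
  finally show ?thesis using False by simp
qed

lemma powr_near_1_lipschitz:
  fixes x b :: real
  assumes "\<bar>x\<bar> \<le> 1 / 2"
  shows "\<bar>(1 + x) powr b - 1\<bar> \<le> \<bar>b\<bar> * 2 powr \<bar>b - 1\<bar> * \<bar>x\<bar>"
proof -
  have "norm ((1 + x) powr b - (1 + 0) powr b) \<le> \<bar>b\<bar> * 2 powr \<bar>b - 1\<bar> * norm (x - 0)"
  proof (rule field_differentiable_bound[where S = "{-\<bar>x\<bar>..\<bar>x\<bar>}"
        and f = "\<lambda>x. (1 + x) powr b" and f' = "\<lambda>x. b * (1 + x) powr (b - 1)"])
    fix z assume z: "z \<in> {-\<bar>x\<bar>..\<bar>x\<bar>}"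
    then show "((\<lambda>x. (1 + x) powr b) has_field_derivative b * (1 + z) powr (b - 1))
        (at z within {-\<bar>x\<bar>..\<bar>x\<bar>})"
      using assms by (auto intro!: derivative_eq_intros)
    show "norm (b * (1 + z) powr (b - 1)) \<le> \<bar>b\<bar> * 2 powr \<bar>b - 1\<bar>"
      using z assms by (auto simp: abs_mult intro!: mult_left_mono powr_near_1_le)
  qed auto
  then show ?thesis by simp
qed

text \<open>The first summand bounds the second-order Taylor remainder of (1 + t)^\<alpha> for |t|
  \<le> 1/2, the next two absorb the power and the linear term for |t| > 1/2, and the final 1 covers
  a = 0 in \<open>abs_add_powr_expand\<close>.\<close>

definition mart_const :: "real \<Rightarrow> real" where
  "mart_const \<alpha> = \<alpha> * (\<alpha> - 1) * 2 powr \<bar>\<alpha> - 2\<bar> + 3 powr \<alpha> + \<alpha> * 2 powr \<alpha> + 1"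

lemma mart_const_ge_1: "\<alpha> > 1 \<Longrightarrow> mart_const \<alpha> \<ge> 1"
  by (simp add: mart_const_def)

text \<open>Taylor expansion near 0, domination by |t|^\<alpha> elsewhere. Keeping the regimes apart
  in the conclusion serves both ranges of \<alpha>: below 2 the small-t term t^2 is at most
  |t|^\<alpha>, above 2 the two terms are added.\<close>

lemma abs_one_plus_powr_le:
  fixes \<alpha> t :: real
  assumes \<alpha>: "\<alpha> > 1"
  shows "\<bar>1 + t\<bar> powr \<alpha> \<le> 1 + \<alpha> * t + mart_const \<alpha> * (if \<bar>t\<bar> \<le> 1 / 2 then t\<^sup>2 else \<bar>t\<bar> powr \<alpha>)"
proof (cases "\<bar>t\<bar> \<le> 1 / 2")
  case True
  define B where "B = \<alpha> * (\<alpha> - 1) * 2 powr \<bar>\<alpha> - 2\<bar>"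
  \<comment> \<open>The derivative of (1 + x)^\<alpha> - \<alpha> x vanishes at 0 and is Lipschitz
    near it, hence at most B |t| on the interval; the mean value bound gives B t^2.\<close>
  have "norm (((1 + t) powr \<alpha> - \<alpha> * t) - ((1 + 0) powr \<alpha> - \<alpha> * 0)) \<le> B * \<bar>t\<bar> * norm (t - 0)"
  proof (rule field_differentiable_bound[where S = "{-\<bar>t\<bar>..\<bar>t\<bar>}"
        and f = "\<lambda>x. (1 + x) powr \<alpha> - \<alpha> * x" and f' = "\<lambda>x. \<alpha> * (1 + x) powr (\<alpha> - 1) - \<alpha>"])
    fix z assume z: "z \<in> {-\<bar>t\<bar>..\<bar>t\<bar>}"
    then show "((\<lambda>x. (1 + x) powr \<alpha> - \<alpha> * x) has_field_derivative \<alpha> * (1 + z) powr (\<alpha> - 1) - \<alpha>)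
        (at z within {-\<bar>t\<bar>..\<bar>t\<bar>})"
      using True by (auto intro!: derivative_eq_intros)
    have "norm (\<alpha> * (1 + z) powr (\<alpha> - 1) - \<alpha>) = \<alpha> * \<bar>(1 + z) powr (\<alpha> - 1) - 1\<bar>"
      using \<alpha> abs_mult[of \<alpha> "(1 + z) powr (\<alpha> - 1) - 1"] by (simp add: right_diff_distrib)
    also have "\<dots> \<le> \<alpha> * (\<bar>\<alpha> - 1\<bar> * 2 powr \<bar>\<alpha> - 1 - 1\<bar> * \<bar>z\<bar>)"
      using z True \<alpha> by (intro mult_left_mono powr_near_1_lipschitz) auto
    also have "\<dots> = B * \<bar>z\<bar>" using \<alpha> by (simp add: B_def)
    also have "\<dots> \<le> B * \<bar>t\<bar>" using z \<alpha> by (intro mult_left_mono) (auto simp: B_def)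
    finally show "norm (\<alpha> * (1 + z) powr (\<alpha> - 1) - \<alpha>) \<le> B * \<bar>t\<bar>" .
  qed auto
  then have "(1 + t) powr \<alpha> - \<alpha> * t - 1 \<le> B * t\<^sup>2"
    by (simp add: power2_eq_square abs_mult_self_eq mult.assoc)
  also have "\<dots> \<le> mart_const \<alpha> * t\<^sup>2"
    using \<alpha> by (intro mult_right_mono) (auto simp: mart_const_def B_def)
  finally have "(1 + t) powr \<alpha> \<le> 1 + \<alpha> * t + mart_const \<alpha> * t\<^sup>2" by linarith
  moreover have "\<bar>1 + t\<bar> = 1 + t" using True by linarith
  ultimately show ?thesis using True by simp
next
  case False
  have "\<bar>1 + t\<bar> powr \<alpha> \<le> (3 * \<bar>t\<bar>) powr \<alpha>" using False \<alpha> by (intro powr_mono2) auto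
  then have 1: "\<bar>1 + t\<bar> powr \<alpha> \<le> 3 powr \<alpha> * \<bar>t\<bar> powr \<alpha>" by (simp add: powr_mult)
  \<comment> \<open>As 2|t| exceeds 1, it is below its own \<alpha>-th power; this absorbs the
    linear term.\<close>
  have "2 * \<bar>t\<bar> \<le> (2 * \<bar>t\<bar>) powr \<alpha>" using False \<alpha> powr_mono[of 1 \<alpha> "2 * \<bar>t\<bar>"] by simp
  then have "\<bar>t\<bar> \<le> 2 powr \<alpha> * \<bar>t\<bar> powr \<alpha>" by (simp add: powr_mult)
  then have a: "\<alpha> * \<bar>t\<bar> \<le> \<alpha> * (2 powr \<alpha> * \<bar>t\<bar> powr \<alpha>)" using \<alpha> by (intro mult_left_mono) auto
  have "\<alpha> * (- t) \<le> \<alpha> * \<bar>t\<bar>" using \<alpha> by (intro mult_left_mono) auto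
  then have 2: "- (\<alpha> * t) \<le> \<alpha> * 2 powr \<alpha> * \<bar>t\<bar> powr \<alpha>"
    using a by simp
  have "(3 powr \<alpha> + \<alpha> * 2 powr \<alpha>) * \<bar>t\<bar> powr \<alpha> \<le> mart_const \<alpha> * \<bar>t\<bar> powr \<alpha>"
    using \<alpha> by (intro mult_right_mono) (auto simp: mart_const_def)
  then show ?thesis using 1 2 False by (simp add: distrib_right)
qed

text \<open>The inequality for 1 + t at t = b/a, multiplied by |a|^\<alpha>. The linear term is the
  derivative of |x|^\<alpha> at a: with a a partial martingale sum and b its next difference, it
  integrates to 0.\<close>

lemma abs_add_powr_expand:
  fixes a b \<alpha> :: real
  assumes \<alpha>: "\<alpha> > 1"
  shows "\<alpha> \<le> 2 \<Longrightarrow> \<bar>a + b\<bar> powr \<alpha> \<le>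
           \<bar>a\<bar> powr \<alpha> + \<alpha> * (sgn a * \<bar>a\<bar> powr (\<alpha> - 1) * b) + mart_const \<alpha> * \<bar>b\<bar> powr \<alpha>"
    and "\<alpha> \<ge> 2 \<Longrightarrow> \<bar>a + b\<bar> powr \<alpha> \<le>
           \<bar>a\<bar> powr \<alpha> + \<alpha> * (sgn a * \<bar>a\<bar> powr (\<alpha> - 1) * b)
             + mart_const \<alpha> * (\<bar>a\<bar> powr (\<alpha> - 2) * b\<^sup>2 + \<bar>b\<bar> powr \<alpha>)"
proof -
  have zero: "\<bar>b\<bar> powr \<alpha> \<le> mart_const \<alpha> * \<bar>b\<bar> powr \<alpha>"
    using mult_right_mono[OF mart_const_ge_1[OF \<alpha>], of "\<bar>b\<bar> powr \<alpha>"] by simp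
  define t where "t = b / a"
  have key: "\<bar>a + b\<bar> powr \<alpha> \<le> \<bar>a\<bar> powr \<alpha> + \<alpha> * (sgn a * \<bar>a\<bar> powr (\<alpha> - 1) * b)
      + mart_const \<alpha> * R"
    if "a \<noteq> 0" "\<bar>a\<bar> powr \<alpha> * (if \<bar>t\<bar> \<le> 1 / 2 then t\<^sup>2 else \<bar>t\<bar> powr \<alpha>) \<le> R" for R
  proof -
    have "\<bar>a + b\<bar> powr \<alpha> = \<bar>a\<bar> powr \<alpha> * \<bar>1 + t\<bar> powr \<alpha>"
      using that(1) by (simp add: t_def powr_mult[symmetric] abs_mult[symmetric] distrib_left)
    also have "\<dots> \<le> \<bar>a\<bar> powr \<alpha> *
        (1 + \<alpha> * t + mart_const \<alpha> * (if \<bar>t\<bar> \<le> 1 / 2 then t\<^sup>2 else \<bar>t\<bar> powr \<alpha>))"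
      using \<alpha> by (intro mult_left_mono abs_one_plus_powr_le) auto
    also have "\<dots> = \<bar>a\<bar> powr \<alpha> + \<alpha> * (\<bar>a\<bar> powr \<alpha> * t)
        + mart_const \<alpha> * (\<bar>a\<bar> powr \<alpha> * (if \<bar>t\<bar> \<le> 1 / 2 then t\<^sup>2 else \<bar>t\<bar> powr \<alpha>))"
      by (simp only: distrib_left mult.assoc mult.left_commute mult_1_right)
    also have "\<bar>a\<bar> powr \<alpha> * t = sgn a * \<bar>a\<bar> powr (\<alpha> - 1) * b"
      using that(1) by (simp add: t_def powr_diff sgn_if field_simps)
    finally show ?thesis
      using mult_left_mono[OF that(2), of "mart_const \<alpha>"] mart_const_ge_1[OF \<alpha>] by linarith
  qed
  have bt: "\<bar>a\<bar> powr \<alpha> * \<bar>t\<bar> powr \<alpha> = \<bar>b\<bar> powr \<alpha>" if "a \<noteq> 0"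
    using that by (simp add: t_def powr_divide)
  show "\<bar>a + b\<bar> powr \<alpha> \<le> \<bar>a\<bar> powr \<alpha> + \<alpha> * (sgn a * \<bar>a\<bar> powr (\<alpha> - 1) * b)
      + mart_const \<alpha> * \<bar>b\<bar> powr \<alpha>" if "\<alpha> \<le> 2"
  proof (cases "a = 0")
    case False
    have "t\<^sup>2 \<le> \<bar>t\<bar> powr \<alpha>" if "\<bar>t\<bar> \<le> 1 / 2"
      using that \<alpha> \<open>\<alpha> \<le> 2\<close> powr_mono'[of \<alpha> 2 "\<bar>t\<bar>"] by (cases "t = 0") auto
    then have "\<bar>a\<bar> powr \<alpha> * (if \<bar>t\<bar> \<le> 1 / 2 then t\<^sup>2 else \<bar>t\<bar> powr \<alpha>) \<le> \<bar>a\<bar> powr \<alpha> * \<bar>t\<bar> powr \<alpha>"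
      by (intro mult_left_mono) auto
    then show ?thesis using key[OF False] bt[OF False] by simp
  qed (use zero in simp)
  show "\<bar>a + b\<bar> powr \<alpha> \<le> \<bar>a\<bar> powr \<alpha> + \<alpha> * (sgn a * \<bar>a\<bar> powr (\<alpha> - 1) * b)
      + mart_const \<alpha> * (\<bar>a\<bar> powr (\<alpha> - 2) * b\<^sup>2 + \<bar>b\<bar> powr \<alpha>)" if "\<alpha> \<ge> 2"
  proof (cases "a = 0")
    case False
    have "\<bar>a\<bar> powr \<alpha> * (if \<bar>t\<bar> \<le> 1 / 2 then t\<^sup>2 else \<bar>t\<bar> powr \<alpha>)
        \<le> \<bar>a\<bar> powr \<alpha> * (t\<^sup>2 + \<bar>t\<bar> powr \<alpha>)"
      by (intro mult_left_mono) auto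
    also have "\<dots> = \<bar>a\<bar> powr (\<alpha> - 2) * b\<^sup>2 + \<bar>b\<bar> powr \<alpha>"
      using False bt[OF False] by (simp add: distrib_left t_def powr_diff power_divide)
    finally show ?thesis using key[OF False] by simp
  qed (use zero in simp)
qed

text \<open>The two lower bounds that absorb the induction step of \<open>Rio_martingale\<close>:
  Bernoulli's inequality for the cross term, superadditivity for the last difference.\<close>

lemma powr_add_ge:
  fixes x y h :: real
  assumes "x \<ge> 0" "y \<ge> 0" "h \<ge> 1"
  shows "x powr h + h * (x powr (h - 1) * y) \<le> (x + y) powr h"
    and "x powr h + y powr h \<le> (x + y) powr h"
proof -
  show "x powr h + h * (x powr (h - 1) * y) \<le> (x + y) powr h"
  proof (cases "x = 0")
    case False
    define u where "u = 1 + y / x"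
    have u: "u \<ge> 1" using assms False by (simp add: u_def)
    \<comment> \<open>Young's inequality with second factor 1 is Bernoulli's inequality u \<le>
      u^h/h + 1 - 1/h.\<close>
    have "(u powr h) powr (1 / h) * 1 powr (1 - 1 / h) \<le> 1 / h * (u powr h) + (1 - 1 / h) * 1"
      using u assms by (intro Youngs_inequality_0) auto
    then have "u \<le> u powr h / h + 1 - 1 / h" using u assms by (simp add: powr_powr)
    then have "h * u \<le> h * (u powr h / h + 1 - 1 / h)" using assms by (intro mult_left_mono) auto
    also have "\<dots> = u powr h + h - 1" using assms(3) by (simp add: distrib_left right_diff_distrib)
    finally have le: "1 + h * (y / x) \<le> u powr h" unfolding u_def by (simp only: distrib_left mult_1_right)
    have "x powr h + h * (x powr (h - 1) * y) = x powr h * (1 + h * (y / x))"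
      using False assms(1) by (simp add: powr_diff distrib_left)
    also have "\<dots> \<le> x powr h * u powr h" using le by (intro mult_left_mono) auto
    also have "\<dots> = (x * u) powr h" using u assms(1) by (simp add: powr_mult)
    also have "x * u = x + y" using False by (simp add: u_def distrib_left)
    finally show ?thesis .
  qed simp
  have split: "z powr h = z * z powr (h - 1)" if "z \<ge> 0" for z :: real
    using that by (cases "z = 0") (auto simp: powr_diff)
  have "x powr h + y powr h = x * x powr (h - 1) + y * y powr (h - 1)"
    using split assms by simp
  also have "\<dots> \<le> x * (x + y) powr (h - 1) + y * (x + y) powr (h - 1)"
    using assms by (intro add_mono mult_left_mono powr_mono2) auto
  also have "\<dots> = (x + y) powr h" using split[of "x + y"] assms by (simp add: distrib_right)
  finally show "x powr h + y powr h \<le> (x + y) powr h" .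
qed

lemma orthogonal_integrable:
  assumes "p > 1" "memLp M p f" "memLp M p g"
  shows "integrable M (\<lambda>x. sgn (f x) * \<bar>f x\<bar> powr (p - 1) * g x)"
proof -
  have [measurable]: "f \<in> borel_measurable M" "g \<in> borel_measurable M"
    using assms by (auto simp: memLp_def)
  have "integrable M (\<lambda>x. \<bar>f x\<bar> powr (p - 1) * \<bar>g x\<bar> powr 1)"
    using assms by (intro memLp_powr_mult_integrable[of _ _ p]) auto
  then show ?thesis
    by (rule Bochner_Integration.integrable_bound) (auto simp: abs_mult sgn_if)
qed

text \<open>Of the martingale property of the partial sums only the orthogonality \<open>orth\<close> is needed.\<close>

lemma von_Bahr_Esseen:
  fixes D :: "nat \<Rightarrow> 'a \<Rightarrow> real"
  assumes p: "1 < p" "p \<le> 2"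
    and D: "\<And>i. i < n \<Longrightarrow> memLp M p (D i)"
    and orth: "\<And>k. k < n \<Longrightarrow>
      (\<integral>x. sgn (\<Sum>i<k. D i x) * \<bar>\<Sum>i<k. D i x\<bar> powr (p - 1) * D k x \<partial>M) = 0"
  shows "(\<integral>x. \<bar>\<Sum>i<n. D i x\<bar> powr p \<partial>M) \<le> mart_const p * (\<Sum>i<n. Lnorm M p (D i) powr p)"
  using D orth
proof (induction n)
  case (Suc n)
  let ?S = "\<lambda>x. \<Sum>i<n. D i x"
  have S: "memLp M p ?S" using Suc.prems p by (intro memLp_sum) auto
  have Dn: "memLp M p (D n)" using Suc.prems by auto
  note int = orthogonal_integrable[OF p(1) S Dn] memLp_int[OF S] memLp_int[OF Dn]
  have "(\<integral>x. \<bar>?S x + D n x\<bar> powr p \<partial>M) \<le> (\<integral>x. \<bar>?S x\<bar> powr p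
      + p * (sgn (?S x) * \<bar>?S x\<bar> powr (p - 1) * D n x) + mart_const p * \<bar>D n x\<bar> powr p \<partial>M)"
    using int p S Dn by (intro integral_mono abs_add_powr_expand(1) memLp_int[OF memLp_add]) auto
  also have "\<dots> = (\<integral>x. \<bar>?S x\<bar> powr p \<partial>M)
      + p * (\<integral>x. sgn (?S x) * \<bar>?S x\<bar> powr (p - 1) * D n x \<partial>M) + mart_const p * Lnorm M p (D n) powr p"
    using int p by (simp add: Lnorm_powr)
  also have "(\<integral>x. sgn (?S x) * \<bar>?S x\<bar> powr (p - 1) * D n x \<partial>M) = 0" using Suc.prems by auto
  also have "(\<integral>x. \<bar>?S x\<bar> powr p \<partial>M) \<le> mart_const p * (\<Sum>i<n. Lnorm M p (D i) powr p)"
    using Suc by auto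
  finally show ?case by (simp add: distrib_left)
qed simp

text \<open>The second-order term is bounded by Hoelder's inequality through the norm of the partial
  sum, to which the induction hypothesis applies. The increase must then fit into (K A + K s)^h - (K
  A)^h, with h = p/2, A the sum of squared norms so far and s the new square.\<close>

lemma Rio_martingale:
  fixes D :: "nat \<Rightarrow> 'a \<Rightarrow> real"
  assumes p: "2 < p"
    and D: "\<And>i. i < n \<Longrightarrow> memLp M p (D i)"
    and orth: "\<And>k. k < n \<Longrightarrow>
      (\<integral>x. sgn (\<Sum>i<k. D i x) * \<bar>\<Sum>i<k. D i x\<bar> powr (p - 1) * D k x \<partial>M) = 0"
  shows "(\<integral>x. \<bar>\<Sum>i<n. D i x\<bar> powr p \<partial>M) \<le>
    (4 * mart_const p * (\<Sum>i<n. (Lnorm M p (D i))\<^sup>2)) powr (p / 2)"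
  using D orth
proof (induction n)
  case (Suc n)
  let ?S = "\<lambda>x. \<Sum>i<n. D i x"
  define C K A s h where "C = mart_const p" and "K = 4 * mart_const p"
    and "A = (\<Sum>i<n. (Lnorm M p (D i))\<^sup>2)" and "s = (Lnorm M p (D n))\<^sup>2" and "h = p / 2"
  have C: "C \<ge> 1" and K: "K \<ge> 1" "K = 4 * C"
    using mart_const_ge_1[of p] p by (auto simp: C_def K_def)
  have h: "h > 1" and A: "A \<ge> 0" and s: "s \<ge> 0" using p by (auto simp: h_def A_def s_def sum_nonneg)
  have S: "memLp M p ?S" using Suc.prems p by (intro memLp_sum) auto
  have Dn: "memLp M p (D n)" using Suc.prems by auto
  have IH: "(\<integral>x. \<bar>?S x\<bar> powr p \<partial>M) \<le> (K * A) powr h"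
    using Suc by (auto simp: K_def A_def h_def)
  have "Lnorm M p ?S \<le> (K * A) powr (1 / 2)"
    using IH p h by (intro Lnorm_leI) (auto simp: powr_powr h_def)
  then have "Lnorm M p ?S powr (p - 2) \<le> ((K * A) powr (1 / 2)) powr (p - 2)"
    using p Lnorm_nonneg by (intro powr_mono2) auto
  also have "\<dots> = (K * A) powr (h - 1)" by (simp add: powr_powr h_def field_simps)
  finally have Sh: "Lnorm M p ?S powr (p - 2) \<le> (K * A) powr (h - 1)" .
  have Dh: "Lnorm M p (D n) powr p = s powr h"
    using Lnorm_nonneg[of M p "D n"] by (simp add: s_def h_def powr_powr flip: powr_numeral)
  have int3: "integrable M (\<lambda>x. \<bar>?S x\<bar> powr (p - 2) * (D n x)\<^sup>2)"
    using memLp_powr_mult_integrable[of "p - 2" 2 p M ?S "D n"] p S Dn by simp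
  have hold: "(\<integral>x. \<bar>?S x\<bar> powr (p - 2) * (D n x)\<^sup>2 \<partial>M) \<le> 2 * (K * A) powr (h - 1) * s"
  proof -
    have "(\<integral>x. \<bar>?S x\<bar> powr (p - 2) * (D n x)\<^sup>2 \<partial>M) \<le> 2 * Lnorm M p ?S powr (p - 2) * s"
      using Holder_crude[of "p - 2" 2 p M ?S "D n"] p S Dn Lnorm_nonneg[of M p "D n"]
      by (simp add: s_def)
    also have "\<dots> \<le> 2 * (K * A) powr (h - 1) * s"
      using Sh s by (intro mult_right_mono mult_left_mono) auto
    finally show ?thesis .
  qed
  note int = orthogonal_integrable[OF _ S Dn] memLp_int[OF S] memLp_int[OF Dn] int3
  have "(\<integral>x. \<bar>?S x + D n x\<bar> powr p \<partial>M) \<le> (\<integral>x. \<bar>?S x\<bar> powr p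
      + p * (sgn (?S x) * \<bar>?S x\<bar> powr (p - 1) * D n x)
      + C * (\<bar>?S x\<bar> powr (p - 2) * (D n x)\<^sup>2 + \<bar>D n x\<bar> powr p) \<partial>M)"
    unfolding C_def
    using int p S Dn by (intro integral_mono abs_add_powr_expand(2) memLp_int[OF memLp_add]) auto
  also have "\<dots> = (\<integral>x. \<bar>?S x\<bar> powr p \<partial>M)
      + p * (\<integral>x. sgn (?S x) * \<bar>?S x\<bar> powr (p - 1) * D n x \<partial>M)
      + C * ((\<integral>x. \<bar>?S x\<bar> powr (p - 2) * (D n x)\<^sup>2 \<partial>M) + s powr h)"
    using int p by (simp add: Lnorm_powr flip: Dh)
  also have "(\<integral>x. sgn (?S x) * \<bar>?S x\<bar> powr (p - 1) * D n x \<partial>M) = 0" using Suc.prems by auto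
  also have "(\<integral>x. \<bar>?S x\<bar> powr p \<partial>M) + p * 0
      + C * ((\<integral>x. \<bar>?S x\<bar> powr (p - 2) * (D n x)\<^sup>2 \<partial>M) + s powr h)
      \<le> (K * A) powr h + p * 0 + C * (2 * (K * A) powr (h - 1) * s + s powr h)"
    using IH hold C p by (intro add_mono mult_left_mono) auto
  also have "\<dots> \<le> (K * A + K * s) powr h"
  proof -
    \<comment> \<open>The target dominates the average of the left sides of 1 and 2: the cross term
      takes half of the Bernoulli gain, the new difference half of the superadditive one. Hence K =
      4C, a factor 2 for \<open>Holder_crude\<close> and a factor 2 for the halving.\<close>
    have 1: "(K * A) powr h + h * ((K * A) powr (h - 1) * (K * s)) \<le> (K * A + K * s) powr h"
      and 2: "(K * A) powr h + (K * s) powr h \<le> (K * A + K * s) powr h"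
      using powr_add_ge[of "K * A" "K * s" h] K A s h by auto
    have "1 * ((K * A) powr (h - 1) * (K * s)) \<le> h * ((K * A) powr (h - 1) * (K * s))"
      using h K A s by (intro mult_right_mono mult_nonneg_nonneg) auto
    then have 3: "C * (2 * (K * A) powr (h - 1) * s) \<le> h * ((K * A) powr (h - 1) * (K * s)) / 2"
      using K by (simp add: algebra_simps)
    have "K powr 1 \<le> K powr h" using K h by (intro powr_mono) auto
    then have "K * s powr h \<le> K powr h * s powr h" using K by (intro mult_right_mono) auto
    moreover have "0 \<le> C * s powr h" using C by simp
    moreover have "K * s powr h = 4 * (C * s powr h)" by (simp add: K(2))
    moreover have "(K * s) powr h = K powr h * s powr h" using K(1) s by (simp add: powr_mult)
    ultimately have 4: "C * s powr h \<le> (K * s) powr h / 2" by linarith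
    show ?thesis using 1 2 3 4 by (simp add: distrib_left)
  qed
  finally show ?case by (simp add: distrib_left K_def A_def s_def h_def)
qed simp

section \<open>Conditional expectations on the product space\<close>

text \<open>x holds the retained coordinates and y the fresh ones: integrating over y gives a
  conditional expectation, sampling y a coupled copy.\<close>

definition mix :: "int set \<Rightarrow> (int \<Rightarrow> 'b) \<Rightarrow> (int \<Rightarrow> 'b) \<Rightarrow> int \<Rightarrow> 'b" where
  "mix S x y j = (if j \<in> S then x j else y j)"

lemma mix_mix_left: "mix S (mix S x y) z = mix S x z"
  by (auto simp: mix_def)

text \<open>Conditioning twice retains only the common coordinates; the tower property comes from
  here.\<close>

lemma mix_mix: "mix T (mix S x y) z = mix (S \<inter> T) x (mix T y z)"
  by (auto simp: mix_def)

text \<open>For \<open>P\<close> the law of an i.i.d. sequence, this is a concrete version of the conditional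
  expectation given the coordinates in \<open>S\<close>.\<close>

definition cex :: "(int \<Rightarrow> 'b) measure \<Rightarrow> int set \<Rightarrow> ((int \<Rightarrow> 'b) \<Rightarrow> real) \<Rightarrow> (int \<Rightarrow> 'b) \<Rightarrow> real" where
  "cex P S f x = (\<integral>y. f (mix S x y) \<partial>P)"

text \<open>A pointwise form of measurability with respect to the coordinates in S. It quantifies
  over all sequences, not only those in the space of the product measure, so it rewrites without
  side conditions.\<close>

definition depends_on :: "int set \<Rightarrow> ((int \<Rightarrow> 'b) \<Rightarrow> 'c) \<Rightarrow> bool" where
  "depends_on S h \<longleftrightarrow> (\<forall>x y. h (mix S x y) = h x)"

lemma depends_onD: "depends_on S h \<Longrightarrow> h (mix S x y) = h x"
  by (simp add: depends_on_def)

lemma depends_on_mono: "depends_on S h \<Longrightarrow> S \<subseteq> T \<Longrightarrow> depends_on T h"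
  unfolding depends_on_def by (metis inf.absorb_iff2 inf_commute mix_mix)

lemma depends_on_cex: "depends_on S (cex P S f)"
  by (simp add: depends_on_def cex_def mix_mix_left)

text \<open>The \<open>L\<^sup>p\<close> distance between \<open>f\<close> and its version with coordinate \<open>j\<close> replaced by an
  independent copy.\<close>

definition coupled_norm :: "(int \<Rightarrow> 'b) measure \<Rightarrow> real \<Rightarrow> int \<Rightarrow> ((int \<Rightarrow> 'b) \<Rightarrow> real) \<Rightarrow> real" where
  "coupled_norm P p j f = Lnorm (P \<Otimes>\<^sub>M P) p (\<lambda>z. f (fst z) - f (mix (- {j}) (fst z) (snd z)))"

definition shiftseq :: "int \<Rightarrow> (int \<Rightarrow> 'b) \<Rightarrow> int \<Rightarrow> 'b" where
  "shiftseq k x j = x (j + k)"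

text \<open>Jensen's inequality on almost every fibre, then Fubini. It yields both the contraction
  property of \<open>cex\<close> and the passage from projections to coupled differences.\<close>

lemma (in pair_prob_space) Lnorm_integral_le:
  assumes p: "p \<ge> 1" and F: "memLp (M1 \<Otimes>\<^sub>M M2) p F"
  shows "memLp M1 p (\<lambda>x. \<integral>y. F (x, y) \<partial>M2)"
    and "Lnorm M1 p (\<lambda>x. \<integral>y. F (x, y) \<partial>M2) \<le> Lnorm (M1 \<Otimes>\<^sub>M M2) p F"
proof -
  have [measurable]: "F \<in> borel_measurable (M1 \<Otimes>\<^sub>M M2)" using F by (simp add: memLp_def)
  have int: "integrable (M1 \<Otimes>\<^sub>M M2) (\<lambda>z. \<bar>F z\<bar> powr p)" using F by (simp add: memLp_def)
  have "AE x in M1. integrable M2 (\<lambda>y. \<bar>F (x, y)\<bar> powr p)"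
    using AE_integrable_fst'[OF int] by simp
  then have le: "AE x in M1. \<bar>\<integral>y. F (x, y) \<partial>M2\<bar> powr p \<le> (\<integral>y. \<bar>F (x, y)\<bar> powr p \<partial>M2)"
    using AE_space
  proof eventually_elim
    case (elim x)
    then have "memLp M2 p (\<lambda>y. F (x, y))" by (auto simp: memLp_def)
    then show ?case by (rule M2.abs_integral_powr_le[OF p])
  qed
  have int2: "integrable M1 (\<lambda>x. \<integral>y. \<bar>F (x, y)\<bar> powr p \<partial>M2)" using integrable_fst'[OF int] by simp
  have ae: "AE x in M1. norm (\<bar>\<integral>y. F (x, y) \<partial>M2\<bar> powr p) \<le> norm (\<integral>y. \<bar>F (x, y)\<bar> powr p \<partial>M2)"
    using le by eventually_elim auto
  have int3: "integrable M1 (\<lambda>x. \<bar>\<integral>y. F (x, y) \<partial>M2\<bar> powr p)"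
    by (rule Bochner_Integration.integrable_bound[OF int2 _ ae]) auto
  then show "memLp M1 p (\<lambda>x. \<integral>y. F (x, y) \<partial>M2)" by (simp add: memLp_def)
  have "(\<integral>x. \<bar>\<integral>y. F (x, y) \<partial>M2\<bar> powr p \<partial>M1) \<le> (\<integral>x. (\<integral>y. \<bar>F (x, y)\<bar> powr p \<partial>M2) \<partial>M1)"
    using int3 int2 le by (rule integral_mono_AE)
  also have "\<dots> = Lnorm (M1 \<Otimes>\<^sub>M M2) p F powr p"
    using integral_fst'[OF int] p by (simp add: Lnorm_powr)
  finally show "Lnorm M1 p (\<lambda>x. \<integral>y. F (x, y) \<partial>M2) \<le> Lnorm (M1 \<Otimes>\<^sub>M M2) p F"
    using p Lnorm_nonneg by (intro Lnorm_leI) auto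
qed

locale iid_seq = Q: prob_space Q for Q :: "'b measure"
begin

abbreviation P :: "(int \<Rightarrow> 'b) measure" where
  "P \<equiv> Pi\<^sub>M UNIV (\<lambda>_. Q)"

sublocale prod: product_prob_space "\<lambda>_::int. Q" UNIV
  by unfold_locales

sublocale pair: pair_prob_space P P
  by unfold_locales

lemma measurable_mix [measurable (raw)]:
  assumes [measurable]: "f \<in> M \<rightarrow>\<^sub>M P" "g \<in> M \<rightarrow>\<^sub>M P"
  shows "(\<lambda>w. mix S (f w) (g w)) \<in> M \<rightarrow>\<^sub>M P"
proof (rule measurable_PiM_single')
  fix j
  show "(\<lambda>w. mix S (f w) (g w) j) \<in> M \<rightarrow>\<^sub>M Q"
    by (cases "j \<in> S") (simp_all add: mix_def)
next
  show "(\<lambda>w i. mix S (f w) (g w) i) \<in> space M \<rightarrow> (UNIV \<rightarrow>\<^sub>E space Q)"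
    using measurable_space[OF assms(1)] measurable_space[OF assms(2)]
    by (auto simp: mix_def space_PiM PiE_iff)
qed

lemma mix_space: "x \<in> space P \<Longrightarrow> y \<in> space P \<Longrightarrow> mix S x y \<in> space P"
  by (auto simp: mix_def space_PiM PiE_iff)

text \<open>Splicing two independent copies gives the law \<open>P\<close> again. On a cylinder over
  J the coordinates in S come from the first copy and the others from the second, so the two
  probabilities multiply.\<close>

lemma distr_mix: "distr (P \<Otimes>\<^sub>M P) P (\<lambda>z. mix S (fst z) (snd z)) = P"
proof (rule prod.PiM_eq)
  fix J :: "int set" and F
  assume J: "finite J" and F: "\<And>j. j \<in> J \<Longrightarrow> F j \<in> sets Q"
  let ?A = "\<lambda>K. {x \<in> space P. \<forall>i\<in>K. x i \<in> F i}"
  have A: "?A K \<in> sets P" "emeasure P (?A K) = (\<Prod>i\<in>K. emeasure Q (F i))" if "K \<subseteq> J" for K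
  proof -
    have "finite K" using that J finite_subset by blast
    then show "emeasure P (?A K) = (\<Prod>i\<in>K. emeasure Q (F i))"
      using that F by (intro prod.emeasure_PiM_Collect) auto
    have "?A K = prod_emb UNIV (\<lambda>_. Q) K (Pi\<^sub>E K F)"
      using \<open>finite K\<close> by (auto simp: prod_emb_def space_PiM Pi_iff)
    then show "?A K \<in> sets P" using \<open>finite K\<close> that F by (auto intro!: sets_PiM_I)
  qed
  have emb: "prod_emb UNIV (\<lambda>_. Q) J (Pi\<^sub>E J F) = ?A J"
    using J by (auto simp: prod_emb_def space_PiM Pi_iff)
  have "(\<lambda>z. mix S (fst z) (snd z)) -` ?A J \<inter> space (P \<Otimes>\<^sub>M P) = ?A (J \<inter> S) \<times> ?A (J - S)"
    by (auto simp: space_pair_measure mix_space mix_def split: if_splits)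
  then have "emeasure (distr (P \<Otimes>\<^sub>M P) P (\<lambda>z. mix S (fst z) (snd z))) (?A J)
      = emeasure (P \<Otimes>\<^sub>M P) (?A (J \<inter> S) \<times> ?A (J - S))"
    using A(1)[of J] by (subst emeasure_distr) auto
  also have "\<dots> = emeasure P (?A (J \<inter> S)) * emeasure P (?A (J - S))"
    using A(1)[of "J \<inter> S"] A(1)[of "J - S"] by (intro prod.P.emeasure_pair_measure_Times) auto
  also have "\<dots> = (\<Prod>i\<in>J \<inter> S. emeasure Q (F i)) * (\<Prod>i\<in>J - S. emeasure Q (F i))"
    using A(2)[of "J \<inter> S"] A(2)[of "J - S"] by simp
  also have "\<dots> = (\<Prod>i\<in>J. emeasure Q (F i))" using J by (simp flip: prod.Int_Diff)
  finally show "emeasure (distr (P \<Otimes>\<^sub>M P) P (\<lambda>z. mix S (fst z) (snd z)))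
      (prod_emb UNIV (\<lambda>_. Q) J (Pi\<^sub>E J F)) = (\<Prod>i\<in>J. emeasure Q (F i))" by (simp add: emb)
qed simp

lemma
  fixes f :: "(int \<Rightarrow> 'b) \<Rightarrow> real"
  assumes "integrable P f"
  shows integrable_mix: "integrable (P \<Otimes>\<^sub>M P) (\<lambda>z. f (mix S (fst z) (snd z)))"
    and integral_mix: "(\<integral>z. f (mix S (fst z) (snd z)) \<partial>(P \<Otimes>\<^sub>M P)) = (\<integral>x. f x \<partial>P)"
proof -
  have [measurable]: "f \<in> borel_measurable P" using assms by auto
  have "integrable (distr (P \<Otimes>\<^sub>M P) P (\<lambda>z. mix S (fst z) (snd z))) f"
    by (simp add: distr_mix assms)
  then show "integrable (P \<Otimes>\<^sub>M P) (\<lambda>z. f (mix S (fst z) (snd z)))"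
    by (simp add: integrable_distr_eq)
  have "(\<integral>x. f x \<partial>P) = (\<integral>x. f x \<partial>(distr (P \<Otimes>\<^sub>M P) P (\<lambda>z. mix S (fst z) (snd z))))"
    by (simp add: distr_mix)
  also have "\<dots> = (\<integral>z. f (mix S (fst z) (snd z)) \<partial>(P \<Otimes>\<^sub>M P))"
    by (subst integral_distr) auto
  finally show "(\<integral>z. f (mix S (fst z) (snd z)) \<partial>(P \<Otimes>\<^sub>M P)) = (\<integral>x. f x \<partial>P)" by simp
qed

lemma memLp_mix:
  assumes "memLp P p f"
  shows "memLp (P \<Otimes>\<^sub>M P) p (\<lambda>z. f (mix S (fst z) (snd z)))"
    and "Lnorm (P \<Otimes>\<^sub>M P) p (\<lambda>z. f (mix S (fst z) (snd z))) = Lnorm P p f"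
proof -
  have [measurable]: "f \<in> borel_measurable P" using assms by (simp add: memLp_def)
  show "memLp (P \<Otimes>\<^sub>M P) p (\<lambda>z. f (mix S (fst z) (snd z)))"
    using assms memLp_distr[of "\<lambda>z. mix S (fst z) (snd z)" "P \<Otimes>\<^sub>M P" P f p] by (simp add: distr_mix)
  show "Lnorm (P \<Otimes>\<^sub>M P) p (\<lambda>z. f (mix S (fst z) (snd z))) = Lnorm P p f"
    using Lnorm_distr[of "\<lambda>z. mix S (fst z) (snd z)" "P \<Otimes>\<^sub>M P" P f p] by (simp add: distr_mix)
qed

lemma borel_measurable_cex [measurable]:
  assumes [measurable]: "f \<in> borel_measurable P"
  shows "cex P S f \<in> borel_measurable P"
  unfolding cex_def by measurable

lemma AE_integrable_mix:
  fixes f :: "(int \<Rightarrow> 'b) \<Rightarrow> real"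
  shows "integrable P f \<Longrightarrow> AE x in P. integrable P (\<lambda>y. f (mix S x y))"
  using pair.AE_integrable_fst'[OF integrable_mix, of f S] by simp

lemma
  assumes "integrable P f"
  shows integrable_cex: "integrable P (cex P S f)"
    and integral_cex: "(\<integral>x. cex P S f x \<partial>P) = (\<integral>x. f x \<partial>P)"
  using pair.integrable_fst'[OF integrable_mix[OF assms, of S]]
    pair.integral_fst'[OF integrable_mix[OF assms, of S]] integral_mix[OF assms, of S]
  by (simp_all add: cex_def[abs_def])

text \<open>By \<open>mix_mix\<close> the double integral runs over \<open>mix T y z\<close>, which
  has law \<open>P\<close>. The argument needs an integrable fibre of f, hence the exceptional null
  set.\<close>

lemma cex_tower:
  assumes "integrable P f"
  shows "AE x in P. cex P S (cex P T f) x = cex P (S \<inter> T) f x"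
  using AE_integrable_mix[OF assms, of "S \<inter> T"] AE_space
proof eventually_elim
  case (elim x)
  let ?h = "\<lambda>u. f (mix (S \<inter> T) x u)"
  have "cex P S (cex P T f) x = (\<integral>y. (\<integral>z. ?h (mix T y z) \<partial>P) \<partial>P)"
    by (simp add: cex_def mix_mix)
  also have "\<dots> = (\<integral>u. ?h u \<partial>P)"
    using integral_cex[OF elim(1), of T] by (simp add: cex_def)
  finally show ?case by (simp add: cex_def)
qed

lemma cex_diff:
  assumes "integrable P f" "integrable P g"
  shows "AE x in P. cex P S (\<lambda>x. f x - g x) x = cex P S f x - cex P S g x"
  using AE_integrable_mix[OF assms(1), of S] AE_integrable_mix[OF assms(2), of S]
  by eventually_elim (simp add: cex_def)

lemma cex_eq: "depends_on S f \<Longrightarrow> cex P S f x = f x"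
  by (simp add: cex_def depends_on_def prod.P.prob_space)

text \<open>h is constant on the fibres over S, so it leaves the inner integral at every point, with
  no exceptional null set.\<close>

lemma
  assumes h: "depends_on S h" and [measurable]: "h \<in> borel_measurable P"
    and hf: "integrable P (\<lambda>x. h x * f x)"
  shows integrable_mult_cex: "integrable P (\<lambda>x. h x * cex P S f x)"
    and integral_mult_cex: "(\<integral>x. h x * cex P S f x \<partial>P) = (\<integral>x. h x * f x \<partial>P)"
proof -
  have "cex P S (\<lambda>x. h x * f x) = (\<lambda>x. h x * cex P S f x)"
    using h by (simp add: cex_def depends_on_def fun_eq_iff)
  then show "integrable P (\<lambda>x. h x * cex P S f x)"
    "(\<integral>x. h x * cex P S f x \<partial>P) = (\<integral>x. h x * f x \<partial>P)"
    using integrable_cex[OF hf, of S] integral_cex[OF hf, of S] by auto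
qed

lemma memLp_cex:
  assumes "p \<ge> 1" "memLp P p f"
  shows "memLp P p (cex P S f)" "Lnorm P p (cex P S f) \<le> Lnorm P p f"
  using pair.Lnorm_integral_le[OF assms(1) memLp_mix(1)[OF assms(2), of S]] memLp_mix(2)[OF assms(2), of S]
  by (simp_all add: cex_def[abs_def])

lemma memLp_coupled_diff:
  assumes "p \<ge> 0" "memLp P p f"
  shows "memLp (P \<Otimes>\<^sub>M P) p (\<lambda>z. f (fst z) - f (mix S (fst z) (snd z)))"
proof -
  have "memLp (P \<Otimes>\<^sub>M P) p (\<lambda>z. f (mix UNIV (fst z) (snd z)))" by (rule memLp_mix[OF assms(2)])
  then show ?thesis using memLp_mix(1)[OF assms(2), of S] assms(1)
    by (intro memLp_diff) (auto simp: mix_def[abs_def])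
qed

text \<open>Since {..j} without j is {..j - 1}, the projection is the conditional expectation given
  {..j} of f minus its average over coordinate j. That difference is itself an average of f minus
  its coupled versions, and both averages contract the norm.\<close>

lemma projection_le_coupled_norm:
  assumes p: "p \<ge> 1" and f: "memLp P p f"
  shows "Lnorm P p (\<lambda>x. cex P {..j} f x - cex P {..j - 1} f x) \<le> coupled_norm P p j f"
proof -
  have [measurable]: "f \<in> borel_measurable P" using f by (simp add: memLp_def)
  have int: "integrable P f" by (rule prod.P.memLp_integrable[OF p f])
  let ?h = "\<lambda>x. f x - cex P (- {j}) f x"
  have "{..j} \<inter> - {j} = {..j - 1}" by auto
  then have "AE x in P. cex P {..j} (cex P (- {j}) f) x = cex P {..j - 1} f x"
    using cex_tower[OF int, of "{..j}" "- {j}"] by simp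
  with cex_diff[OF int integrable_cex[OF int, of "- {j}"], of "{..j}"]
  have "AE x in P. cex P {..j} f x - cex P {..j - 1} f x = cex P {..j} ?h x"
    by eventually_elim simp
  then have "Lnorm P p (\<lambda>x. cex P {..j} f x - cex P {..j - 1} f x) = Lnorm P p (cex P {..j} ?h)"
    by (rule Lnorm_cong_AE) auto
  also have "\<dots> \<le> Lnorm P p ?h"
    using p f by (intro memLp_cex memLp_diff) auto
  also have "\<dots> = Lnorm P p (\<lambda>x. \<integral>y. f x - f (mix (- {j}) x y) \<partial>P)"
  proof (rule Lnorm_cong_AE)
    show "AE x in P. ?h x = (\<integral>y. f x - f (mix (- {j}) x y) \<partial>P)"
      using AE_integrable_mix[OF int, of "- {j}"]
      by eventually_elim (simp add: cex_def prod.P.prob_space)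
  qed auto
  also have "\<dots> \<le> coupled_norm P p j f"
    using pair.Lnorm_integral_le(2)[OF p memLp_coupled_diff[OF _ f, of "- {j}"]] p
    by (simp add: coupled_norm_def)
  finally show ?thesis .
qed

lemma coupled_norm_eq_0:
  assumes "depends_on (- {j}) f"
  shows "coupled_norm P p j f = 0"
  using assms by (simp add: coupled_norm_def depends_on_def Lnorm_zero)

lemma coupled_norm_nonneg: "0 \<le> coupled_norm P p j f"
  by (simp add: coupled_norm_def Lnorm_nonneg)

text \<open>Kolmogorov's zero-one law in the form needed here: the conditional expectations given the
  remote past converge to the mean in \<open>L\<^sup>1\<close>.\<close>

definition tail_trivial :: "((int \<Rightarrow> 'b) \<Rightarrow> real) \<Rightarrow> bool" where
  "tail_trivial f \<longleftrightarrow> integrable P f \<and>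
     (\<lambda>m. \<integral>x. \<bar>cex P {..- int m} f x - (\<integral>z. f z \<partial>P)\<bar> \<partial>P) \<longlonglongrightarrow> 0"

text \<open>Conditional expectations and the mean are L^1 contractions, uniformly in m, so the class
  is closed under L^1 approximation; the three errors are e/3 each.\<close>

lemma tail_trivial_approx:
  assumes f: "integrable P f"
    and g: "\<And>e. e > 0 \<Longrightarrow> \<exists>g. tail_trivial g \<and> (\<integral>x. \<bar>f x - g x\<bar> \<partial>P) \<le> e"
  shows "tail_trivial f"
proof -
  let ?E = "\<lambda>m. cex P {..- int m}"
  let ?d = "\<lambda>f m. \<integral>x. \<bar>?E m f x - (\<integral>z. f z \<partial>P)\<bar> \<partial>P"
  have "?d f \<longlonglongrightarrow> 0"
  proof (rule tendstoI)
    fix e :: real assume e: "e > 0"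
    obtain g where g: "tail_trivial g" "(\<integral>x. \<bar>f x - g x\<bar> \<partial>P) \<le> e / 3"
      using g[of "e / 3"] e by auto
    then have int: "integrable P g" and lim: "?d g \<longlonglongrightarrow> 0" by (auto simp: tail_trivial_def)
    have "eventually (\<lambda>m. ?d g m < e / 3) sequentially"
      using order_tendstoD(2)[OF lim, of "e / 3"] e by simp
    then show "eventually (\<lambda>m. dist (?d f m) 0 < e) sequentially"
    proof eventually_elim
      case (elim m)
      note ints = f int integrable_cex[OF f, of "{..- int m}"] integrable_cex[OF int, of "{..- int m}"]
      have fg: "integrable P (\<lambda>x. f x - g x)" using ints by auto
      have d1: "(\<integral>x. \<bar>?E m f x - ?E m g x\<bar> \<partial>P) \<le> e / 3"
      proof -
        have "(\<integral>x. \<bar>?E m f x - ?E m g x\<bar> \<partial>P) = (\<integral>x. \<bar>?E m (\<lambda>x. f x - g x) x\<bar> \<partial>P)"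
          using cex_diff[OF f int, of "{..- int m}"] ints(3,4) integrable_cex[OF fg, of "{..- int m}"]
          by (intro integral_cong_AE) auto
        also have "\<dots> \<le> (\<integral>x. \<bar>f x - g x\<bar> \<partial>P)"
          using memLp_cex(2)[of 1 "\<lambda>x. f x - g x" "{..- int m}"] fg
          by (simp add: memLp_def Lnorm_def)
        finally show ?thesis using g by simp
      qed
      have "\<bar>(\<integral>x. f x \<partial>P) - (\<integral>x. g x \<partial>P)\<bar> = \<bar>\<integral>x. f x - g x \<partial>P\<bar>" using ints by simp
      also have "\<dots> \<le> (\<integral>x. \<bar>f x - g x\<bar> \<partial>P)" by (rule integral_abs_bound)
      finally have d2: "\<bar>(\<integral>x. f x \<partial>P) - (\<integral>x. g x \<partial>P)\<bar> \<le> e / 3" using g by simp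
      have "?d f m \<le> (\<integral>x. \<bar>?E m f x - ?E m g x\<bar> + \<bar>?E m g x - (\<integral>z. g z \<partial>P)\<bar>
          + \<bar>(\<integral>x. f x \<partial>P) - (\<integral>x. g x \<partial>P)\<bar> \<partial>P)"
        using ints by (intro integral_mono) auto
      also have "\<dots> = (\<integral>x. \<bar>?E m f x - ?E m g x\<bar> \<partial>P) + ?d g m
          + \<bar>(\<integral>x. f x \<partial>P) - (\<integral>x. g x \<partial>P)\<bar>"
        using ints by (simp add: prod.P.prob_space)
      also have "\<dots> < e" using d1 d2 elim by linarith
      finally show ?case by (simp add: dist_real_def)
    qed
  qed
  with f show ?thesis by (simp add: tail_trivial_def)
qed

text \<open>Dominated convergence turns pointwise into L^1 approximation. It is applied to partial
  sums of disjoint indicators and to the approximating sequences of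
  \<open>integrable_induct\<close>.\<close>

lemma tail_trivial_dominated:
  assumes s: "\<And>i::nat. tail_trivial (s i)" and f: "integrable P f"
    and lim: "\<And>x. x \<in> space P \<Longrightarrow> (\<lambda>i. s i x) \<longlonglongrightarrow> f x"
    and bound: "\<And>i x. x \<in> space P \<Longrightarrow> \<bar>s i x\<bar> \<le> w x" and w: "integrable P w"
  shows "tail_trivial f"
proof (rule tail_trivial_approx[OF f])
  fix e :: real assume "e > 0"
  have int: "integrable P (s i)" for i using s by (simp add: tail_trivial_def)
  have [measurable]: "s i \<in> borel_measurable P" "f \<in> borel_measurable P" for i using int f by auto
  have "(\<lambda>i. \<integral>x. \<bar>f x - s i x\<bar> \<partial>P) \<longlonglongrightarrow> (\<integral>x. 0 \<partial>P)"
  proof (rule integral_dominated_convergence)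
    show "integrable P (\<lambda>x. \<bar>f x\<bar> + w x)" using f w by auto
    show "AE x in P. (\<lambda>i. \<bar>f x - s i x\<bar>) \<longlonglongrightarrow> 0"
    proof (rule AE_I2)
      fix x assume "x \<in> space P"
      then have "(\<lambda>i. \<bar>f x - s i x\<bar>) \<longlonglongrightarrow> \<bar>f x - f x\<bar>" by (intro tendsto_intros lim)
      then show "(\<lambda>i. \<bar>f x - s i x\<bar>) \<longlonglongrightarrow> 0" by simp
    qed
    show "AE x in P. norm \<bar>f x - s i x\<bar> \<le> \<bar>f x\<bar> + w x" for i
      using bound[of _ i] by (intro AE_I2) (smt (verit) real_norm_def)
  qed auto
  then have "eventually (\<lambda>i. (\<integral>x. \<bar>f x - s i x\<bar> \<partial>P) < e) sequentially"
    using order_tendstoD(2)[of _ 0 sequentially e] \<open>e > 0\<close> by simp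
  then obtain i where "(\<integral>x. \<bar>f x - s i x\<bar> \<partial>P) < e" by (auto simp: eventually_sequentially)
  then show "\<exists>g. tail_trivial g \<and> (\<integral>x. \<bar>f x - g x\<bar> \<partial>P) \<le> e"
    using s[of i] by (intro exI[of _ "s i"]) simp
qed

lemma tail_trivial_add:
  assumes "tail_trivial f" "tail_trivial g"
  shows "tail_trivial (\<lambda>x. f x + g x)"
proof -
  let ?E = "\<lambda>m. cex P {..- int m}"
  let ?d = "\<lambda>f m. \<integral>x. \<bar>?E m f x - (\<integral>z. f z \<partial>P)\<bar> \<partial>P"
  have int: "integrable P f" "integrable P g" and lim: "?d f \<longlonglongrightarrow> 0" "?d g \<longlonglongrightarrow> 0"
    using assms by (auto simp: tail_trivial_def)
  have "?d (\<lambda>x. f x + g x) m \<le> ?d f m + ?d g m" for m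
  proof -
    note ints = int integrable_cex[OF int(1), of "{..- int m}"] integrable_cex[OF int(2), of "{..- int m}"]
    have "AE x in P. ?E m (\<lambda>x. f x + g x) x = ?E m f x + ?E m g x"
      using AE_integrable_mix[OF int(1), of "{..- int m}"] AE_integrable_mix[OF int(2), of "{..- int m}"]
      by eventually_elim (simp add: cex_def)
    then have "?d (\<lambda>x. f x + g x) m \<le> (\<integral>x. \<bar>?E m f x - (\<integral>z. f z \<partial>P)\<bar>
        + \<bar>?E m g x - (\<integral>z. g z \<partial>P)\<bar> \<partial>P)"
      using ints integrable_cex[of "\<lambda>x. f x + g x" "{..- int m}"]
      by (intro integral_mono_AE) (auto elim!: AE_mp)
    also have "\<dots> = ?d f m + ?d g m" using ints by simp
    finally show ?thesis .
  qed
  note le = this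
  have "?d (\<lambda>x. f x + g x) \<longlonglongrightarrow> 0"
  proof (rule tendsto_sandwich)
    show "eventually (\<lambda>m. 0 \<le> ?d (\<lambda>x. f x + g x) m) sequentially"
      by (intro always_eventually allI Bochner_Integration.integral_nonneg) simp
    show "eventually (\<lambda>m. ?d (\<lambda>x. f x + g x) m \<le> ?d f m + ?d g m) sequentially"
      using le by (intro always_eventually allI)
    show "(\<lambda>m. ?d f m + ?d g m) \<longlonglongrightarrow> 0"
      using tendsto_add[OF lim] by simp
  qed simp
  with int show ?thesis by (simp add: tail_trivial_def)
qed

lemma tail_trivial_cmult:
  assumes "tail_trivial f"
  shows "tail_trivial (\<lambda>x. c * f x)"
proof -
  have "cex P S (\<lambda>x. c * f x) x = c * cex P S f x" for S x by (simp add: cex_def)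
  then have "\<bar>cex P S (\<lambda>x. c * f x) x - (\<integral>x. c * f x \<partial>P)\<bar> = \<bar>c\<bar> * \<bar>cex P S f x - (\<integral>x. f x \<partial>P)\<bar>" for S x
    by (simp flip: abs_mult right_diff_distrib)
  then show ?thesis using assms tendsto_mult_right_zero[of _ sequentially "\<bar>c\<bar>"]
    by (simp add: tail_trivial_def)
qed

lemma tail_trivial_const: "tail_trivial (\<lambda>x. c)"
  by (simp add: tail_trivial_def cex_def prod.P.prob_space)

text \<open>Finite-dimensional cylinders generate the sigma-algebra and are stable under
  intersection, and a cylinder is independent of every past that ends before all of its
  coordinates.\<close>

lemma tail_trivial_indicator:
  assumes "A \<in> sets P"
  shows "tail_trivial (indicator A)"
proof -
  let ?G = "prod_algebra UNIV (\<lambda>_::int. Q)"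
  \<comment> \<open>A complement is taken inside the space, so its indicator equals 1 minus the old
    one only there.\<close>
  have cong: "tail_trivial f \<longleftrightarrow> tail_trivial g" if eq: "\<And>x. x \<in> space P \<Longrightarrow> f x = g x" for f g
  proof -
    have "cex P S f x = cex P S g x" if "x \<in> space P" for S x
      unfolding cex_def using that by (intro Bochner_Integration.integral_cong) (auto simp: eq mix_space)
    moreover have "(\<integral>x. f x \<partial>P) = (\<integral>x. g x \<partial>P)" "integrable P f = integrable P g"
      using eq by (auto intro!: Bochner_Integration.integral_cong Bochner_Integration.integrable_cong)
    ultimately show ?thesis by (simp add: tail_trivial_def cong: Bochner_Integration.integral_cong)
  qed
  have "A \<in> sigma_sets (\<Pi>\<^sub>E i\<in>UNIV. space Q) ?G" using assms by (simp add: sets_PiM)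
  from Int_stable_prod_algebra prod_algebra_sets_into_space this show ?thesis
  proof (induction A rule: sigma_sets_induct_disjoint)
    case (basic A)
    then obtain J F where J: "finite J" "\<And>j. j \<in> J \<Longrightarrow> F j \<in> sets Q"
      and A: "A = prod_emb UNIV (\<lambda>_. Q) J (Pi\<^sub>E J F)"
      by (elim prod_algebraE) auto
    have [measurable]: "A \<in> sets P" using basic by (auto simp: sets_PiM)
    have "eventually (\<lambda>m. - int m < j) sequentially" for j
      by (rule eventually_sequentiallyI[of "nat (1 - j)"]) (simp add: nat_le_iff)
    then have "eventually (\<lambda>m. \<forall>j\<in>J. - int m < j) sequentially"
      using J(1) by (intro eventually_ball_finite) auto
    then have "eventually (\<lambda>m. (\<integral>x. \<bar>cex P {..- int m} (indicator A) x
        - (\<integral>z. indicator A z \<partial>P)\<bar> \<partial>P) = 0) sequentially"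
    proof eventually_elim
      case (elim m)
      have "cex P {..- int m} (indicator A) x = (\<integral>z. (indicator A z :: real) \<partial>P)" if x: "x \<in> space P" for x
        unfolding cex_def
      proof (rule Bochner_Integration.integral_cong)
        fix y assume y: "y \<in> space P"
        have "mix {..- int m} x y j = y j" if "j \<in> J" for j using elim that by (auto simp: mix_def)
        then show "indicator A (mix {..- int m} x y) = (indicator A y :: real)"
          using x y mix_space[OF x y] by (auto simp: A prod_emb_def space_PiM Pi_iff indicator_def)
      qed simp
      then show ?case by (simp cong: Bochner_Integration.integral_cong)
    qed
    then show ?case by (simp add: tail_trivial_def tendsto_eventually less_top[symmetric])
  next
    case empty
    show ?case using tail_trivial_const[of 0] by simp
  next
    case (compl A)
    have "tail_trivial (\<lambda>x. 1 + (-1) * indicator A x)"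
      using compl by (intro tail_trivial_add tail_trivial_const tail_trivial_cmult)
    then show ?case
      by (rule cong[THEN iffD1, rotated]) (auto simp: space_PiM indicator_def)
  next
    case (union A)
    have A[measurable]: "A i \<in> sets P" for i using union by (auto simp: sets_PiM)
    show ?case
    proof (rule tail_trivial_dominated[where s = "\<lambda>n x. \<Sum>i<n. indicator (A i) x" and w = "\<lambda>_. 1"])
      show "tail_trivial (\<lambda>x. \<Sum>i<n. indicator (A i) x)" for n
      proof (induction n)
        case (Suc n)
        then show ?case using tail_trivial_add[OF Suc union(3)[of n]] by simp
      qed (simp add: tail_trivial_const)
      have eq: "(\<Sum>i<n. indicator (A i) x :: real) = indicator (\<Union>i<n. A i) x" for n x
        using union(1) by (intro indicator_UN_disjoint[symmetric])
          (auto simp: disjoint_family_on_def)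
      show "(\<lambda>n. \<Sum>i<n. indicator (A i) x) \<longlonglongrightarrow> (indicator (\<Union>i. A i) x :: real)" for x
        unfolding eq by (rule LIMSEQ_indicator_UN)
      show "\<bar>\<Sum>i<n. indicator (A i) x\<bar> \<le> (1 :: real)" for n x
        unfolding eq by (simp add: indicator_def)
    qed (auto simp: less_top[symmetric])
  qed
qed

lemma tail_trivial_integrable:
  assumes "integrable P f"
  shows "tail_trivial f"
  using assms
proof (induction rule: integrable_induct)
  case (base A c)
  then show ?case using tail_trivial_cmult[OF tail_trivial_indicator, of A c] by (simp add: mult.commute)
next
  case (add f g)
  then show ?case by (intro tail_trivial_add)
next
  case (lim f s)
  show ?case
    by (rule tail_trivial_dominated[where s = s and w = "\<lambda>x. 2 * \<bar>f x\<bar>"]) (use lim in auto)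
qed

lemma cex_tail_tendsto:
  "integrable P f \<Longrightarrow>
    (\<lambda>m. \<integral>x. \<bar>cex P {..- int m} f x - (\<integral>z. f z \<partial>P)\<bar> \<partial>P) \<longlonglongrightarrow> 0"
  using tail_trivial_integrable by (simp add: tail_trivial_def)

section \<open>Stationarity: shifts of the sequence space\<close>

lemma measurable_shiftseq [measurable]: "shiftseq k \<in> P \<rightarrow>\<^sub>M P"
proof (rule measurable_PiM_single')
  show "(\<lambda>x. shiftseq k x j) \<in> P \<rightarrow>\<^sub>M Q" for j by (simp add: shiftseq_def)
  show "(\<lambda>x. shiftseq k x) \<in> space P \<rightarrow> (UNIV \<rightarrow>\<^sub>E space Q)"
    by (auto simp: shiftseq_def space_PiM PiE_iff)
qed

lemma distr_shiftseq: "distr P P (shiftseq k) = P"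
  using distr_PiM_reindex[of UNIV "\<lambda>_::int. Q" "\<lambda>j. j + k" UNIV] Q.prob_space_axioms
  by (simp add: shiftseq_def[abs_def] inj_on_def restrict_UNIV)

lemma shiftseq_mix: "shiftseq k (mix S x y) = mix {j. j + k \<in> S} (shiftseq k x) (shiftseq k y)"
  by (auto simp: shiftseq_def mix_def)

lemma cex_shiftseq:
  assumes [measurable]: "f \<in> borel_measurable P" and x: "x \<in> space P"
  shows "cex P S (\<lambda>x. f (shiftseq k x)) x = cex P {j. j + k \<in> S} f (shiftseq k x)"
proof -
  have "shiftseq k x \<in> space P" using x by (auto simp: shiftseq_def space_PiM PiE_iff)
  then have [measurable]: "(\<lambda>y. f (mix {j. j + k \<in> S} (shiftseq k x) y)) \<in> borel_measurable P" by measurable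
  have "cex P {j. j + k \<in> S} f (shiftseq k x) =
      (\<integral>y. f (mix {j. j + k \<in> S} (shiftseq k x) y) \<partial>(distr P P (shiftseq k)))"
    by (simp add: cex_def distr_shiftseq)
  also have "\<dots> = (\<integral>y. f (mix {j. j + k \<in> S} (shiftseq k x) (shiftseq k y)) \<partial>P)"
    by (subst integral_distr) auto
  finally show ?thesis by (simp add: cex_def shiftseq_mix)
qed

lemma Lnorm_shiftseq:
  assumes [measurable]: "f \<in> borel_measurable P"
  shows "Lnorm P p (\<lambda>x. f (shiftseq k x)) = Lnorm P p f"
  using Lnorm_distr[of "shiftseq k" P P f p] by (simp add: distr_shiftseq)

text \<open>Shifting both copies at once preserves the product of \<open>P\<close> with itself and
  moves the replaced coordinate from j to j - k.\<close>

lemma coupled_norm_shiftseq: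
  assumes [measurable]: "f \<in> borel_measurable P"
  shows "coupled_norm P p j (\<lambda>x. f (shiftseq k x)) = coupled_norm P p (j - k) f"
proof -
  let ?T = "\<lambda>z. (shiftseq k (fst z), shiftseq k (snd z))"
  have "distr P P (shiftseq k) \<Otimes>\<^sub>M distr P P (shiftseq k) = distr (P \<Otimes>\<^sub>M P) (P \<Otimes>\<^sub>M P) (\<lambda>(x, y). (shiftseq k x, shiftseq k y))"
    by (rule pair_measure_distr) (auto simp: distr_shiftseq prod.P.sigma_finite_measure_axioms)
  then have T: "distr (P \<Otimes>\<^sub>M P) (P \<Otimes>\<^sub>M P) ?T = P \<Otimes>\<^sub>M P"
    unfolding distr_shiftseq split_beta' by (rule sym)
  have "{i. i + k \<in> - {j}} = - {j - k}" by auto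
  then have "coupled_norm P p j (\<lambda>x. f (shiftseq k x)) = Lnorm (P \<Otimes>\<^sub>M P) p
      (\<lambda>z. f (fst (?T z)) - f (mix (- {j - k}) (fst (?T z)) (snd (?T z))))"
    by (simp add: coupled_norm_def shiftseq_mix)
  also have "\<dots> = Lnorm (distr (P \<Otimes>\<^sub>M P) (P \<Otimes>\<^sub>M P) ?T) p
      (\<lambda>z. f (fst z) - f (mix (- {j - k}) (fst z) (snd z)))"
    by (subst Lnorm_distr) auto
  also have "\<dots> = coupled_norm P p (j - k) f" by (simp add: T coupled_norm_def)
  finally show ?thesis .
qed

end

section \<open>Moment bounds by coupling\<close>

context iid_seq
begin

lemma depends_on_sub_cex:
  assumes "a \<le> b"
  shows "depends_on {..b} (\<lambda>x. cex P {..b} f x - cex P {..a} f x)"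
proof -
  have "depends_on {..b} (cex P {..a} f)"
    using assms by (intro depends_on_mono[OF depends_on_cex]) auto
  then show ?thesis using depends_on_cex[of "{..b}" P f] by (simp add: depends_on_def)
qed

text \<open>Multiplication by h commutes with both conditionings. This supplies the orthogonality
  hypotheses of the martingale inequalities and removes the cross term in the covariance
  bound.\<close>

lemma integral_mult_projection:
  assumes h: "depends_on {..a} h" "h \<in> borel_measurable P" and "a \<le> b"
    and int: "integrable P (\<lambda>x. h x * f x)"
  shows "(\<integral>x. h x * (cex P {..b} f x - cex P {..a} f x) \<partial>P) = 0"
proof -
  have h': "depends_on {..b} h" using h(1) assms by (auto elim: depends_on_mono)
  show ?thesis
    using integrable_mult_cex[OF h int] integrable_mult_cex[OF h' h(2) int]
      integral_mult_cex[OF h int] integral_mult_cex[OF h' h(2) int]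
    by (simp add: right_diff_distrib)
qed

text \<open>Projections after time -m control f only up to its conditional expectation given the
  past up to -m. That expectation tends to the mean in L^1, hence almost surely along a subsequence,
  and Fatou's lemma carries a bound uniform in m to the limit.\<close>

lemma tail_limit_moment:
  assumes p: "p \<ge> 1" and f: "memLp P p f"
    and bound: "\<And>m. (\<integral>x. \<bar>f x - cex P {..- int m} f x\<bar> powr p \<partial>P) \<le> K"
  shows "(\<integral>x. \<bar>f x - (\<integral>z. f z \<partial>P)\<bar> powr p \<partial>P) \<le> K"
proof -
  let ?c = "\<integral>z. f z \<partial>P"
  have [measurable]: "f \<in> borel_measurable P" using f by (simp add: memLp_def)
  have int: "integrable P f" by (rule prod.P.memLp_integrable[OF p f])
  have "0 \<le> (\<integral>x. \<bar>f x - cex P {..- int 0} f x\<bar> powr p \<partial>P)" by simp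
  then have K: "0 \<le> K" using bound[of 0] by linarith
  have m1: "memLp P p (\<lambda>x. f x - cex P {..- int m} f x)" for m
    using p f by (intro memLp_diff memLp_cex) auto
  have m2: "memLp P p (\<lambda>x. f x - ?c)"
    using p f by (intro memLp_diff prod.P.memLp_const) auto
  obtain r :: "nat \<Rightarrow> nat" where r: "strict_mono r"
    and lim: "AE x in P. (\<lambda>n. cex P {..- int (r n)} f x - ?c) \<longlonglongrightarrow> 0"
    using tendsto_L1_AE_subseq[of P "\<lambda>n x. cex P {..- int n} f x - ?c"]
      cex_tail_tendsto[OF int] integrable_cex[OF int] by auto
  have "(\<integral>\<^sup>+x. ennreal (\<bar>f x - ?c\<bar> powr p) \<partial>P)
      = (\<integral>\<^sup>+x. liminf (\<lambda>n. ennreal (\<bar>f x - cex P {..- int (r n)} f x\<bar> powr p)) \<partial>P)"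
  proof (rule nn_integral_cong_AE, use lim in eventually_elim)
    case (elim x)
    have "(\<lambda>n. \<bar>f x - ?c - (cex P {..- int (r n)} f x - ?c)\<bar> powr p) \<longlonglongrightarrow> \<bar>f x - ?c - 0\<bar> powr p"
      using p by (intro tendsto_intros elim) auto
    then have "(\<lambda>n. ennreal (\<bar>f x - cex P {..- int (r n)} f x\<bar> powr p)) \<longlonglongrightarrow> ennreal (\<bar>f x - ?c\<bar> powr p)"
      by (intro tendsto_ennrealI) simp
    then show ?case by (intro lim_imp_Liminf[symmetric] sequentially_bot)
  qed
  also have "\<dots> \<le> liminf (\<lambda>n. \<integral>\<^sup>+x. ennreal (\<bar>f x - cex P {..- int (r n)} f x\<bar> powr p) \<partial>P)"
    by (rule nn_integral_liminf) auto
  also have "\<dots> \<le> ennreal K"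
  proof (intro Liminf_le always_eventually allI)
    show "(\<integral>\<^sup>+x. ennreal (\<bar>f x - cex P {..- int (r n)} f x\<bar> powr p) \<partial>P) \<le> ennreal K" for n
      using bound[of "r n"] memLp_int[OF m1] by (subst nn_integral_eq_integral) (auto simp: ennreal_leI)
  qed simp
  finally have "ennreal (\<integral>x. \<bar>f x - ?c\<bar> powr p \<partial>P) \<le> ennreal K"
    using memLp_int[OF m2] by (subst (asm) nn_integral_eq_integral) auto
  then show ?thesis using K by (simp add: ennreal_le_iff)
qed

text \<open>Telescoping over the conditional expectations given {..a + i}. The multiplier of each
  difference depends on earlier coordinates only, so orthogonality is
  \<open>integral_mult_projection\<close>; the i-th difference belongs to coordinate a + 1 +
  i.\<close>

lemma projection_sum:
  assumes p: "p > 1" and f: "memLp P p f" and dep: "depends_on {..n} f"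
  obtains N D where "\<And>x. f x - cex P {..a} f x = (\<Sum>i<N. D i x)"
    and "\<And>i. i < N \<Longrightarrow> memLp P p (D i)"
    and "\<And>k. k < N \<Longrightarrow> (\<integral>x. sgn (\<Sum>i<k. D i x) * \<bar>\<Sum>i<k. D i x\<bar> powr (p - 1) * D k x \<partial>P) = 0"
    and "\<And>i. i < N \<Longrightarrow> Lnorm P p (D i) \<le> coupled_norm P p (a + 1 + int i) f"
proof -
  let ?E = "\<lambda>j. cex P {..j} f"
  define D where "D i x = ?E (a + 1 + int i) x - ?E (a + int i) x" for i :: nat and x
  \<comment> \<open>For n \<le> a there are no differences, and f equals its conditional expectation
    given {..a}.\<close>
  define N where "N = nat (n - a)"
  have p1: "p \<ge> 1" using p by simp
  have S: "(\<Sum>i<k. D i x) = ?E (a + int k) x - ?E a x" for k x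
    by (induction k) (auto simp: D_def add_ac)
  have N: "?E (a + int N) x = f x" for x
    using dep by (intro cex_eq) (auto simp: N_def elim!: depends_on_mono)
  have memE: "memLp P p (?E j)" for j by (rule memLp_cex[OF p1 f])
  have memD: "memLp P p (D i)" for i
    unfolding D_def[abs_def] using p memE by (intro memLp_diff) auto
  show ?thesis
  proof (rule that)
    show "f x - ?E a x = (\<Sum>i<N. D i x)" for x using S N by simp
    show "memLp P p (D i)" for i by (rule memD)
    show "Lnorm P p (D i) \<le> coupled_norm P p (a + 1 + int i) f" for i
      using projection_le_coupled_norm[OF p1 f, of "a + 1 + int i"]
      by (simp add: D_def[abs_def] algebra_simps)
    fix k
    let ?h = "\<lambda>x. sgn (\<Sum>i<k. D i x) * \<bar>\<Sum>i<k. D i x\<bar> powr (p - 1)"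
    have memS: "memLp P p (\<lambda>x. \<Sum>i<k. D i x)" using p memD by (intro memLp_sum) auto
    have [measurable]: "(\<lambda>x. \<Sum>i<k. D i x) \<in> borel_measurable P" by (rule memLp_meas[OF memS])
    have "depends_on {..a + int k} (\<lambda>x. \<Sum>i<k. D i x)"
      unfolding S by (rule depends_on_sub_cex) simp
    then have dep: "depends_on {..a + int k} ?h" by (simp add: depends_on_def)
    have "integrable P (\<lambda>x. ?h x * f x)" by (rule orthogonal_integrable[OF p memS f])
    then have "(\<integral>x. ?h x * (?E (a + 1 + int k) x - ?E (a + int k) x) \<partial>P) = 0"
      using dep by (intro integral_mult_projection) auto
    then show "(\<integral>x. ?h x * D k x \<partial>P) = 0" by (simp add: D_def)
  qed
qed

lemma sum_shifted_le:
  fixes \<beta> :: "int \<Rightarrow> real"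
  assumes "\<And>J. finite J \<Longrightarrow> (\<Sum>j\<in>J. \<beta> j) \<le> B"
  shows "(\<Sum>i<N. \<beta> (a + 1 + int i)) \<le> B"
proof -
  have "(\<Sum>i<N. \<beta> (a + 1 + int i)) = (\<Sum>j\<in>(\<lambda>i. a + 1 + int i) ` {..<N}. \<beta> j)"
    by (subst sum.reindex) (auto simp: inj_on_def)
  also have "\<dots> \<le> B" by (rule assms) simp
  finally show ?thesis .
qed

text \<open>Bounding the sum over every finite set of coordinates makes the right side independent
  of the truncation m, as \<open>tail_limit_moment\<close> requires. \<beta> may be any majorant,
  since coupled norms of sums are only estimated.\<close>

lemma moment_bound_le_2:
  assumes p: "1 < p" "p \<le> 2" and f: "memLp P p f" and dep: "depends_on {..n} f"
    and \<beta>: "\<And>j. coupled_norm P p j f \<le> \<beta> j"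
    and B: "\<And>J. finite J \<Longrightarrow> (\<Sum>j\<in>J. \<beta> j powr p) \<le> B"
  shows "(\<integral>x. \<bar>f x - (\<integral>z. f z \<partial>P)\<bar> powr p \<partial>P) \<le> mart_const p * B"
proof (rule tail_limit_moment[OF _ f])
  fix m :: nat
  define a where "a = - int m"
  obtain N D where eq: "\<And>x. f x - cex P {..a} f x = (\<Sum>i<N. D i x)"
    and D: "\<And>i. i < N \<Longrightarrow> memLp P p (D i)"
    and orth: "\<And>k. k < N \<Longrightarrow>
      (\<integral>x. sgn (\<Sum>i<k. D i x) * \<bar>\<Sum>i<k. D i x\<bar> powr (p - 1) * D k x \<partial>P) = 0"
    and le: "\<And>i. i < N \<Longrightarrow> Lnorm P p (D i) \<le> coupled_norm P p (a + 1 + int i) f"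
    using projection_sum[OF p(1) f dep, of a thesis] by blast
  have "(\<integral>x. \<bar>f x - cex P {..a} f x\<bar> powr p \<partial>P) \<le> mart_const p * (\<Sum>i<N. Lnorm P p (D i) powr p)"
    unfolding eq by (rule von_Bahr_Esseen[OF p D orth])
  also have "\<dots> \<le> mart_const p * (\<Sum>i<N. \<beta> (a + 1 + int i) powr p)"
    using mart_const_ge_1[OF p(1)] le \<beta> p
    by (intro mult_left_mono sum_mono powr_mono2 Lnorm_nonneg) (auto intro: order_trans)
  also have "\<dots> \<le> mart_const p * B"
    using mart_const_ge_1[OF p(1)] by (intro mult_left_mono sum_shifted_le[OF B]) auto
  finally show "(\<integral>x. \<bar>f x - cex P {..- int m} f x\<bar> powr p \<partial>P) \<le> mart_const p * B"
    by (simp add: a_def)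
qed (use p in simp)

lemma moment_bound_gt_2:
  assumes p: "2 < p" and f: "memLp P p f" and dep: "depends_on {..n} f"
    and \<beta>: "\<And>j. coupled_norm P p j f \<le> \<beta> j"
    and B: "\<And>J. finite J \<Longrightarrow> (\<Sum>j\<in>J. (\<beta> j)\<^sup>2) \<le> B"
  shows "(\<integral>x. \<bar>f x - (\<integral>z. f z \<partial>P)\<bar> powr p \<partial>P) \<le> (4 * mart_const p * B) powr (p / 2)"
proof (rule tail_limit_moment[OF _ f])
  fix m :: nat
  define a where "a = - int m"
  have p1: "p > 1" using p by simp
  obtain N D where eq: "\<And>x. f x - cex P {..a} f x = (\<Sum>i<N. D i x)"
    and D: "\<And>i. i < N \<Longrightarrow> memLp P p (D i)"
    and orth: "\<And>k. k < N \<Longrightarrow>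
      (\<integral>x. sgn (\<Sum>i<k. D i x) * \<bar>\<Sum>i<k. D i x\<bar> powr (p - 1) * D k x \<partial>P) = 0"
    and le: "\<And>i. i < N \<Longrightarrow> Lnorm P p (D i) \<le> coupled_norm P p (a + 1 + int i) f"
    using projection_sum[OF p1 f dep, of a thesis] by blast
  have "(\<integral>x. \<bar>f x - cex P {..a} f x\<bar> powr p \<partial>P)
      \<le> (4 * mart_const p * (\<Sum>i<N. (Lnorm P p (D i))\<^sup>2)) powr (p / 2)"
    unfolding eq by (rule Rio_martingale[OF p D orth])
  also have "\<dots> \<le> (4 * mart_const p * B) powr (p / 2)"
  proof (intro powr_mono2 mult_left_mono)
    have "(\<Sum>i<N. (Lnorm P p (D i))\<^sup>2) \<le> (\<Sum>i<N. (\<beta> (a + 1 + int i))\<^sup>2)"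
      using le \<beta> by (intro sum_mono power_mono Lnorm_nonneg) (auto intro: order_trans)
    also have "\<dots> \<le> B" by (rule sum_shifted_le[OF B])
    finally show "(\<Sum>i<N. (Lnorm P p (D i))\<^sup>2) \<le> B" .
  qed (use mart_const_ge_1[OF p1] p in \<open>auto intro!: mult_nonneg_nonneg sum_nonneg\<close>)
  finally show "(\<integral>x. \<bar>f x - cex P {..- int m} f x\<bar> powr p \<partial>P) \<le> (4 * mart_const p * B) powr (p / 2)"
    by (simp add: a_def)
qed (use p in simp)

text \<open>The zero-one law gives convergence in L^1, while h is merely square integrable.
  Truncating h at level n leaves a bounded part, settled by the L^1 limit, and a remainder small in
  L^2, settled by Cauchy-Schwarz uniformly in m.\<close>

lemma integral_tail_cex_mult_tendsto:
  assumes f: "memLp P 2 f" and mean: "(\<integral>x. f x \<partial>P) = 0" and h: "memLp P 2 h"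
  shows "(\<lambda>m. \<integral>x. cex P {..- int m} f x * h x \<partial>P) \<longlonglongrightarrow> 0"
proof (rule tendstoI)
  fix e :: real assume e: "e > 0"
  let ?E = "\<lambda>m. cex P {..- int m} f"
  let ?g = "\<lambda>n::nat. \<lambda>x. if \<bar>h x\<bar> \<le> real n then h x else 0"
  have [measurable]: "h \<in> borel_measurable P" "f \<in> borel_measurable P" using h f by (auto simp: memLp_def)
  have g: "memLp P 2 (?g n)" for n
  proof -
    have "integrable P (\<lambda>x. (?g n x)\<^sup>2)"
      by (rule Bochner_Integration.integrable_bound[where f = "\<lambda>x. (h x)\<^sup>2"]) (use h in \<open>auto simp: memLp_2_iff\<close>)
    then show ?thesis by (simp add: memLp_2_iff)
  qed
  have d: "memLp P 2 (\<lambda>x. h x - ?g n x)" for n by (rule memLp_diff[OF _ h g]) simp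
  have E: "memLp P 2 (?E m)" "Lnorm P 2 (?E m) \<le> Lnorm P 2 f" for m
    using memLp_cex[OF _ f] by auto
  have int: "integrable P f" by (rule prod.P.memLp_integrable[OF _ f]) simp
  have "(\<lambda>n. \<integral>x. (h x - ?g n x)\<^sup>2 \<partial>P) \<longlonglongrightarrow> (\<integral>x. 0 \<partial>P)"
  proof (rule integral_dominated_convergence)
    show "integrable P (\<lambda>x. (h x)\<^sup>2)" using h by (simp add: memLp_2_iff)
    show "AE x in P. (\<lambda>n. (h x - ?g n x)\<^sup>2) \<longlonglongrightarrow> 0"
    proof (rule AE_I2)
      fix x
      have "eventually (\<lambda>n. \<bar>h x\<bar> \<le> real n) sequentially"
        by (rule eventually_sequentiallyI[of "nat \<lceil>\<bar>h x\<bar>\<rceil>"]) linarith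
      then have "eventually (\<lambda>n. (h x - ?g n x)\<^sup>2 = 0) sequentially" by eventually_elim simp
      then show "(\<lambda>n. (h x - ?g n x)\<^sup>2) \<longlonglongrightarrow> 0" by (rule tendsto_eventually)
    qed
    show "AE x in P. norm ((h x - ?g n x)\<^sup>2) \<le> (h x)\<^sup>2" for n by (rule AE_I2) auto
  qed auto
  then have "(\<lambda>n. Lnorm P 2 (\<lambda>x. h x - ?g n x)) \<longlonglongrightarrow> 0"
    by (auto simp: Lnorm_def powr_half_sqrt intro: tendsto_real_sqrt[of _ 0, simplified])
  then have "(\<lambda>n. Lnorm P 2 f * Lnorm P 2 (\<lambda>x. h x - ?g n x)) \<longlonglongrightarrow> 0"
    by (rule tendsto_mult_right_zero)
  then have "eventually (\<lambda>n. Lnorm P 2 f * Lnorm P 2 (\<lambda>x. h x - ?g n x) < e / 2) sequentially"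
    using order_tendstoD(2)[of _ 0 sequentially "e / 2"] e by simp
  then obtain n where n: "Lnorm P 2 f * Lnorm P 2 (\<lambda>x. h x - ?g n x) < e / 2"
    by (auto simp: eventually_sequentially)
  have "(\<lambda>m. real n * (\<integral>x. \<bar>?E m x\<bar> \<partial>P)) \<longlonglongrightarrow> 0"
    using cex_tail_tendsto[OF int] by (intro tendsto_mult_right_zero) (simp add: mean)
  then have "eventually (\<lambda>m. real n * (\<integral>x. \<bar>?E m x\<bar> \<partial>P) < e / 2) sequentially"
    using order_tendstoD(2)[of _ 0 sequentially "e / 2"] e by simp
  then show "eventually (\<lambda>m. dist (\<integral>x. ?E m x * h x \<partial>P) 0 < e) sequentially"
  proof eventually_elim
    case (elim m)
    have "(\<integral>x. ?E m x * h x \<partial>P) = (\<integral>x. ?E m x * ?g n x + ?E m x * (h x - ?g n x) \<partial>P)"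
      by (simp add: algebra_simps)
    also have "\<dots> = (\<integral>x. ?E m x * ?g n x \<partial>P) + (\<integral>x. ?E m x * (h x - ?g n x) \<partial>P)"
      by (intro Bochner_Integration.integral_add memLp_2_mult E g d)
    finally have split: "(\<integral>x. ?E m x * h x \<partial>P)
        = (\<integral>x. ?E m x * ?g n x \<partial>P) + (\<integral>x. ?E m x * (h x - ?g n x) \<partial>P)" .
    have "\<bar>\<integral>x. ?E m x * ?g n x \<partial>P\<bar> \<le> (\<integral>x. \<bar>?E m x * ?g n x\<bar> \<partial>P)" by (rule integral_abs_bound)
    also have "\<dots> \<le> (\<integral>x. real n * \<bar>?E m x\<bar> \<partial>P)"
    proof (rule integral_mono)
      show "integrable P (\<lambda>x. \<bar>?E m x * ?g n x\<bar>)" by (intro integrable_abs memLp_2_mult E g)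
      show "integrable P (\<lambda>x. real n * \<bar>?E m x\<bar>)" using integrable_cex[OF int] by simp
      show "\<bar>?E m x * ?g n x\<bar> \<le> real n * \<bar>?E m x\<bar>" for x
        by (auto simp: abs_mult mult.commute[of "\<bar>?E m x\<bar>"] intro: mult_right_mono)
    qed
    finally have 1: "\<bar>\<integral>x. ?E m x * ?g n x \<partial>P\<bar> < e / 2" using elim by simp
    have "\<bar>\<integral>x. ?E m x * (h x - ?g n x) \<partial>P\<bar> \<le> Lnorm P 2 (?E m) * Lnorm P 2 (\<lambda>x. h x - ?g n x)"
      by (rule Cauchy_Schwarz_Lnorm[OF E(1) d])
    also have "\<dots> \<le> Lnorm P 2 f * Lnorm P 2 (\<lambda>x. h x - ?g n x)"
      using E(2) by (intro mult_right_mono Lnorm_nonneg)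
    finally have 2: "\<bar>\<integral>x. ?E m x * (h x - ?g n x) \<partial>P\<bar> < e / 2" using n by simp
    show ?case using 1 2 split by (simp add: dist_real_def)
  qed
qed

end

section \<open>Autocovariance sums and block lengths\<close>

text \<open>\<open>real 0 powr q\<close> is 0, so the weighted series says nothing about j = 0; the
  comparison starts at 1, where the weight is at least 1.\<close>

lemma summable_powr_weight:
  fixes \<theta> :: "nat \<Rightarrow> real"
  assumes "q > 0" "\<And>j. \<theta> j \<ge> 0" "summable (\<lambda>j. real j powr q * \<theta> j)"
  shows "summable \<theta>"
proof (rule summable_comparison_test_ev[OF _ assms(3)])
  show "eventually (\<lambda>j. norm (\<theta> j) \<le> real j powr q * \<theta> j) sequentially"
  proof (rule eventually_sequentiallyI[of 1])
    fix j :: nat assume "1 \<le> j"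
    then have "1 \<le> real j powr q" using assms(1) by (intro ge_one_powr_ge_zero) auto
    then show "norm (\<theta> j) \<le> real j powr q * \<theta> j"
      using assms(2)[of j] mult_right_mono[of 1 "real j powr q" "\<theta> j"] by simp
  qed
qed

lemma summable_mult_shift:
  fixes \<theta> :: "nat \<Rightarrow> real"
  assumes "\<And>j. \<theta> j \<ge> 0" "summable \<theta>"
  shows "summable (\<lambda>i. \<theta> i * \<theta> (i + k))"
proof (rule summable_comparison_test[OF _ summable_mult2[OF assms(2)]])
  have "\<theta> j \<le> suminf \<theta>" for j
    using sum_le_suminf[OF assms(2), of "{j}"] assms(1) by simp
  then show "\<exists>N. \<forall>n\<ge>N. norm (\<theta> n * \<theta> (n + k)) \<le> \<theta> n * suminf \<theta>"
    using assms(1) by (auto intro!: mult_left_mono)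
qed

text \<open>The weight moves to the later factor by k^q \<le> (i + k)^q; exchanging the sums leaves
  the plain series of \<theta> times its weighted series.\<close>

lemma summable_weighted_autocorrelation:
  fixes \<theta> c :: "nat \<Rightarrow> real"
  assumes q: "q > 0" and \<theta>: "\<And>j. \<theta> j \<ge> 0" and sum: "summable (\<lambda>j. real j powr q * \<theta> j)"
    and c: "\<And>k. c k \<ge> 0" "\<And>k. c k \<le> (\<Sum>i. \<theta> i * \<theta> (i + k))"
  shows "summable (\<lambda>k. real k powr q * c k)"
proof (rule summableI_nonneg_bounded)
  note s\<theta> = summable_powr_weight[OF q \<theta> sum]
  note s2 = summable_mult_shift[OF \<theta> s\<theta>]
  define T where "T = (\<Sum>j. real j powr q * \<theta> j)"
  fix n
  have inner: "(\<Sum>k<n. real k powr q * \<theta> (i + k)) \<le> T" for i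
  proof -
    have "(\<Sum>k<n. real k powr q * \<theta> (i + k)) \<le> (\<Sum>k<n. real (i + k) powr q * \<theta> (i + k))"
      using \<theta> q by (intro sum_mono mult_right_mono powr_mono2) auto
    also have "\<dots> = (\<Sum>j\<in>(+) i ` {..<n}. real j powr q * \<theta> j)"
      by (subst sum.reindex) auto
    also have "\<dots> \<le> T" unfolding T_def using \<theta> by (intro sum_le_suminf[OF sum]) auto
    finally show ?thesis .
  qed
  have "(\<Sum>k<n. real k powr q * c k) \<le> (\<Sum>k<n. real k powr q * (\<Sum>i. \<theta> i * \<theta> (i + k)))"
    using c by (intro sum_mono mult_left_mono) auto
  also have "\<dots> = (\<Sum>k<n. \<Sum>i. real k powr q * (\<theta> i * \<theta> (i + k)))"
    using s2 by (simp add: suminf_mult)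
  also have "\<dots> = (\<Sum>i. \<Sum>k<n. real k powr q * (\<theta> i * \<theta> (i + k)))"
    using s2 by (intro suminf_sum[symmetric] summable_mult)
  also have "\<dots> = (\<Sum>i. \<theta> i * (\<Sum>k<n. real k powr q * \<theta> (i + k)))"
    by (simp add: sum_distrib_left mult.left_commute)
  also have "\<dots> \<le> (\<Sum>i. \<theta> i * T)"
  proof (rule suminf_le)
    show "\<theta> i * (\<Sum>k<n. real k powr q * \<theta> (i + k)) \<le> \<theta> i * T" for i
      using inner \<theta> by (intro mult_left_mono) auto
    show "summable (\<lambda>i. \<theta> i * (\<Sum>k<n. real k powr q * \<theta> (i + k)))"
    proof -
      have "summable (\<lambda>i. \<Sum>k<n. real k powr q * (\<theta> i * \<theta> (i + k)))"
        using s2 by (intro summable_sum summable_mult)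
      then show ?thesis by (simp add: sum_distrib_left mult.left_commute)
    qed
  qed (rule summable_mult2[OF s\<theta>])
  finally show "(\<Sum>k<n. real k powr q * c k) \<le> (\<Sum>i. \<theta> i * T)" .
qed (use c in simp)

text \<open>The long-run variance is an unordered sum over the integers, whereas the estimates
  concern series over nonnegative lags; symmetry folds the negative half.\<close>

lemma infsum_even_int:
  fixes c :: "int \<Rightarrow> real"
  assumes even: "\<And>k. c (- k) = c k" and sum: "summable (\<lambda>k. \<bar>c (int k)\<bar>)"
  shows "(\<Sum>\<^sub>\<infinity>k. c k) = c 0 + 2 * (\<Sum>k. c (int (Suc k)))"
proof -
  have sum': "summable (\<lambda>k. norm (c (int (Suc k))))" using sum summable_Suc_iff[of "\<lambda>k. \<bar>c (int k)\<bar>"] by simp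
  have "((\<lambda>k. c (int k)) has_sum (\<Sum>k. c (int k))) UNIV"
    using sum by (intro norm_summable_imp_has_sum[OF _ summable_sums[OF summable_rabs_cancel[OF sum]]]) simp
  then have 1: "(c has_sum (\<Sum>k. c (int k))) (range int)"
    by (subst has_sum_reindex) (auto simp: inj_on_def o_def)
  have "((\<lambda>k. c (int (Suc k))) has_sum (\<Sum>k. c (int (Suc k)))) UNIV"
    by (rule norm_summable_imp_has_sum[OF sum' summable_sums[OF summable_norm_cancel[OF sum']]])
  then have 2: "(c has_sum (\<Sum>k. c (int (Suc k)))) (range (\<lambda>k. - int (Suc k)))"
    using even by (subst has_sum_reindex) (auto simp only: inj_on_def o_def neg_equal_iff_equal of_nat_eq_iff nat.inject)
  have "k \<in> range int \<union> range (\<lambda>k. - int (Suc k))" for k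
    by (cases k rule: int_cases) auto
  then have "UNIV = range int \<union> range (\<lambda>k. - int (Suc k))" by blast
  moreover have "range int \<inter> range (\<lambda>k. - int (Suc k)) = {}" by auto
  ultimately have "(c has_sum ((\<Sum>k. c (int k)) + (\<Sum>k. c (int (Suc k))))) UNIV"
    using has_sum_Un_disjoint[OF 1 2] by metis
  moreover have "(\<Sum>k. c (int k)) = (\<Sum>k. c (int (Suc k))) + c 0"
    using suminf_split_head[of "\<lambda>k. c (int k)"] summable_rabs_cancel[OF sum] by simp
  ultimately show ?thesis by (simp add: infsumI)
qed

text \<open>Enlarging the square from l to l + 1 adds a row and a column that meet in c 0, each
  carrying the lags 1 to l once.\<close>

lemma sum_square_even:
  fixes c :: "int \<Rightarrow> real"
  assumes even: "\<And>k. c (- k) = c k"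
  shows "(\<Sum>a<l. \<Sum>b<l. c (int b - int a)) = (\<Sum>i<l. c 0 + 2 * (\<Sum>k<i. c (int (Suc k))))"
proof (induction l)
  case (Suc l)
  have rev: "(\<Sum>a<l. c (int l - int a)) = (\<Sum>k<l. c (int (Suc k)))"
  proof -
    have "(\<Sum>a<l. c (int l - int a)) = (\<Sum>a<l. c (int (Suc (l - Suc a))))"
      by (intro sum.cong refl arg_cong[of _ _ c]) auto
    also have "\<dots> = (\<Sum>k<l. c (int (Suc k)))" by (rule sum.nat_diff_reindex)
    finally show ?thesis .
  qed
  have "(\<Sum>b<l. c (int b - int l)) = (\<Sum>b<l. c (int l - int b))"
    by (intro sum.cong refl) (metis even minus_diff_eq)
  then show ?case using Suc rev by (simp add: sum.distrib distrib_right)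
qed simp

text \<open>d k occurs in the tails with i \<le> k, that is min l (k + 1) times; splitting this
  count m as m^q m^(1-q) bounds one factor by each of the two entries.\<close>

lemma sum_tails_le:
  fixes d :: "nat \<Rightarrow> real"
  assumes q: "0 < q" "q \<le> 1" and d: "\<And>k. d k \<ge> 0"
    and sum: "summable (\<lambda>k. real (Suc k) powr q * d k)"
  shows "(\<Sum>i<l. \<Sum>k. d (k + i)) \<le> (\<Sum>k. real (Suc k) powr q * d k) * real l powr (1 - q)"
proof -
  have sd: "summable d"
  proof (rule summable_comparison_test[OF _ sum], intro exI allI impI)
    fix k
    have "1 \<le> real (Suc k) powr q" using q by (intro ge_one_powr_ge_zero) auto
    then show "norm (d k) \<le> real (Suc k) powr q * d k"
      using d[of k] mult_right_mono[of 1 "real (Suc k) powr q" "d k"] by simp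
  qed
  \<comment> \<open>A tail written as a full series with a cut-off allows the two sums to be
    exchanged.\<close>
  let ?e = "\<lambda>i k. if i \<le> k then d k else 0"
  have se: "summable (?e i)" for i
    by (rule summable_comparison_test[OF _ sd]) (use d in auto)
  have "(\<Sum>k. d (k + i)) = suminf (?e i)" for i
    using suminf_split_initial_segment[OF se, of i i] by simp
  then have "(\<Sum>i<l. \<Sum>k. d (k + i)) = (\<Sum>i<l. \<Sum>k. ?e i k)" by simp
  also have "\<dots> = (\<Sum>k. \<Sum>i<l. ?e i k)" using se by (intro suminf_sum[symmetric])
  also have "\<dots> \<le> (\<Sum>k. real (Suc k) powr q * d k * real l powr (1 - q))"
  proof (rule suminf_le)
    fix k
    define m where "m = min l (Suc k)"
    have "(\<Sum>i<l. ?e i k) = real (card {i. i < l \<and> i \<le> k}) * d k"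
      by (subst sum.inter_filter[symmetric]) (auto simp: lessThan_def)
    also have "{i. i < l \<and> i \<le> k} = {..<m}" by (auto simp: m_def)
    also have "real (card {..<m}) = real m powr q * real m powr (1 - q)"
      by (simp flip: powr_add)
    also have "\<dots> * d k \<le> (real (Suc k) powr q * real l powr (1 - q)) * d k"
      using q d by (intro mult_right_mono mult_mono powr_mono2) (auto simp: m_def)
    finally show "(\<Sum>i<l. ?e i k) \<le> real (Suc k) powr q * d k * real l powr (1 - q)"
      by (simp add: mult_ac)
  qed (use sum se in \<open>auto intro!: summable_mult2 summable_sum\<close>)
  also have "\<dots> = (\<Sum>k. real (Suc k) powr q * d k) * real l powr (1 - q)"
    using sum by (rule suminf_mult2[symmetric])
  finally show ?thesis .
qed

text \<open>The i-th increment of the double sum misses exactly the lags beyond i, on both sides, so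
  the error is twice a sum of tails of the covariance series.\<close>

lemma long_run_variance_error:
  fixes c :: "int \<Rightarrow> real"
  assumes q: "0 < q" "q \<le> 1" and even: "\<And>k. c (- k) = c k"
    and sum: "summable (\<lambda>k. real k powr q * \<bar>c (int k)\<bar>)"
  shows "\<bar>(\<Sum>a<l. \<Sum>b<l. c (int b - int a)) - real l * (\<Sum>\<^sub>\<infinity>k. c k)\<bar>
    \<le> 2 * (\<Sum>k. real k powr q * \<bar>c (int k)\<bar>) * real l powr (1 - q)"
proof -
  have sc: "summable (\<lambda>k. \<bar>c (int k)\<bar>)"
    by (rule summable_powr_weight[OF q(1) _ sum]) simp
  define d where "d k = \<bar>c (int (Suc k))\<bar>" for k
  have sumS: "summable (\<lambda>k. real (Suc k) powr q * d k)"
    using sum summable_Suc_iff[of "\<lambda>k. real k powr q * \<bar>c (int k)\<bar>"] by (simp add: d_def)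
  have sd: "summable d" using sc summable_Suc_iff[of "\<lambda>k. \<bar>c (int k)\<bar>"] by (simp add: d_def[abs_def])
  have s1: "summable (\<lambda>k. c (int (Suc k)))" using sd unfolding d_def by (rule summable_rabs_cancel)
  have "real l * (\<Sum>\<^sub>\<infinity>k. c k) - (\<Sum>a<l. \<Sum>b<l. c (int b - int a))
      = (\<Sum>i<l. (\<Sum>\<^sub>\<infinity>k. c k) - (c 0 + 2 * (\<Sum>k<i. c (int (Suc k)))))"
    by (simp add: sum_square_even[where c = c, OF even] sum_subtractf)
  also have "\<dots> = (\<Sum>i<l. 2 * (\<Sum>k. c (int (Suc (k + i)))))"
    using suminf_minus_initial_segment[OF s1] by (simp add: infsum_even_int[where c = c, OF even sc] right_diff_distrib)
  finally have "\<bar>(\<Sum>a<l. \<Sum>b<l. c (int b - int a)) - real l * (\<Sum>\<^sub>\<infinity>k. c k)\<bar>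
      = \<bar>\<Sum>i<l. 2 * (\<Sum>k. c (int (Suc (k + i))))\<bar>" by linarith
  also have "\<dots> \<le> (\<Sum>i<l. \<bar>2 * (\<Sum>k. c (int (Suc (k + i))))\<bar>)" by (rule sum_abs)
  also have "\<dots> \<le> (\<Sum>i<l. 2 * (\<Sum>k. d (k + i)))"
  proof (rule sum_mono)
    fix i
    have "\<bar>\<Sum>k. c (int (Suc (k + i)))\<bar> \<le> (\<Sum>k. \<bar>c (int (Suc (k + i)))\<bar>)"
      using summable_ignore_initial_segment[OF sd, of i] by (intro summable_rabs) (simp add: d_def)
    then show "\<bar>2 * (\<Sum>k. c (int (Suc (k + i))))\<bar> \<le> 2 * (\<Sum>k. d (k + i))"
      by (simp add: d_def abs_mult)
  qed
  also have "\<dots> = 2 * (\<Sum>i<l. \<Sum>k. d (k + i))" by (simp add: sum_distrib_left)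
  also have "\<dots> \<le> 2 * ((\<Sum>k. real (Suc k) powr q * d k) * real l powr (1 - q))"
    using sum_tails_le[OF q _ sumS, of l] by (simp add: d_def)
  \<comment> \<open>The term k = 0 has weight 0, so the index shift costs nothing.\<close>
  also have "(\<Sum>k. real (Suc k) powr q * d k) = (\<Sum>k. real k powr q * \<bar>c (int k)\<bar>)"
    using suminf_split_head[OF sum] q by (simp add: d_def)
  finally show ?thesis by simp
qed

section \<open>Lengths of the blocks started at floor(c k^p)\<close>

lemma powr_diff_le:
  fixes x p :: real
  assumes "x > 0" "p > 1"
  shows "(x + 1) powr p - x powr p \<le> p * (x + 1) powr (p - 1)"
proof -
  have "\<exists>z>x. z < x + 1 \<and> (x + 1) powr p - x powr p = (x + 1 - x) * (p * z powr (p - 1))"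
    using assms by (intro MVT2) (auto intro!: derivative_eq_intros)
  then obtain z where z: "x < z" "z < x + 1"
    "(x + 1) powr p - x powr p = (x + 1 - x) * (p * z powr (p - 1))" by blast
  have "z powr (p - 1) \<le> (x + 1) powr (p - 1)" using z assms by (intro powr_mono2) auto
  then show ?thesis using z assms by simp
qed

text \<open>\<open>blk_start\<close> is a \<open>Max\<close>, so finiteness of its set must be
  secured: as no a k is negative, the set lies in {0..i}. The element 1 keeps the start positive
  even where a k is 0.\<close>

lemma
  fixes c p :: real
  assumes c: "c > 0" and p: "p > 1" and i: "i \<ge> 1"
  defines "a \<equiv> \<lambda>k. \<lfloor>c * real k powr p\<rfloor>"
  shows blk_start_bounds: "1 \<le> blk_start a i" "blk_start a i \<le> int i"
    and blk_start_ge: "k \<ge> 1 \<Longrightarrow> a k \<le> int i \<Longrightarrow> a k \<le> blk_start a i"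
proof -
  let ?A = "{1} \<union> {a k |k. k \<ge> 1 \<and> a k \<le> int i}"
  have "a k \<ge> 0" for k using c by (simp add: a_def)
  then have "?A \<subseteq> {0..int i}" using i by auto
  then have fin: "finite ?A" by (rule finite_subset) simp
  show "1 \<le> blk_start a i" unfolding blk_start_def using fin by (intro Max_ge) auto
  show "blk_start a i \<le> int i" unfolding blk_start_def using fin i by (subst Max_le_iff) auto
  show "k \<ge> 1 \<Longrightarrow> a k \<le> int i \<Longrightarrow> a k \<le> blk_start a i"
    unfolding blk_start_def using fin by (intro Max_ge) auto
qed

text \<open>Let x solve c x^p = i and K = floor x. If K \<ge> 1, then a_K is an admissible start,
  while i lies below c (K + 1)^p; the gap c ((K + 1)^p - K^p) is of order x^(p-1), that is
  i^(1-1/p).\<close>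

lemma blk_len_le:
  fixes c p :: real
  assumes c: "c > 0" and p: "p > 1"
  defines "a \<equiv> \<lambda>k. \<lfloor>c * real k powr p\<rfloor>"
  obtains C where "C > 0" "\<And>n i. 1 \<le> i \<Longrightarrow> i \<le> n \<Longrightarrow> blk_len a i \<le> C * real n powr (1 - 1 / p)"
proof -
  \<comment> \<open>From c p (K + 1)^(p-1), with K + 1 \<le> 2x for K \<ge> 1 and x =
    (i/c)^(1/p).\<close>
  define B where "B = c * p * 2 powr (p - 1) * (1 / c) powr (1 - 1 / p)"
  have B: "B \<ge> 0" using c p by (simp add: B_def)
  have exp: "1 - 1 / p > 0" using p by simp
  show ?thesis
  proof (rule that)
    \<comment> \<open>2 pays for the rounding of a_K and for counting both ends of a block, c for
      the indices i < c, where K = 0.\<close>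
    show "B + 2 + c > 0" using B c by simp
    fix n i :: nat assume i: "1 \<le> i" "i \<le> n"
    let ?r = "1 - 1 / p"
    have n1: "1 \<le> real n powr ?r" using i exp by (intro ge_one_powr_ge_zero) auto
    define x where "x = (real i / c) powr (1 / p)"
    have x: "x > 0" "c * x powr p = real i" using c p i by (auto simp: x_def powr_powr)
    define K where "K = nat \<lfloor>x\<rfloor>"
    have K: "real K \<le> x" "x < real K + 1" using x by (auto simp: K_def)
    have len: "blk_len a i = real i - real_of_int (blk_start a i) + 1" by (simp add: blk_len_def)
    note bounds = blk_start_bounds[OF c p i(1), folded a_def] blk_start_ge[OF c p i(1), folded a_def]
    show "blk_len a i \<le> (B + 2 + c) * real n powr ?r"
    proof (cases "K \<ge> 1")
      case True
      have "c * real K powr p \<le> c * x powr p"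
        using K c p by (intro mult_left_mono powr_mono2) auto
      then have "a K \<le> int i" unfolding a_def x(2) by (simp add: floor_le_iff)
      then have "a K \<le> blk_start a i" using True bounds(3)[of K] by (simp add: a_def)
      moreover have "c * real K powr p < real_of_int (a K) + 1" unfolding a_def by linarith
      ultimately have "blk_len a i \<le> real i - c * real K powr p + 2" unfolding len by linarith
      also have "real i \<le> c * (real K + 1) powr p"
        unfolding x(2)[symmetric] using K x c p by (intro mult_left_mono powr_mono2) auto
      also have "c * (real K + 1) powr p - c * real K powr p + 2 \<le> c * (p * (real K + 1) powr (p - 1)) + 2"
        using powr_diff_le[of "real K" p] True c p by (simp flip: right_diff_distrib)
      also have "\<dots> \<le> c * (p * (2 * x) powr (p - 1)) + 2"
        using K True c p by (intro add_right_mono mult_left_mono powr_mono2) auto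
      also have "c * (p * (2 * x) powr (p - 1)) = B * real i powr ?r"
      proof -
        have "x powr (p - 1) = (real i / c) powr ?r" using p by (simp add: x_def powr_powr diff_divide_distrib)
        also have "\<dots> = (1 / c) powr ?r * real i powr ?r" using c by (simp add: powr_mult[symmetric])
        finally show ?thesis using x by (simp add: B_def powr_mult)
      qed
      also have "B * real i powr ?r \<le> B * real n powr ?r"
        using B i exp by (intro mult_left_mono powr_mono2) auto
      finally have "blk_len a i \<le> B * real n powr ?r + 2" by simp
      moreover have "2 * 1 \<le> 2 * real n powr ?r" using n1 by simp
      moreover have "0 \<le> c * real n powr ?r" using c by simp
      ultimately show ?thesis by (simp add: distrib_right)
    next
      case False
      then have "x powr p < 1" using K x p powr_less_mono2[of p x 1] by simp
      then have "real i \<le> c" using x(2) c by (smt (verit) mult_left_le)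
      then have "blk_len a i \<le> c" using bounds(1) unfolding len by linarith
      also have "\<dots> \<le> c * real n powr ?r" using n1 c by simp
      also have "\<dots> \<le> (B + 2 + c) * real n powr ?r" using B by (intro mult_right_mono) auto
      finally show ?thesis .
    qed
  qed
qed

section \<open>Causal processes\<close>

context iid_seq
begin

lemma memLp_shiftseq:
  assumes [measurable]: "f \<in> borel_measurable P"
  shows "memLp P p (\<lambda>x. f (shiftseq k x)) \<longleftrightarrow> memLp P p f"
  using memLp_distr[of "shiftseq k" P P f p] by (simp add: distr_shiftseq)

lemma integral_shiftseq:
  fixes f :: "(int \<Rightarrow> 'b) \<Rightarrow> real"
  assumes [measurable]: "f \<in> borel_measurable P"
  shows "(\<integral>x. f (shiftseq k x) \<partial>P) = (\<integral>x. f x \<partial>P)"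
  using integral_distr[of "shiftseq k" P P f] by (simp add: distr_shiftseq)

lemma memLp_fst:
  assumes "memLp P p f"
  shows "memLp (P \<Otimes>\<^sub>M P) p (\<lambda>z. f (fst z))" "Lnorm (P \<Otimes>\<^sub>M P) p (\<lambda>z. f (fst z)) = Lnorm P p f"
  using memLp_mix[OF assms, of UNIV] by (simp_all add: mix_def[abs_def])

lemma coupled_norm_sum_le:
  assumes "p \<ge> 1" "\<And>i. i \<in> I \<Longrightarrow> memLp P p (f i)"
  shows "coupled_norm P p j (\<lambda>x. \<Sum>i\<in>I. f i x) \<le> (\<Sum>i\<in>I. coupled_norm P p j (f i))"
  unfolding coupled_norm_def sum_subtractf[symmetric]
  using assms by (intro Lnorm_sum_le memLp_coupled_diff) auto

lemma memLp_square:
  assumes "memLp M (2 * r) f"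
  shows "memLp M r (\<lambda>x. (f x)\<^sup>2)"
proof -
  have "\<bar>(f x)\<^sup>2\<bar> powr r = \<bar>f x\<bar> powr (2 * r)" for x
    by (cases "f x = 0") (simp_all add: powr_powr[symmetric])
  moreover have "(\<lambda>x. (f x)\<^sup>2) \<in> borel_measurable M"
    using memLp_meas[OF assms] by measurable
  ultimately show ?thesis using assms by (simp add: memLp_def)
qed

text \<open>Write the difference of squares as (f - f')(f + f') and apply Hoelder's inequality with
  equal exponents, which turns L^(2r) into L^r. Of the constant 4, one factor 2 is Hoelder's and the
  other comes from the triangle inequality for f + f'.\<close>

lemma coupled_norm_square_le:
  assumes r: "r \<ge> 1" and f: "memLp P (2 * r) f"
  shows "coupled_norm P r j (\<lambda>x. (f x)\<^sup>2) \<le> 4 * Lnorm P (2 * r) f * coupled_norm P (2 * r) j f"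
proof -
  let ?PP = "P \<Otimes>\<^sub>M P" and ?f = "\<lambda>z. f (fst z)" and ?f' = "\<lambda>z. f (mix (- {j}) (fst z) (snd z))"
  let ?u = "\<lambda>z. ?f z - ?f' z" and ?v = "\<lambda>z. ?f z + ?f' z"
  have m: "memLp ?PP (2 * r) ?f" "memLp ?PP (2 * r) ?f'" using memLp_fst(1) memLp_mix(1) f by auto
  have u: "memLp ?PP (2 * r) ?u" and v: "memLp ?PP (2 * r) ?v"
    using m r by (auto intro!: memLp_diff memLp_add)
  have vle: "Lnorm ?PP (2 * r) ?v \<le> 2 * Lnorm P (2 * r) f"
    using Lnorm_triangle[OF _ m] r memLp_fst(2)[OF f] memLp_mix(2)[OF f, of "- {j}"] by simp
  have "(\<integral>z. \<bar>(?f z)\<^sup>2 - (?f' z)\<^sup>2\<bar> powr r \<partial>?PP) = (\<integral>z. \<bar>?u z\<bar> powr r * \<bar>?v z\<bar> powr r \<partial>?PP)"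
    by (simp add: powr_mult[symmetric] abs_mult[symmetric] power2_eq_square algebra_simps)
  also have "\<dots> \<le> 2 * Lnorm ?PP (2 * r) ?u powr r * Lnorm ?PP (2 * r) ?v powr r"
    using r u v by (intro Holder_crude) auto
  \<comment> \<open>2 \<le> 2^r lets the Hoelder constant enter the r-th power.\<close>
  also have "\<dots> \<le> 2 powr r * Lnorm ?PP (2 * r) ?u powr r * Lnorm ?PP (2 * r) ?v powr r"
    using r powr_mono[of 1 r 2] by (intro mult_right_mono) auto
  also have "\<dots> = (2 * Lnorm ?PP (2 * r) ?u * Lnorm ?PP (2 * r) ?v) powr r"
    by (simp add: powr_mult Lnorm_nonneg)
  finally have "Lnorm ?PP r (\<lambda>z. (?f z)\<^sup>2 - (?f' z)\<^sup>2) \<le> 2 * Lnorm ?PP (2 * r) ?u * Lnorm ?PP (2 * r) ?v"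
    using r by (intro Lnorm_leI) (auto simp: Lnorm_nonneg)
  also have "\<dots> \<le> 2 * Lnorm ?PP (2 * r) ?u * (2 * Lnorm P (2 * r) f)"
    using vle by (intro mult_left_mono) (auto simp: Lnorm_nonneg)
  finally show ?thesis by (simp add: coupled_norm_def mult_ac)
qed

end

text \<open>Coupled norms are indexed by integer lags and vanish at negative ones, while summability
  is given along the naturals.\<close>

lemma sum_int_le_suminf:
  fixes f :: "int \<Rightarrow> real"
  assumes "finite J" "\<And>i. f i \<ge> 0" "\<And>i. i < 0 \<Longrightarrow> f i = 0" "summable (\<lambda>n. f (int n))"
  shows "(\<Sum>i\<in>J. f i) \<le> (\<Sum>n. f (int n))"
proof -
  have "0 \<le> i" if "f i \<noteq> 0" for i using assms(3)[of i] that by linarith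
  then have "(\<Sum>i\<in>J. f i) = (\<Sum>i\<in>J \<inter> {0..}. f i)"
    using assms(1) by (intro sum.mono_neutral_right) auto
  also have "\<dots> = (\<Sum>n\<in>nat ` (J \<inter> {0..}). f (int n))"
    by (subst sum.reindex) (auto simp: inj_on_def intro!: sum.cong)
  also have "\<dots> \<le> (\<Sum>n. f (int n))"
    using assms by (intro sum_le_suminf) auto
  finally show ?thesis .
qed

locale causal_process = iid_seq Q for Q :: "'b measure" +
  fixes g :: "(nat \<Rightarrow> 'b) \<Rightarrow> real"
  assumes g_meas: "g \<in> borel_measurable (Pi\<^sub>M UNIV (\<lambda>_. Q))"
begin

definition X :: "int \<Rightarrow> (int \<Rightarrow> 'b) \<Rightarrow> real" where
  "X i x = g (\<lambda>k. x (i - int k))"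

lemma measurable_X [measurable]: "X i \<in> borel_measurable P"
proof -
  have "(\<lambda>x k. x (i - int k)) \<in> P \<rightarrow>\<^sub>M Pi\<^sub>M UNIV (\<lambda>_. Q)"
    by (rule measurable_PiM_single') (auto simp: space_PiM PiE_iff)
  then show ?thesis unfolding X_def[abs_def] by (rule measurable_compose[OF _ g_meas])
qed

lemma X_shift: "X (i + k) x = X i (shiftseq k x)"
  by (simp add: X_def shiftseq_def algebra_simps)

lemma X_shift0: "X i = (\<lambda>x. X 0 (shiftseq i x))"
  using X_shift[of 0 i] by auto

lemma depends_on_X: "depends_on {..i} (X i)"
  by (auto simp: depends_on_def X_def mix_def intro!: arg_cong[of _ _ g])

lemma memLp_X: "memLp P p (X 0) \<Longrightarrow> memLp P p (X i)"
  by (subst X_shift0) (simp add: memLp_shiftseq)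

lemma integral_X: "(\<integral>x. X i x \<partial>P) = (\<integral>x. X 0 x \<partial>P)"
  by (subst X_shift0) (simp add: integral_shiftseq)

text \<open>The predictive dependence measure on the product space: \<open>cex P {..0} (X i)\<close>
  is the function g_i, and replacing coordinate 0 produces its argument F_0'.\<close>

definition pdep :: "nat \<Rightarrow> real" where
  "pdep i = coupled_norm P 2 0 (cex P {..0} (X (int i)))"

definition autocov :: "int \<Rightarrow> real" where
  "autocov k = (\<integral>x. X 0 x * X k x \<partial>P)"

lemma pdep_nonneg: "pdep i \<ge> 0"
  by (simp add: pdep_def coupled_norm_nonneg)

text \<open>Stationarity reduces to j = 0. By the tower property X_i may be replaced by H, its
  conditional expectation given {..0}, before projecting; the coupling inequality applied to H then
  gives the predictive instead of the physical measure.\<close>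

lemma projection_X_le:
  assumes "memLp P 2 (X 0)"
  shows "Lnorm P 2 (\<lambda>x. cex P {..j} (X (j + int i)) x - cex P {..j - 1} (X (j + int i)) x) \<le> pdep i"
proof -
  let ?X = "X (int i)" and ?H = "cex P {..0} (X (int i))"
  have mX: "memLp P 2 ?X" by (rule memLp_X[OF assms])
  then have int: "integrable P ?X" by (intro prod.P.memLp_integrable[of 2]) auto
  have eq: "X (j + int i) = (\<lambda>x. ?X (shiftseq j x))" using X_shift[of "int i" j] by (auto simp: add.commute)
  have sets: "{i. i + j \<in> {..j}} = {..0}" "{i. i + j \<in> {..j - 1}} = {..-1}" by auto
  have "AE x in P. cex P {..j} (X (j + int i)) x - cex P {..j - 1} (X (j + int i)) x
      = ?H (shiftseq j x) - cex P {..-1} ?X (shiftseq j x)"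
  proof (rule AE_I2)
    fix x assume x: "x \<in> space P"
    show "cex P {..j} (X (j + int i)) x - cex P {..j - 1} (X (j + int i)) x
      = ?H (shiftseq j x) - cex P {..-1} ?X (shiftseq j x)"
      unfolding eq cex_shiftseq[OF measurable_X x] sets ..
  qed
  then have "Lnorm P 2 (\<lambda>x. cex P {..j} (X (j + int i)) x - cex P {..j - 1} (X (j + int i)) x)
      = Lnorm P 2 (\<lambda>x. ?H (shiftseq j x) - cex P {..-1} ?X (shiftseq j x))"
    by (rule Lnorm_cong_AE) auto
  also have "\<dots> = Lnorm P 2 (\<lambda>x. ?H x - cex P {..-1} ?X x)"
    using Lnorm_shiftseq[of "\<lambda>x. ?H x - cex P {..-1} ?X x" 2 j] by simp
  also have "\<dots> = Lnorm P 2 (\<lambda>x. cex P {..0} ?H x - cex P {..0 - 1} ?H x)"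
  proof (rule Lnorm_cong_AE)
    have "{..-1} \<inter> {..0} = {..-1::int}" by auto
    then have "AE x in P. cex P {..-1} ?H x = cex P {..-1} ?X x"
      using cex_tower[OF int, of "{..-1}" "{..0}"] by simp
    then show "AE x in P. ?H x - cex P {..-1} ?X x = cex P {..0} ?H x - cex P {..0 - 1} ?H x"
      by eventually_elim (simp add: cex_eq[OF depends_on_cex])
  qed auto
  also have "\<dots> \<le> pdep i"
    unfolding pdep_def by (intro projection_le_coupled_norm memLp_cex mX) auto
  finally show ?thesis .
qed

lemma integral_X_mult: "(\<integral>x. X a x * X b x \<partial>P) = autocov (b - a)"
proof -
  have "X a x * X b x = X 0 (shiftseq a x) * X (b - a) (shiftseq a x)" for x
    using X_shift[of 0 a x] X_shift[of "b - a" a x] by simp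
  then show ?thesis
    using integral_shiftseq[of "\<lambda>x. X 0 x * X (b - a) x" a] by (simp add: autocov_def)
qed

lemma autocov_even: "autocov (- k) = autocov k"
  using integral_X_mult[of k 0] by (simp add: autocov_def mult.commute)

text \<open>R m correlates X_k with the part of X_0 known at time -m. It starts at the covariance
  for m = 0, tends to 0, and its m-th increment is the inner product of the projections of X_0 and
  X_k at time -m.\<close>

lemma autocov_le:
  assumes X: "memLp P 2 (X 0)" and mean: "(\<integral>x. X 0 x \<partial>P) = 0" and sum: "summable pdep"
  shows "\<bar>autocov (int k)\<bar> \<le> (\<Sum>i. pdep i * pdep (i + k))"
proof -
  let ?E = "\<lambda>m. cex P {..- int m}"
  define R where "R m = (\<integral>x. ?E m (X 0) x * X (int k) x \<partial>P)" for m
  have mX: "memLp P 2 (X i)" for i by (rule memLp_X[OF X])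
  have mE: "memLp P 2 (?E m (X i))" for m i by (rule memLp_cex) (auto simp: mX)
  have step: "\<bar>R m - R (Suc m)\<bar> \<le> pdep m * pdep (m + k)" for m
  proof -
    define D where "D i x = ?E m (X i) x - ?E (Suc m) (X i) x" for i x
    have mD: "memLp P 2 (D i)" for i
      unfolding D_def[abs_def] by (intro memLp_diff mE) auto
    have [measurable]: "D i \<in> borel_measurable P" for i by (rule memLp_meas[OF mD])
    have dep: "depends_on {..- int m} (D i)" for i
      unfolding D_def[abs_def] by (rule depends_on_sub_cex) simp
    have "R m - R (Suc m) = (\<integral>x. ?E m (X 0) x * X (int k) x - ?E (Suc m) (X 0) x * X (int k) x \<partial>P)"
      unfolding R_def by (intro Bochner_Integration.integral_diff[symmetric] memLp_2_mult mE mX)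
    also have "\<dots> = (\<integral>x. D 0 x * X (int k) x \<partial>P)" by (simp add: D_def left_diff_distrib)
    \<comment> \<open>D 0 depends on the coordinates up to -m only, so X_k may be replaced by its
      conditional expectation given them; the part of it known one step earlier is then orthogonal
      to D 0.\<close>
    also have "\<dots> = (\<integral>x. D 0 x * ?E m (X (int k)) x \<partial>P)"
      by (intro integral_mult_cex[symmetric] dep memLp_2_mult mD mX) simp
    also have "\<dots> = (\<integral>x. D 0 x * D (int k) x + ?E (Suc m) (X (int k)) x * D 0 x \<partial>P)"
      by (simp add: D_def algebra_simps)
    also have "\<dots> = (\<integral>x. D 0 x * D (int k) x \<partial>P) + (\<integral>x. ?E (Suc m) (X (int k)) x * D 0 x \<partial>P)"
      by (intro Bochner_Integration.integral_add memLp_2_mult mD mE)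
    also have "(\<integral>x. ?E (Suc m) (X (int k)) x * D 0 x \<partial>P) = 0"
      unfolding D_def
      by (intro integral_mult_projection depends_on_cex memLp_2_mult mE mX) auto
    finally have "R m - R (Suc m) = (\<integral>x. D 0 x * D (int k) x \<partial>P)" by simp
    then have "\<bar>R m - R (Suc m)\<bar> \<le> Lnorm P 2 (D 0) * Lnorm P 2 (D (int k))"
      using Cauchy_Schwarz_Lnorm[OF mD mD] by simp
    also have "\<dots> \<le> pdep m * pdep (m + k)"
    proof (intro mult_mono Lnorm_nonneg pdep_nonneg)
      have e: "- int (Suc m) = - int m - 1" by simp
      show "Lnorm P 2 (D 0) \<le> pdep m"
        using projection_X_le[OF X, of "- int m" m] unfolding D_def[abs_def] e by simp
      show "Lnorm P 2 (D (int k)) \<le> pdep (m + k)"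
        using projection_X_le[OF X, of "- int m" "m + k"] unfolding D_def[abs_def] e by simp
    qed
    finally show ?thesis .
  qed
  have "?E 0 (X 0) x = X 0 x" for x using cex_eq[OF depends_on_X[of 0]] by simp
  then have R0: "R 0 = autocov (int k)" by (simp add: R_def autocov_def)
  have bound: "\<bar>autocov (int k)\<bar> \<le> (\<Sum>i. pdep i * pdep (i + k)) + \<bar>R m\<bar>" for m
  proof -
    have "\<bar>R 0 - R m\<bar> \<le> (\<Sum>i<m. pdep i * pdep (i + k))"
    proof (induction m)
      case (Suc m)
      then show ?case using step[of m] by simp
    qed simp
    also have "\<dots> \<le> (\<Sum>i. pdep i * pdep (i + k))"
      using pdep_nonneg by (intro sum_le_suminf summable_mult_shift sum) auto
    finally show ?thesis using R0 by linarith
  qed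
  have "R \<longlonglongrightarrow> 0"
    unfolding R_def[abs_def] by (rule integral_tail_cex_mult_tendsto[OF X mean mX])
  then have "(\<lambda>m. (\<Sum>i. pdep i * pdep (i + k)) + \<bar>R m\<bar>) \<longlonglongrightarrow> (\<Sum>i. pdep i * pdep (i + k)) + \<bar>0\<bar>"
    by (intro tendsto_intros)
  then show ?thesis using bound by (intro LIMSEQ_le_const[of _ _ "\<bar>autocov (int k)\<bar>"]) auto
qed

lemma integral_square_sum_X:
  assumes X: "memLp P 2 (X 0)"
  shows "(\<integral>x. (\<Sum>j\<in>{s..s + int l - 1}. X j x)\<^sup>2 \<partial>P) = (\<Sum>a<l. \<Sum>b<l. autocov (int b - int a))"
proof -
  have mX: "memLp P 2 (X i)" for i by (rule memLp_X[OF X])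
  have img: "{s..s + int l - 1} = (\<lambda>a. s + int a) ` {..<l}"
  proof
    show "{s..s + int l - 1} \<subseteq> (\<lambda>a. s + int a) ` {..<l}"
    proof
      fix j assume "j \<in> {s..s + int l - 1}"
      then show "j \<in> (\<lambda>a. s + int a) ` {..<l}" by (intro image_eqI[of _ _ "nat (j - s)"]) auto
    qed
  qed auto
  have "(\<Sum>j\<in>{s..s + int l - 1}. X j x)\<^sup>2 = (\<Sum>a<l. \<Sum>b<l. X (s + int a) x * X (s + int b) x)" for x
    unfolding img by (subst sum.reindex) (auto simp: power2_eq_square sum_product inj_on_def)
  then show ?thesis
    using mX by (simp add: memLp_2_mult integral_X_mult)
qed

lemma lrvar_eq:
  assumes mean: "(\<integral>x. X 0 x \<partial>P) = 0"
  shows "lrvar P X = (\<Sum>\<^sub>\<infinity>k. autocov k)"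
proof -
  have "(\<integral>x. X k x \<partial>P) = 0" for k using integral_X[of k] mean by simp
  then show ?thesis by (simp add: lrvar_def autocov_def)
qed

lemma block_variance_error:
  assumes X: "memLp P 2 (X 0)" and mean: "(\<integral>x. X 0 x \<partial>P) = 0" and q: "0 < q" "q \<le> 1"
    and sum: "summable (\<lambda>j. real j powr q * pdep j)"
  obtains G where "G \<ge> 0" "\<And>s l. \<bar>(\<integral>x. (\<Sum>j\<in>{s..s + int l - 1}. X j x)\<^sup>2 \<partial>P) - real l * lrvar P X\<bar>
    \<le> G * real l powr (1 - q)"
proof -
  have s1: "summable pdep" by (rule summable_powr_weight[OF q(1) pdep_nonneg sum])
  have s2: "summable (\<lambda>k. real k powr q * \<bar>autocov (int k)\<bar>)"
    by (rule summable_weighted_autocorrelation[OF q(1) pdep_nonneg sum])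
      (auto simp: autocov_le[OF X mean s1])
  from long_run_variance_error[where c = autocov, OF q autocov_even s2] show ?thesis
    using that[of "2 * (\<Sum>k. real k powr q * \<bar>autocov (int k)\<bar>)"] s2
    by (auto simp: integral_square_sum_X[OF X] lrvar_eq[OF mean] suminf_nonneg)
qed

text \<open>\<open>V\<^sub>n\<close> for arbitrary block starts \<open>t\<^sub>i\<close>.\<close>

definition sqsum :: "(nat \<Rightarrow> int) \<Rightarrow> nat \<Rightarrow> (int \<Rightarrow> 'b) \<Rightarrow> real" where
  "sqsum t n x = (\<Sum>i=1..n. (\<Sum>j\<in>{t i..int i}. X j x)\<^sup>2)"

text \<open>G is chosen before t, n and L, because L grows with n in the application.\<close>

lemma expectation_sqsum_error:
  assumes X: "memLp P 2 (X 0)" and mean: "(\<integral>x. X 0 x \<partial>P) = 0" and q: "0 < q" "q \<le> 1"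
    and sum: "summable (\<lambda>j. real j powr q * pdep j)"
  obtains G where "G \<ge> 0" "\<And>t n L. (\<And>i. 1 \<le> i \<Longrightarrow> i \<le> n \<Longrightarrow> t i \<le> int i \<and> real_of_int (int i - t i + 1) \<le> L) \<Longrightarrow>
    \<bar>(\<integral>x. sqsum t n x \<partial>P) - (\<Sum>i=1..n. real_of_int (int i - t i + 1)) * lrvar P X\<bar>
      \<le> G * (real n * L powr (1 - q))"
proof -
  obtain G where G: "G \<ge> 0"
    and err: "\<And>s l. \<bar>(\<integral>x. (\<Sum>j\<in>{s..s + int l - 1}. X j x)\<^sup>2 \<partial>P) - real l * lrvar P X\<bar>
    \<le> G * real l powr (1 - q)"
    using block_variance_error[OF assms] by blast
  show ?thesis
  proof (rule that[OF G])
    fix t n L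
    assume t: "\<And>i. 1 \<le> i \<Longrightarrow> i \<le> n \<Longrightarrow> t i \<le> int i \<and> real_of_int (int i - t i + 1) \<le> L"
    let ?l = "\<lambda>i. real_of_int (int i - t i + 1)" and ?W = "\<lambda>i x. \<Sum>j\<in>{t i..int i}. X j x"
    have mW: "memLp P 2 (?W i)" for i by (intro memLp_sum memLp_X[OF X]) auto
    have "(\<integral>x. sqsum t n x \<partial>P) = (\<Sum>i=1..n. \<integral>x. (?W i x)\<^sup>2 \<partial>P)"
      unfolding sqsum_def using mW by (intro Bochner_Integration.integral_sum) (simp add: memLp_2_iff)
    then have "\<bar>(\<integral>x. sqsum t n x \<partial>P) - (\<Sum>i=1..n. ?l i) * lrvar P X\<bar>
        = \<bar>\<Sum>i=1..n. (\<integral>x. (?W i x)\<^sup>2 \<partial>P) - ?l i * lrvar P X\<bar>"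
      by (simp only: sum_subtractf sum_distrib_right)
    also have "\<dots> \<le> (\<Sum>i=1..n. \<bar>(\<integral>x. (?W i x)\<^sup>2 \<partial>P) - ?l i * lrvar P X\<bar>)" by (rule sum_abs)
    also have "\<dots> \<le> (\<Sum>i=1..n. G * L powr (1 - q))"
    proof (rule sum_mono)
      fix i assume i: "i \<in> {1..n}"
      define l where "l = nat (int i - t i + 1)"
      have l: "int l = int i - t i + 1" "real l = ?l i" "real l \<le> L" using t[of i] i by (auto simp: l_def)
      have "{t i..int i} = {t i..t i + int l - 1}" by (simp add: l)
      then have "\<bar>(\<integral>x. (?W i x)\<^sup>2 \<partial>P) - ?l i * lrvar P X\<bar> \<le> G * real l powr (1 - q)"
        using err[of "t i" l] l(2) by metis
      also have "\<dots> \<le> G * L powr (1 - q)" using G q l by (intro mult_left_mono powr_mono2) auto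
      finally show "\<bar>(\<integral>x. (?W i x)\<^sup>2 \<partial>P) - ?l i * lrvar P X\<bar> \<le> G * L powr (1 - q)" .
    qed
    finally show "\<bar>(\<integral>x. sqsum t n x \<partial>P) - (\<Sum>i=1..n. ?l i) * lrvar P X\<bar> \<le> G * (real n * L powr (1 - q))"
      by (simp add: mult_ac)
  qed
qed

section \<open>Coupled norms of block sums and the deviation of V_n\<close>

lemma coupled_norm_X: "coupled_norm P p j (X l) = coupled_norm P p 0 (X (l - j))"
proof -
  have "X l = (\<lambda>x. X (l - j) (shiftseq j x))" using X_shift[of "l - j" j] by auto
  then show ?thesis using coupled_norm_shiftseq[OF measurable_X, of p j "l - j" j] by simp
qed

lemma coupled_norm_X_future: "i < 0 \<Longrightarrow> coupled_norm P p 0 (X i) = 0"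
  by (intro coupled_norm_eq_0 depends_on_mono[OF depends_on_X]) auto

text \<open>The coupled norm of X_l at coordinate j depends on l - j alone and vanishes for l < j,
  so rows and columns of this array are both parts of one convergent series.\<close>

lemma
  assumes sum: "summable (\<lambda>i. coupled_norm P p 0 (X (int i)))" and J: "finite J"
  defines "\<Delta> \<equiv> \<Sum>i. coupled_norm P p 0 (X (int i))"
  shows sum_coupled_norm_X_time: "(\<Sum>l\<in>J. coupled_norm P p j (X l)) \<le> \<Delta>"
    and sum_coupled_norm_X_coord: "(\<Sum>j\<in>J. coupled_norm P p j (X l)) \<le> \<Delta>"
proof -
  let ?d = "\<lambda>i. coupled_norm P p 0 (X i)"
  have le: "(\<Sum>i\<in>K. ?d i) \<le> \<Delta>" if "finite K" for K
    unfolding \<Delta>_def by (intro sum_int_le_suminf that sum coupled_norm_nonneg coupled_norm_X_future)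
  have "(\<Sum>l\<in>J. coupled_norm P p j (X l)) = (\<Sum>i\<in>(\<lambda>l. l - j) ` J. ?d i)"
    by (subst sum.reindex) (auto simp: inj_on_def coupled_norm_X[of p j])
  then show "(\<Sum>l\<in>J. coupled_norm P p j (X l)) \<le> \<Delta>" using le J by simp
  have "(\<Sum>j\<in>J. coupled_norm P p j (X l)) = (\<Sum>i\<in>(\<lambda>j. l - j) ` J. ?d i)"
    by (subst sum.reindex) (auto simp: inj_on_def coupled_norm_X[of p _ l])
  then show "(\<Sum>j\<in>J. coupled_norm P p j (X l)) \<le> \<Delta>" using le J by simp
qed

lemma depends_on_sum_X: "depends_on {..n} (\<lambda>x. \<Sum>j\<in>{s..n}. X j x)"
proof -
  have "X j (mix {..n} x y) = X j x" if "j \<le> n" for j x y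
    by (rule depends_onD[OF depends_on_mono[OF depends_on_X]]) (use that in auto)
  then show ?thesis by (auto simp: depends_on_def intro!: sum.cong)
qed

text \<open>Coordinate j affects the block sum by at most \<beta>_j. Each \<beta>_j is at most
  \<Delta>, and together they are at most \<Delta> times the block length, so their squares sum to
  at most \<Delta>^2 L; Rio's inequality turns this into square-root growth.\<close>

lemma Lnorm_sum_X_le:
  assumes p: "p > 2" and X: "memLp P p (X 0)" and mean: "(\<integral>x. X 0 x \<partial>P) = 0"
    and sum: "summable (\<lambda>i. coupled_norm P p 0 (X (int i)))"
  defines "\<Delta> \<equiv> \<Sum>i. coupled_norm P p 0 (X (int i))"
  assumes L: "s \<le> n" "real_of_int (n - s + 1) \<le> L"
  shows "Lnorm P p (\<lambda>x. \<Sum>j\<in>{s..n}. X j x) \<le> sqrt (4 * mart_const p) * \<Delta> * sqrt L"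
proof -
  let ?S = "\<lambda>x. \<Sum>j\<in>{s..n}. X j x"
  let ?\<beta> = "\<lambda>j. \<Sum>l\<in>{s..n}. coupled_norm P p j (X l)"
  have mX: "memLp P p (X j)" for j by (rule memLp_X[OF X])
  have mS: "memLp P p ?S" using p by (intro memLp_sum mX) auto
  have \<Delta>: "\<Delta> \<ge> 0" unfolding \<Delta>_def by (intro suminf_nonneg sum coupled_norm_nonneg)
  have L0: "L \<ge> 0" using L by auto
  have "(\<integral>x. ?S x \<partial>P) = (\<Sum>j\<in>{s..n}. \<integral>x. X j x \<partial>P)"
    using p by (intro Bochner_Integration.integral_sum prod.P.memLp_integrable[OF _ mX]) auto
  then have mS0: "(\<integral>x. ?S x \<partial>P) = 0" using integral_X mean by simp
  have "(\<integral>x. \<bar>?S x - (\<integral>z. ?S z \<partial>P)\<bar> powr p \<partial>P) \<le> (4 * mart_const p * (\<Delta>\<^sup>2 * L)) powr (p / 2)"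
  proof (rule moment_bound_gt_2[OF p mS depends_on_sum_X])
    show "coupled_norm P p j ?S \<le> ?\<beta> j" for j using p mX by (intro coupled_norm_sum_le) auto
    fix J :: "int set" assume J: "finite J"
    have "(\<Sum>j\<in>J. (?\<beta> j)\<^sup>2) \<le> (\<Sum>j\<in>J. \<Delta> * ?\<beta> j)"
      unfolding power2_eq_square \<Delta>_def
      by (intro sum_mono mult_right_mono sum_coupled_norm_X_time sum sum_nonneg coupled_norm_nonneg) auto
    also have "\<dots> = \<Delta> * (\<Sum>l\<in>{s..n}. \<Sum>j\<in>J. coupled_norm P p j (X l))"
      by (subst sum.swap) (simp add: sum_distrib_left)
    also have "\<dots> \<le> \<Delta> * (\<Sum>l\<in>{s..n}. \<Delta>)"
      using \<Delta> J sum unfolding \<Delta>_def by (intro mult_left_mono sum_mono sum_coupled_norm_X_coord) auto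
    also have "\<dots> = \<Delta>\<^sup>2 * real_of_int (n - s + 1)" using L by (simp add: power2_eq_square)
    also have "\<dots> \<le> \<Delta>\<^sup>2 * L" using L by (intro mult_left_mono) auto
    finally show "(\<Sum>j\<in>J. (?\<beta> j)\<^sup>2) \<le> \<Delta>\<^sup>2 * L" .
  qed
  also have "\<dots> = (sqrt (4 * mart_const p) * \<Delta> * sqrt L) powr p"
  proof -
    have "4 * mart_const p * (\<Delta>\<^sup>2 * L) = (sqrt (4 * mart_const p) * \<Delta> * sqrt L)\<^sup>2"
      using mart_const_ge_1[of p] p L0 by (simp add: power_mult_distrib)
    moreover have "0 \<le> sqrt (4 * mart_const p) * \<Delta> * sqrt L"
      using \<Delta> L0 mart_const_ge_1[of p] p by simp
    moreover have "(y\<^sup>2) powr (p / 2) = y powr p" if "0 \<le> y" for y :: real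
      using that by (cases "y = 0") (simp_all add: powr_powr flip: powr_numeral)
    ultimately show ?thesis by simp
  qed
  finally show ?thesis
    using \<Delta> L0 mart_const_ge_1[of p] p by (intro Lnorm_leI) (simp_all add: mS0)
qed

text \<open>An index l lies in the block ending at i only if l \<le> i and i - l + 1 \<le> L, so it
  is counted for at most L values of i.\<close>

lemma sum_blocks_le:
  fixes f :: "int \<Rightarrow> real"
  assumes f: "\<And>l. f l \<ge> 0"
    and t: "\<And>i. 1 \<le> i \<Longrightarrow> i \<le> n \<Longrightarrow> 1 \<le> t i \<and> t i \<le> int i \<and> real_of_int (int i - t i + 1) \<le> L"
    and L: "L \<ge> 0"
  shows "(\<Sum>i=1..n. \<Sum>l\<in>{t i..int i}. f l) \<le> L * (\<Sum>l\<in>{1..int n}. f l)"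
proof -
  have "(\<Sum>i=1..n. \<Sum>l\<in>{t i..int i}. f l)
      = (\<Sum>i=1..n. \<Sum>l\<in>{1..int n}. if l \<in> {t i..int i} then f l else 0)"
    using t by (intro sum.cong refl sum.mono_neutral_cong_left) force+
  also have "\<dots> = (\<Sum>l\<in>{1..int n}. \<Sum>i=1..n. if l \<in> {t i..int i} then f l else 0)" by (rule sum.swap)
  also have "\<dots> \<le> (\<Sum>l\<in>{1..int n}. L * f l)"
  proof (rule sum_mono)
    fix l assume l: "l \<in> {1..int n}"
    let ?I = "{i \<in> {1..n}. l \<in> {t i..int i}}"
    have "?I \<subseteq> {nat l..<nat l + nat \<lfloor>L\<rfloor>}"
    proof
      fix i assume i: "i \<in> ?I"
      then have "real_of_int (int i - l + 1) \<le> L" using t[of i] by auto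
      then have "int i - l + 1 \<le> \<lfloor>L\<rfloor>" by linarith
      then show "i \<in> {nat l..<nat l + nat \<lfloor>L\<rfloor>}" using i l by auto
    qed
    then have "card ?I \<le> card {nat l..<nat l + nat \<lfloor>L\<rfloor>}" by (intro card_mono) auto
    then have "real (card ?I) \<le> L" using L by (simp add: nat_le_iff le_nat_iff) linarith
    moreover have "(\<Sum>i=1..n. if l \<in> {t i..int i} then f l else 0) = real (card ?I) * f l"
      by (subst sum.inter_filter[symmetric]) auto
    ultimately show "(\<Sum>i=1..n. if l \<in> {t i..int i} then f l else 0) \<le> L * f l"
      using f[of l] by (simp add: mult_right_mono)
  qed
  finally show ?thesis by (simp add: sum_distrib_left)
qed

text \<open>A change of coordinate j alters V_n by at most B b_j, where b_j adds the coupled norms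
  of X_1, ..., X_n at j. Since b_j \<le> \<Delta> and the b_j add up to at most n \<Delta>, their
  r-th powers add up to at most n \<Delta>^r; this is the origin of n^(1/r).\<close>

lemma Lnorm_sqsum_le:
  assumes r: "1 < r" "r \<le> 2" and X: "memLp P (2 * r) (X 0)" and mean: "(\<integral>x. X 0 x \<partial>P) = 0"
    and sum: "summable (\<lambda>i. coupled_norm P (2 * r) 0 (X (int i)))"
  obtains K where "K \<ge> 0" "\<And>t n L. L \<ge> 0 \<Longrightarrow>
    (\<And>i. 1 \<le> i \<Longrightarrow> i \<le> n \<Longrightarrow> 1 \<le> t i \<and> t i \<le> int i \<and> real_of_int (int i - t i + 1) \<le> L) \<Longrightarrow>
    Lnorm P r (\<lambda>x. sqsum t n x - (\<integral>z. sqsum t n z \<partial>P)) \<le> K * (L powr (3 / 2) * real n powr (1 / r))"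
proof -
  define \<Delta> where "\<Delta> = (\<Sum>i. coupled_norm P (2 * r) 0 (X (int i)))"
  define A where "A = sqrt (4 * mart_const (2 * r)) * \<Delta>"
  define K where "K = mart_const r powr (1 / r) * (4 * A * \<Delta>)"
  have \<Delta>: "\<Delta> \<ge> 0" unfolding \<Delta>_def by (intro suminf_nonneg sum coupled_norm_nonneg)
  have A: "A \<ge> 0" using \<Delta> mart_const_ge_1[of "2 * r"] r by (simp add: A_def)
  have K: "K \<ge> 0" using A \<Delta> by (simp add: K_def)
  show ?thesis
  proof (rule that[OF K])
    fix t n L
    assume L: "L \<ge> 0"
      and t: "\<And>i. 1 \<le> i \<Longrightarrow> i \<le> n \<Longrightarrow> 1 \<le> t i \<and> t i \<le> int i \<and> real_of_int (int i - t i + 1) \<le> L"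
    let ?W = "\<lambda>i x. \<Sum>j\<in>{t i..int i}. X j x" and ?V = "sqsum t n"
    let ?b = "\<lambda>j. \<Sum>l\<in>{1..int n}. coupled_norm P (2 * r) j (X l)"
    \<comment> \<open>4 comes from \<open>coupled_norm_square_le\<close>, A sqrt L bounds the norm
      of a block sum, and L counts the blocks that contain a given index.\<close>
    define B where "B = 4 * A * sqrt L * L"
    have B: "B \<ge> 0" using A L by (simp add: B_def)
    have b: "?b j \<ge> 0" "?b j \<le> \<Delta>" for j
      unfolding \<Delta>_def using sum by (auto intro!: sum_nonneg coupled_norm_nonneg sum_coupled_norm_X_time)
    have mW: "memLp P (2 * r) (?W i)" for i using r by (intro memLp_sum memLp_X[OF X]) auto
    have mV: "memLp P r ?V"
      unfolding sqsum_def[abs_def] using r by (intro memLp_sum memLp_square mW) auto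
    have dep: "depends_on {..int n} ?V"
    proof -
      have "?W i (mix {..int n} x y) = ?W i x" if "i \<in> {1..n}" for i x y
        by (rule depends_onD[OF depends_on_mono[OF depends_on_sum_X]]) (use that in auto)
      then show ?thesis by (auto simp: depends_on_def sqsum_def intro!: sum.cong)
    qed
    have "(\<integral>x. \<bar>?V x - (\<integral>z. ?V z \<partial>P)\<bar> powr r \<partial>P) \<le> mart_const r * ((B * \<Delta>) powr r * real n)"
    proof (rule moment_bound_le_2[OF r mV dep])
      fix j
      have "coupled_norm P r j ?V \<le> (\<Sum>i=1..n. coupled_norm P r j (\<lambda>x. (?W i x)\<^sup>2))"
        unfolding sqsum_def[abs_def] using r by (intro coupled_norm_sum_le memLp_square mW) auto
      also have "\<dots> \<le> (\<Sum>i=1..n. 4 * (A * sqrt L) * (\<Sum>l\<in>{t i..int i}. coupled_norm P (2 * r) j (X l)))"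
      proof (rule sum_mono)
        fix i assume i: "i \<in> {1..n}"
        have "coupled_norm P r j (\<lambda>x. (?W i x)\<^sup>2) \<le> 4 * Lnorm P (2 * r) (?W i) * coupled_norm P (2 * r) j (?W i)"
          using r mW by (intro coupled_norm_square_le) auto
        also have "\<dots> \<le> 4 * (A * sqrt L) * (\<Sum>l\<in>{t i..int i}. coupled_norm P (2 * r) j (X l))"
        proof (intro mult_mono)
          show "Lnorm P (2 * r) (?W i) \<le> A * sqrt L"
            unfolding A_def \<Delta>_def using r t[of i] i by (intro Lnorm_sum_X_le X mean sum) auto
          show "coupled_norm P (2 * r) j (?W i) \<le> (\<Sum>l\<in>{t i..int i}. coupled_norm P (2 * r) j (X l))"
            using r by (intro coupled_norm_sum_le memLp_X[OF X]) auto
        qed (use A L in \<open>auto simp: Lnorm_nonneg coupled_norm_nonneg\<close>)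
        finally show "coupled_norm P r j (\<lambda>x. (?W i x)\<^sup>2)
          \<le> 4 * (A * sqrt L) * (\<Sum>l\<in>{t i..int i}. coupled_norm P (2 * r) j (X l))" .
      qed
      also have "\<dots> = 4 * (A * sqrt L) * (\<Sum>i=1..n. \<Sum>l\<in>{t i..int i}. coupled_norm P (2 * r) j (X l))"
        by (simp add: sum_distrib_left)
      also have "\<dots> \<le> 4 * (A * sqrt L) * (L * ?b j)"
        using A L t by (intro mult_left_mono sum_blocks_le coupled_norm_nonneg) auto
      finally show "coupled_norm P r j ?V \<le> B * ?b j" by (simp add: B_def mult_ac)
    next
      fix J :: "int set" assume J: "finite J"
      have "(\<Sum>j\<in>J. (B * ?b j) powr r) \<le> (\<Sum>j\<in>J. B powr r * \<Delta> powr (r - 1) * ?b j)"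
      proof (rule sum_mono)
        fix j
        have "?b j powr r = ?b j powr (r - 1) * ?b j"
          using b(1)[of j] by (cases "?b j = 0") (auto simp: powr_diff)
        also have "\<dots> \<le> \<Delta> powr (r - 1) * ?b j"
          using b[of j] r by (intro mult_right_mono powr_mono2) auto
        finally have "B powr r * ?b j powr r \<le> B powr r * (\<Delta> powr (r - 1) * ?b j)"
          by (rule mult_left_mono) simp
        then show "(B * ?b j) powr r \<le> B powr r * \<Delta> powr (r - 1) * ?b j"
          using b(1)[of j] B by (simp add: powr_mult mult.assoc)
      qed
      also have "\<dots> = B powr r * \<Delta> powr (r - 1) * (\<Sum>j\<in>J. ?b j)" by (simp add: sum_distrib_left)
      also have "(\<Sum>j\<in>J. ?b j) = (\<Sum>l\<in>{1..int n}. \<Sum>j\<in>J. coupled_norm P (2 * r) j (X l))" by (rule sum.swap)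
      also have "B powr r * \<Delta> powr (r - 1) * \<dots> \<le> B powr r * \<Delta> powr (r - 1) * (\<Sum>l\<in>{1..int n}. \<Delta>)"
        unfolding \<Delta>_def using J sum by (intro mult_left_mono sum_mono sum_coupled_norm_X_coord) auto
      also have "\<dots> = B powr r * (\<Delta> powr (r - 1) * \<Delta>) * real n" by simp
      also have "\<Delta> powr (r - 1) * \<Delta> = \<Delta> powr r" using \<Delta> by (cases "\<Delta> = 0") (auto simp: powr_diff)
      finally show "(\<Sum>j\<in>J. (B * ?b j) powr r) \<le> (B * \<Delta>) powr r * real n"
        using B \<Delta> by (simp add: powr_mult)
    qed
    also have "\<dots> = (mart_const r powr (1 / r) * (B * \<Delta>) * real n powr (1 / r)) powr r"
      using mart_const_ge_1[of r] r B \<Delta> by (simp add: powr_mult powr_powr)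
    finally have "Lnorm P r (\<lambda>x. ?V x - (\<integral>z. ?V z \<partial>P))
        \<le> mart_const r powr (1 / r) * (B * \<Delta>) * real n powr (1 / r)"
      using r B \<Delta> by (intro Lnorm_leI) auto
    also have "sqrt L * L = L powr (3 / 2)"
      using L by (cases "L = 0") (auto simp: powr_half_sqrt[symmetric] powr_mult_base mult.commute)
    then have "mart_const r powr (1 / r) * (B * \<Delta>) * real n powr (1 / r)
        = K * (L powr (3 / 2) * real n powr (1 / r))" by (simp add: B_def K_def flip: mult.assoc) 
    finally show "Lnorm P r (\<lambda>x. ?V x - (\<integral>z. ?V z \<partial>P)) \<le> K * (L powr (3 / 2) * real n powr (1 / r))" .
  qed
qed

end

section \<open>Transfer to the product space\<close>

context iid_seq
begin

lemma integral_mult_cex_bounded: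
  assumes h: "depends_on S h" "h \<in> borel_measurable P" "\<And>x. \<bar>h x\<bar> \<le> 1" and f: "integrable P f"
  shows "(\<integral>x. h x * f x \<partial>P) = (\<integral>x. h x * cex P S f x \<partial>P)"
proof (rule integral_mult_cex[OF h(1,2), symmetric])
  have [measurable]: "h \<in> borel_measurable P" "f \<in> borel_measurable P" using h f by auto
  show "integrable P (\<lambda>x. h x * f x)"
    using h(3) by (intro Bochner_Integration.integrable_bound[OF f])
      (auto simp: abs_mult intro!: mult_left_le_one_le)
qed

text \<open>Induction over the generated sigma-algebra. R consists of arbitrary sequences, so that
  invariance under \<open>mix\<close> holds without restriction and complements are simply - R;
  measurability concerns its trace on the space of \<open>P\<close>.\<close>

lemma sets_past_sa_representation:
  assumes e: "\<And>j. e j \<in> M \<rightarrow>\<^sub>M Q" and N: "sets N = sets Q" and A: "A \<in> sets (past_sa M N e i)"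
  obtains R where "\<And>x y. mix {..i} x y \<in> R \<longleftrightarrow> x \<in> R" "{x \<in> space P. x \<in> R} \<in> sets P"
    "A = {w \<in> space M. (\<lambda>j. e j w) \<in> R}"
proof -
  have "\<exists>R. (\<forall>x y. mix {..i} x y \<in> R \<longleftrightarrow> x \<in> R) \<and> {x \<in> space P. x \<in> R} \<in> sets P
      \<and> A = {w \<in> space M. (\<lambda>j. e j w) \<in> R}" (is "\<exists>R. ?rep A R")
  proof -
    have "A \<in> sigma_sets (space M) {e j -` A \<inter> space M |j A. j \<le> i \<and> A \<in> sets N}"
      using A unfolding past_sa_def by (subst (asm) sets_measure_of) auto
    then show ?thesis
    proof (induction rule: sigma_sets.induct)
      case (Basic A)
      then obtain j B where B: "j \<le> i" "B \<in> sets Q" "A = e j -` B \<inter> space M" using N by auto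
      then have "?rep A {x. x j \<in> B}" by (auto simp: mix_def)
      then show ?case by blast
    next
      case Empty
      show ?case by (rule exI[of _ "{}"]) simp
    next
      case (Compl A)
      then obtain R where R: "?rep A R" by blast
      have "{x \<in> space P. x \<in> - R} = space P - {x \<in> space P. x \<in> R}" by auto
      with R have "?rep (space M - A) (- R)" by auto
      then show ?case by blast
    next
      case (Union A)
      then have "\<forall>n. \<exists>R. ?rep (A n) R" by blast
      then obtain R where R: "\<forall>n. ?rep (A n) (R n)" by (rule choice[THEN exE])
      have "{x \<in> space P. x \<in> (\<Union>n. R n)} = (\<Union>n. {x \<in> space P. x \<in> R n})" by auto
      moreover have "\<dots> \<in> sets P" using R by blast
      moreover have "A n = {w \<in> space M. (\<lambda>j. e j w) \<in> R n}" for n using R by blast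
      ultimately have "?rep (\<Union>n. A n) (\<Union>n. R n)" using R by (simp only: UN_iff) blast
      then show ?case by (rule exI)
    qed
  qed
  then obtain R where "?rep A R" ..
  then show ?thesis using that[of R] by simp
qed

text \<open>Both functions have the same integral over every past event: its indicator is a function
  of the coordinates up to i along the sequence, and the law of the sequence moves the identity to
  \<open>P\<close>, where that function is pulled out of \<open>cex\<close>.\<close>

lemma real_cond_exp_past_sa:
  assumes "prob_space M" and e: "\<And>j. e j \<in> M \<rightarrow>\<^sub>M Q" and N: "sets N = sets Q"
    and law: "distr M P (\<lambda>w j. e j w) = P" and f: "integrable P f"
  shows "AE w in M. real_cond_exp M (past_sa M N e i) (\<lambda>w. f (\<lambda>j. e j w)) w = cex P {..i} f (\<lambda>j. e j w)"
    and "real_cond_exp M (past_sa M N e i) (\<lambda>w. f (\<lambda>j. e j w)) \<in> borel_measurable M"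
proof -
  interpret M: prob_space M by fact
  let ?F = "past_sa M N e i" and ?E = "\<lambda>w j. e j w"
  let ?G = "{e j -` A \<inter> space M |j A. j \<le> i \<and> A \<in> sets N}"
  have spF: "space ?F = space M" unfolding past_sa_def by (rule space_measure_of) auto
  have setsF: "sets ?F = sigma_sets (space M) ?G"
    unfolding past_sa_def by (rule sets_measure_of) auto
  have sub: "subalgebra M ?F"
  proof -
    have "sigma_sets (space M) ?G \<subseteq> sets M"
      using measurable_sets[OF e] N by (intro sets.sigma_sets_subset) auto
    then show ?thesis by (simp add: subalgebra_def spF setsF)
  qed
  interpret F: finite_measure_subalgebra M ?F
    by unfold_locales (rule sub)
  have E[measurable]: "?E \<in> M \<rightarrow>\<^sub>M P"
    using e by (intro measurable_PiM_single') (auto simp: PiE_iff dest: measurable_space)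
  have intP: "integrable M (\<lambda>w. h (?E w))" if "integrable P h" for h :: "_ \<Rightarrow> real"
    using that law integrable_distr[OF E, of h] by simp
  have lawP: "(\<integral>w. h (?E w) \<partial>M) = (\<integral>x. h x \<partial>P)" if [measurable]: "h \<in> borel_measurable P" for h :: "_ \<Rightarrow> real"
    using integral_distr[OF E, of h] by (simp add: law)
  have [measurable]: "f \<in> borel_measurable P" using f by auto
  show "AE w in M. real_cond_exp M ?F (\<lambda>w. f (?E w)) w = cex P {..i} f (?E w)"
  proof (rule F.real_cond_exp_charact)
    show "integrable M (\<lambda>w. f (?E w))" "integrable M (\<lambda>w. cex P {..i} f (?E w))"
      using f integrable_cex by (auto intro!: intP)
    \<comment> \<open>A fixed point z is put into the coordinates after i: this leaves the value of
      \<open>cex\<close> unchanged and makes it visibly measurable with respect to the past.\<close>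
    obtain b where "b \<in> space Q" using Q.not_empty by auto
    then obtain z where z: "z \<in> space P" by (intro that[of "\<lambda>_. b"]) (auto simp: space_PiM PiE_iff)
    have "(\<lambda>w. mix {..i} (?E w) z) \<in> ?F \<rightarrow>\<^sub>M P"
    proof (rule measurable_PiM_single')
      show "(\<lambda>w. mix {..i} (?E w) z j) \<in> ?F \<rightarrow>\<^sub>M Q" for j
      proof (cases "j \<le> i")
        case True
        have "e j \<in> ?F \<rightarrow>\<^sub>M Q"
        proof (rule measurableI)
          show "e j w \<in> space Q" if "w \<in> space ?F" for w
            using that measurable_space[OF e] by (simp add: spF)
          show "e j -` A \<inter> space ?F \<in> sets ?F" if "A \<in> sets Q" for A
            using that True N unfolding setsF spF by (intro sigma_sets.Basic) auto
        qed
        then show ?thesis using True by (simp add: mix_def)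
      next
        case False
        then show ?thesis using z by (simp add: mix_def space_PiM PiE_iff)
      qed
      show "(\<lambda>w j. mix {..i} (?E w) z j) \<in> space ?F \<rightarrow> (UNIV \<rightarrow>\<^sub>E space Q)"
        using z measurable_space[OF e] by (auto simp: spF mix_def space_PiM PiE_iff)
    qed
    then have "(\<lambda>w. cex P {..i} f (mix {..i} (?E w) z)) \<in> borel_measurable ?F" by measurable
    then show "(\<lambda>w. cex P {..i} f (?E w)) \<in> borel_measurable ?F"
      by (simp add: depends_onD[OF depends_on_cex])
  next
    fix A assume AF: "A \<in> sets ?F"
    obtain R where R: "\<And>x y. mix {..i} x y \<in> R \<longleftrightarrow> x \<in> R" "{x \<in> space P. x \<in> R} \<in> sets P"
      and A: "A = {w \<in> space M. ?E w \<in> R}"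
      by (rule sets_past_sa_representation[OF e N AF]) (rule that)
    define h :: "_ \<Rightarrow> real" where "h = indicator R"
    have hm [measurable]: "h \<in> borel_measurable P"
      unfolding h_def by (rule borel_measurable_indicator') (use R(2) in \<open>auto simp: Int_def conj_commute\<close>)
    have dep: "depends_on {..i} h" using R(1) by (simp add: depends_on_def h_def indicator_def)
    have set_int: "(\<integral>w\<in>A. k (?E w) \<partial>M) = (\<integral>x. h x * k x \<partial>P)" if [measurable]: "k \<in> borel_measurable P" for k
    proof -
      have "(\<integral>w\<in>A. k (?E w) \<partial>M) = (\<integral>w. h (?E w) * k (?E w) \<partial>M)"
        unfolding set_lebesgue_integral_def
        by (intro Bochner_Integration.integral_cong) (auto simp: A h_def indicator_def)
      also have "\<dots> = (\<integral>x. h x * k x \<partial>P)" by (rule lawP) simp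
      finally show ?thesis .
    qed
    show "(\<integral>w\<in>A. f (?E w) \<partial>M) = (\<integral>w\<in>A. cex P {..i} f (?E w) \<partial>M)"
      unfolding set_int[OF \<open>f \<in> _\<close>] set_int[OF borel_measurable_cex[OF \<open>f \<in> _\<close>]]
      by (rule integral_mult_cex_bounded[OF dep hm _ f]) (simp add: h_def indicator_def)
  qed
  show "real_cond_exp M ?F (\<lambda>w. f (?E w)) \<in> borel_measurable M"
    by (rule borel_measurable_cond_exp2)
qed

text \<open>On the original space the copy is a single variable, on the product space a whole
  sequence of which only coordinate 0 is used. Both coupled pairs are images of the product of
  \<open>P\<close> and Q under one map.\<close>

lemma distr_coupled_pair:
  fixes E :: "'a \<Rightarrow> int \<Rightarrow> 'b"
  assumes E: "E \<in> M \<rightarrow>\<^sub>M P" and e0: "e0 \<in> M \<rightarrow>\<^sub>M Q"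
    and law: "distr M (P \<Otimes>\<^sub>M Q) (\<lambda>w. (E w, e0 w)) = P \<Otimes>\<^sub>M Q"
  shows "distr M (P \<Otimes>\<^sub>M P) (\<lambda>w. (E w, \<lambda>j. if j = 0 then e0 w else E w j))
    = distr (P \<Otimes>\<^sub>M P) (P \<Otimes>\<^sub>M P) (\<lambda>z. (fst z, mix (- {0}) (fst z) (snd z)))"
proof -
  note [measurable] = E e0
  let ?T = "\<lambda>z. (fst z, \<lambda>j. if j = 0 then snd z else fst z j)"
  have "(\<lambda>z j. if j = 0 then snd z else fst z j) \<in> P \<Otimes>\<^sub>M Q \<rightarrow>\<^sub>M P"
  proof (rule measurable_PiM_single')
    show "(\<lambda>z. if j = 0 then snd z else fst z j) \<in> P \<Otimes>\<^sub>M Q \<rightarrow>\<^sub>M Q" for j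
      by (cases "j = 0") auto
  qed (auto simp: space_pair_measure space_PiM PiE_iff)
  then have T [measurable]: "?T \<in> P \<Otimes>\<^sub>M Q \<rightarrow>\<^sub>M P \<Otimes>\<^sub>M P" by measurable
  have "distr P P (\<lambda>x. x) \<Otimes>\<^sub>M distr P Q (\<lambda>y. y 0)
      = distr (P \<Otimes>\<^sub>M P) (P \<Otimes>\<^sub>M Q) (\<lambda>(x, y). (x, y 0))"
    by (rule pair_measure_distr) (auto intro!: prob_space.prob_space_distr prod.P.prob_space_axioms
        prob_space_imp_sigma_finite)
  moreover have "distr P Q (\<lambda>y. y 0) = Q" using prod.PiM_component[of 0] by simp
  ultimately have law2: "distr (P \<Otimes>\<^sub>M P) (P \<Otimes>\<^sub>M Q) (\<lambda>z. (fst z, snd z 0)) = P \<Otimes>\<^sub>M Q"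
    by (simp add: distr_id2 split_beta')
  have "distr M (P \<Otimes>\<^sub>M P) (\<lambda>w. (E w, \<lambda>j. if j = 0 then e0 w else E w j))
      = distr (distr M (P \<Otimes>\<^sub>M Q) (\<lambda>w. (E w, e0 w))) (P \<Otimes>\<^sub>M P) ?T"
    by (subst distr_distr) (auto simp: comp_def cong: if_cong)
  also have "\<dots> = distr (distr (P \<Otimes>\<^sub>M P) (P \<Otimes>\<^sub>M Q) (\<lambda>z. (fst z, snd z 0))) (P \<Otimes>\<^sub>M P) ?T"
    by (simp only: law law2)
  also have "\<dots> = distr (P \<Otimes>\<^sub>M P) (P \<Otimes>\<^sub>M P) (\<lambda>z. ?T (fst z, snd z 0))"
    by (subst distr_distr) (auto simp: comp_def cong: if_cong)
  also have "(\<lambda>z. ?T (fst z, snd z 0)) = (\<lambda>z. (fst z, mix (- {0}) (fst z) (snd z :: int \<Rightarrow> 'b)))"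
    by (auto simp: mix_def fun_eq_iff)
  finally show ?thesis .
qed

end

text \<open>Indexing by \<open>int option\<close>, with \<open>None\<close> for the copy, puts all
  independence into one family. The law of the sequence follows by reindexing along
  \<open>Some\<close>, the joint law with the copy by grouping the indices into
  \<open>range Some\<close> and \<open>{None}\<close>.\<close>

lemma (in prob_space) innovation_laws:
  fixes e :: "int \<Rightarrow> 'a \<Rightarrow> 'b"
  assumes iid: "indep_vars (\<lambda>_. N) (\<lambda>j. case j of None \<Rightarrow> e0' | Some i \<Rightarrow> e i) UNIV"
    and ident: "\<And>i. distr M N (e i) = distr M N (e 0)" "distr M N e0' = distr M N (e 0)"
  defines "Q \<equiv> distr M N (e 0)"
  defines "P \<equiv> Pi\<^sub>M (UNIV :: int set) (\<lambda>_. Q)"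
  shows "\<And>j. e j \<in> M \<rightarrow>\<^sub>M Q" "e0' \<in> M \<rightarrow>\<^sub>M Q" "prob_space Q"
    and "distr M P (\<lambda>w j. e j w) = P"
    and "distr M (P \<Otimes>\<^sub>M Q) (\<lambda>w. (\<lambda>j. e j w, e0' w)) = P \<Otimes>\<^sub>M Q"
proof -
  let ?Z = "\<lambda>j. case j of None \<Rightarrow> e0' | Some i \<Rightarrow> e i"
  let ?O = "Pi\<^sub>M (UNIV :: int option set) (\<lambda>_. N)"
  have Z: "?Z k \<in> M \<rightarrow>\<^sub>M N" for k using iid by (simp add: indep_vars_def2)
  have eN: "e j \<in> M \<rightarrow>\<^sub>M N" for j using Z[of "Some j"] by simp
  have e0N: "e0' \<in> M \<rightarrow>\<^sub>M N" using Z[of None] by simp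
  have setsQ [measurable_cong]: "sets Q = sets N" by (simp add: Q_def)
  show eQ: "e j \<in> M \<rightarrow>\<^sub>M Q" for j using eN measurable_cong_sets[OF refl setsQ] by blast
  show e0Q: "e0' \<in> M \<rightarrow>\<^sub>M Q" using e0N measurable_cong_sets[OF refl setsQ] by blast
  show "prob_space Q" unfolding Q_def by (rule prob_space_distr[OF eN])
  then interpret Q: prob_space Q .
  have lawZ: "distr M N (?Z k) = Q" for k
    using ident by (cases k) (auto simp: Q_def)
  have "distr M ?O (\<lambda>w. \<lambda>k\<in>UNIV. ?Z k w) = Pi\<^sub>M UNIV (\<lambda>k. distr M N (?Z k))"
    by (rule iffD1[OF indep_vars_iff_distr_eq_PiM iid]) (auto simp: Z)
  then have lawO: "distr M ?O (\<lambda>w k. ?Z k w) = Pi\<^sub>M UNIV (\<lambda>_. Q)"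
    by (simp add: lawZ restrict_UNIV)
  \<comment> \<open>\<open>distr\<close> records its target, so product sigma-algebras over N and
    over Q, though equal, are exchanged explicitly.\<close>
  have setsO: "sets ?O = sets (Pi\<^sub>M (UNIV :: int option set) (\<lambda>_. Q))"
    by (rule sets_PiM_cong) (auto simp: setsQ)
  have ZQ [measurable]: "?Z k \<in> M \<rightarrow>\<^sub>M Q" for k using Z measurable_cong_sets[OF refl setsQ] by blast
  have Zm: "(\<lambda>w k. ?Z k w) \<in> M \<rightarrow>\<^sub>M Pi\<^sub>M UNIV (\<lambda>_. Q)"
    using measurable_space[OF ZQ] by (intro measurable_PiM_single') (auto simp: PiE_iff)
  have lawO': "distr M (Pi\<^sub>M UNIV (\<lambda>_. Q)) (\<lambda>w k. ?Z k w) = Pi\<^sub>M UNIV (\<lambda>_. Q)"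
    using lawO distr_cong[OF refl setsO] by metis
  have red: "(\<lambda>x j. x (Some j)) \<in> Pi\<^sub>M (UNIV :: int option set) (\<lambda>_. Q) \<rightarrow>\<^sub>M P"
    unfolding P_def by (intro measurable_PiM_single') (auto simp: PiE_iff space_PiM)
  have reindex: "distr (Pi\<^sub>M UNIV (\<lambda>_. Q)) P (\<lambda>x j. x (Some j)) = P"
    using distr_PiM_reindex[of UNIV "\<lambda>_ :: int option. Q" "Some" "UNIV :: int set"] Q.prob_space_axioms
    by (simp add: P_def restrict_UNIV)
  have "distr M P (\<lambda>w j. e j w) = distr (distr M (Pi\<^sub>M UNIV (\<lambda>_. Q)) (\<lambda>w k. ?Z k w)) P (\<lambda>x j. x (Some j))"
    by (subst distr_distr[OF red Zm]) (simp add: comp_def)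
  then show lawE: "distr M P (\<lambda>w j. e j w) = P" by (simp only: lawO' reindex)
  let ?A = "Pi\<^sub>M (range (Some :: int \<Rightarrow> _)) (\<lambda>_. N)" and ?B = "Pi\<^sub>M {None :: int option} (\<lambda>_. N)"
  let ?X = "\<lambda>w. \<lambda>k\<in>range Some. ?Z k w" and ?Y = "\<lambda>w. \<lambda>k\<in>{None}. ?Z k w"
  have "indep_var ?A ?X ?B ?Y"
    by (rule indep_var_restrict[OF iid]) auto
  then have X: "?X \<in> M \<rightarrow>\<^sub>M ?A" and Y: "?Y \<in> M \<rightarrow>\<^sub>M ?B"
    and XY: "distr M ?A ?X \<Otimes>\<^sub>M distr M ?B ?Y = distr M (?A \<Otimes>\<^sub>M ?B) (\<lambda>w. (?X w, ?Y w))"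
    unfolding indep_var_distribution_eq by auto
  have f: "(\<lambda>x j. x (Some j)) \<in> ?A \<rightarrow>\<^sub>M P"
    unfolding P_def by (rule measurable_PiM_single') (auto simp: PiE_iff space_PiM Q_def)
  have h: "(\<lambda>x. x None) \<in> ?B \<rightarrow>\<^sub>M Q"
    unfolding Q_def by simp
  have Qe0: "distr M Q e0' = Q" using distr_cong[OF refl setsQ] ident(2) Q_def by metis
  have fX: "distr (distr M ?A ?X) P (\<lambda>x j. x (Some j)) = P"
    using f X lawE by (subst distr_distr) (auto simp: comp_def)
  have hY: "distr (distr M ?B ?Y) Q (\<lambda>x. x None) = Q"
    using h Y Qe0 by (subst distr_distr) (auto simp: comp_def)
  have "distr (distr M ?A ?X) P (\<lambda>x j. x (Some j)) \<Otimes>\<^sub>M distr (distr M ?B ?Y) Q (\<lambda>x. x None)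
      = distr (distr M ?A ?X \<Otimes>\<^sub>M distr M ?B ?Y) (P \<Otimes>\<^sub>M Q) (\<lambda>(x, y). ((\<lambda>j. x (Some j)), y None))"
    using f h by (intro pair_measure_distr) (auto simp: hY Q.sigma_finite_measure_axioms)
  then have "P \<Otimes>\<^sub>M Q = distr (distr M (?A \<Otimes>\<^sub>M ?B) (\<lambda>w. (?X w, ?Y w))) (P \<Otimes>\<^sub>M Q)
      (\<lambda>(x, y). ((\<lambda>j. x (Some j)), y None))"
    by (simp only: fX hY XY)
  also have "\<dots> = distr M (P \<Otimes>\<^sub>M Q) ((\<lambda>(x, y). ((\<lambda>j. x (Some j)), y None)) \<circ> (\<lambda>w. (?X w, ?Y w)))"
  proof (rule distr_distr)
    show "(\<lambda>(x, y). ((\<lambda>j. x (Some j)), y None)) \<in> ?A \<Otimes>\<^sub>M ?B \<rightarrow>\<^sub>M P \<Otimes>\<^sub>M Q"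
      unfolding split_beta'
      by (intro measurable_Pair measurable_compose[OF measurable_fst f] measurable_compose[OF measurable_snd h])
    show "(\<lambda>w. (?X w, ?Y w)) \<in> M \<rightarrow>\<^sub>M ?A \<Otimes>\<^sub>M ?B" using X Y by (rule measurable_Pair)
  qed
  finally show "distr M (P \<Otimes>\<^sub>M Q) (\<lambda>w. (\<lambda>j. e j w, e0' w)) = P \<Otimes>\<^sub>M Q" by (simp add: comp_def)
qed

section \<open>Growth rates for the given blocks, and the theorem\<close>

context causal_process
begin

lemma measurable_sqsum [measurable]: "sqsum t n \<in> borel_measurable P"
  unfolding sqsum_def[abs_def] by measurable

lemma expectation_sqsum_rate:
  fixes c p q :: real
  assumes X: "memLp P 2 (X 0)" and mean: "(\<integral>x. X 0 x \<partial>P) = 0" and q: "0 < q" "q \<le> 1"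
    and sum: "summable (\<lambda>j. real j powr q * pdep j)" and c: "c > 0" and p: "p > 1"
  defines "a \<equiv> \<lambda>k. \<lfloor>c * real k powr p\<rfloor>"
  obtains C where "C \<ge> 0" "\<And>n. \<bar>(\<integral>x. sqsum (blk_start a) n x \<partial>P) - vn a n * lrvar P X\<bar>
    \<le> C * real n powr (1 + (1 - q) * (1 - 1 / p))"
proof -
  obtain L where L: "L > 0" "\<And>n i. 1 \<le> i \<Longrightarrow> i \<le> n \<Longrightarrow> blk_len a i \<le> L * real n powr (1 - 1 / p)"
    using blk_len_le[OF c p] unfolding a_def by metis
  obtain G where G: "G \<ge> 0" "\<And>t n L. (\<And>i. 1 \<le> i \<Longrightarrow> i \<le> n \<Longrightarrow> t i \<le> int i \<and> real_of_int (int i - t i + 1) \<le> L) \<Longrightarrow>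
    \<bar>(\<integral>x. sqsum t n x \<partial>P) - (\<Sum>i=1..n. real_of_int (int i - t i + 1)) * lrvar P X\<bar>
      \<le> G * (real n * L powr (1 - q))"
    by (rule expectation_sqsum_error[OF X mean q sum]) (rule that, assumption, blast)
  show ?thesis
  proof (rule that)
    show "G * L powr (1 - q) \<ge> 0" using G by simp
    fix n
    have "\<bar>(\<integral>x. sqsum (blk_start a) n x \<partial>P) - vn a n * lrvar P X\<bar>
        \<le> G * (real n * (L * real n powr (1 - 1 / p)) powr (1 - q))"
      unfolding vn_def blk_len_def
    proof (rule G(2))
      fix i assume i: "1 \<le> i" "i \<le> n"
      then show "blk_start a i \<le> int i \<and> real_of_int (int i - blk_start a i + 1) \<le> L * real n powr (1 - 1 / p)"
        using blk_start_bounds(2)[OF c p i(1), folded a_def] L(2)[OF i] by (simp add: blk_len_def a_def)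
    qed
    also have "\<dots> = G * L powr (1 - q) * real n powr (1 + (1 - q) * (1 - 1 / p))"
      using L(1) by (cases "n = 0") (simp_all add: powr_mult powr_powr powr_add mult_ac)
    finally show "\<bar>(\<integral>x. sqsum (blk_start a) n x \<partial>P) - vn a n * lrvar P X\<bar>
        \<le> G * L powr (1 - q) * real n powr (1 + (1 - q) * (1 - 1 / p))" .
  qed
qed

text \<open>Three halves of the block length exponent 1 - 1/p, plus 1/r from the number of
  coordinates that matter.\<close>

lemma deviation_sqsum_rate:
  fixes c p r :: real
  assumes r: "1 < r" "r \<le> 2" and X: "memLp P (2 * r) (X 0)" and mean: "(\<integral>x. X 0 x \<partial>P) = 0"
    and sum: "summable (\<lambda>i. coupled_norm P (2 * r) 0 (X (int i)))" and c: "c > 0" and p: "p > 1"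
  defines "a \<equiv> \<lambda>k. \<lfloor>c * real k powr p\<rfloor>"
  obtains C where "C \<ge> 0" "\<And>n. Lnorm P r (\<lambda>x. sqsum (blk_start a) n x - (\<integral>z. sqsum (blk_start a) n z \<partial>P))
    \<le> C * real n powr (3 / 2 - 3 / (2 * p) + 1 / r)"
proof -
  obtain L where L: "L > 0" "\<And>n i. 1 \<le> i \<Longrightarrow> i \<le> n \<Longrightarrow> blk_len a i \<le> L * real n powr (1 - 1 / p)"
    using blk_len_le[OF c p] unfolding a_def by metis
  obtain K where K: "K \<ge> 0" "\<And>t n L. L \<ge> 0 \<Longrightarrow>
    (\<And>i. 1 \<le> i \<Longrightarrow> i \<le> n \<Longrightarrow> 1 \<le> t i \<and> t i \<le> int i \<and> real_of_int (int i - t i + 1) \<le> L) \<Longrightarrow>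
    Lnorm P r (\<lambda>x. sqsum t n x - (\<integral>z. sqsum t n z \<partial>P)) \<le> K * (L powr (3 / 2) * real n powr (1 / r))"
    by (rule Lnorm_sqsum_le[OF r X mean sum]) (rule that, assumption, blast)
  show ?thesis
  proof (rule that)
    show "K * L powr (3 / 2) \<ge> 0" using K by simp
    fix n
    have "Lnorm P r (\<lambda>x. sqsum (blk_start a) n x - (\<integral>z. sqsum (blk_start a) n z \<partial>P))
        \<le> K * ((L * real n powr (1 - 1 / p)) powr (3 / 2) * real n powr (1 / r))"
    proof (rule K(2))
      fix i assume i: "1 \<le> i" "i \<le> n"
      then show "1 \<le> blk_start a i \<and> blk_start a i \<le> int i
          \<and> real_of_int (int i - blk_start a i + 1) \<le> L * real n powr (1 - 1 / p)"
        using blk_start_bounds[OF c p i(1), folded a_def] L(2)[OF i] by (simp add: blk_len_def a_def)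
    qed (use L in simp)
    also have "\<dots> = K * L powr (3 / 2) * real n powr ((1 - 1 / p) * (3 / 2) + 1 / r)"
      using L(1) by (simp add: powr_mult powr_powr powr_add mult_ac)
    also have "(1 - 1 / p) * (3 / 2) + 1 / r = 3 / 2 - 3 / (2 * p) + 1 / r"
      using p by (simp add: field_simps)
    finally show "Lnorm P r (\<lambda>x. sqsum (blk_start a) n x - (\<integral>z. sqsum (blk_start a) n z \<partial>P))
        \<le> K * L powr (3 / 2) * real n powr (3 / 2 - 3 / (2 * p) + 1 / r)" .
  qed
qed

end

theorem theorem2:
  fixes M :: "'a measure" and N :: "'b measure"
    and e :: "int \<Rightarrow> 'a \<Rightarrow> 'b" and e0' :: "'a \<Rightarrow> 'b"
    and g :: "(nat \<Rightarrow> 'b) \<Rightarrow> real"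
    and c p q :: real
  assumes "prob_space M"
    and iid: "prob_space.indep_vars M (\<lambda>_. N) (\<lambda>j. case j of None \<Rightarrow> e0' | Some i \<Rightarrow> e i) UNIV"
    and ident: "\<And>i. distr M N (e i) = distr M N (e 0)"
    and ident': "distr M N e0' = distr M N (e 0)"
    and g_meas: "g \<in> borel_measurable (PiM UNIV (\<lambda>_. N))"
    and c_pos: "c > 0" and p_gt: "p > 1"
    and mean0: "\<And>i. integrable M (bshift g e i) \<and> (\<integral>w. bshift g e i w \<partial>M) = 0"
    and L2: "\<And>i. integrable M (\<lambda>w. (bshift g e i w)\<^sup>2)"
    and q: "0 < q" "q \<le> 1"
    and omega_sum: "summable (\<lambda>j. real j powr q * pred_dep M N g e e0' 2 j)"
  shows "(\<lambda>n. (\<integral>w. Vn (\<lambda>k. \<lfloor>c * real k powr p\<rfloor>) (bshift g e) n w \<partial>M)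
              - vn (\<lambda>k. \<lfloor>c * real k powr p\<rfloor>) n * lrvar M (bshift g e))
           \<in> O(\<lambda>n. real n powr (1 + (1 - q) * (1 - 1 / p)))
       \<and> (\<forall>\<alpha>. 2 < \<alpha> \<and> \<alpha> \<le> 4
           \<and> (\<forall>i. integrable M (\<lambda>w. \<bar>bshift g e i w\<bar> powr \<alpha>))
           \<and> summable (\<lambda>j. phys_dep M g e e0' \<alpha> j) \<longrightarrow>
           (\<lambda>n. Lnorm M (\<alpha> / 2) (\<lambda>w. Vn (\<lambda>k. \<lfloor>c * real k powr p\<rfloor>) (bshift g e) n w
                 - vn (\<lambda>k. \<lfloor>c * real k powr p\<rfloor>) n * lrvar M (bshift g e)))
           \<in> O(\<lambda>n. real n powr (max (3/2 - 3 / (2 * p) + 2 / \<alpha>) (1 + (1 - q) * (1 - 1 / p)))))"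
proof -
  interpret M: prob_space M by fact
  define Q where "Q = distr M N (e 0)"
  note laws = M.innovation_laws[OF iid ident ident', folded Q_def]
  have setsQ: "sets N = sets Q" by (simp add: Q_def)
  have "sets (Pi\<^sub>M (UNIV :: nat set) (\<lambda>_. N)) = sets (Pi\<^sub>M UNIV (\<lambda>_. Q))"
    by (rule sets_PiM_cong) (auto simp: setsQ)
  then have gQ: "g \<in> borel_measurable (Pi\<^sub>M UNIV (\<lambda>_. Q))"
    using g_meas measurable_cong_sets by blast
  interpret Q: prob_space Q by (rule laws)
  interpret causal_process Q g
    by unfold_locales (rule gQ)
  \<comment> \<open>The two innovation sequences as points of the product space, so that their laws
    are image measures under single maps.\<close>
  define E E' where "E w j = e j w" and "E' w j = coupled e e0' j w" for w j
  have E [measurable]: "E \<in> M \<rightarrow>\<^sub>M P"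
    unfolding E_def[abs_def] using measurable_space[OF laws(1)] laws(1)
    by (intro measurable_PiM_single') (auto simp: PiE_iff)
  have coupled_meas: "coupled e e0' j \<in> M \<rightarrow>\<^sub>M Q" for j
    using laws(1,2) by (cases "j = 0") (simp_all add: coupled_def[abs_def])
  then have E' [measurable]: "E' \<in> M \<rightarrow>\<^sub>M P"
    unfolding E'_def[abs_def] using measurable_space[OF coupled_meas]
    by (intro measurable_PiM_single') (auto simp: PiE_iff)
  have lawE: "distr M P E = P" using laws(4) by (simp add: E_def[abs_def])
  have pair_law: "distr M (P \<Otimes>\<^sub>M P) (\<lambda>w. (E w, E' w))
      = distr (P \<Otimes>\<^sub>M P) (P \<Otimes>\<^sub>M P) (\<lambda>z. (fst z, mix (- {0}) (fst z) (snd z)))"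
  proof -
    have "E' w = (\<lambda>j. if j = 0 then e0' w else E w j)" for w
      by (auto simp: E'_def E_def coupled_def)
    then show ?thesis
      using distr_coupled_pair[OF E laws(2)] laws(5) by (simp add: E_def[abs_def])
  qed
  have lawE': "distr M P E' = P"
  proof -
    have "distr M P E' = distr (distr M (P \<Otimes>\<^sub>M P) (\<lambda>w. (E w, E' w))) P snd"
      by (subst distr_distr) (auto simp: comp_def)
    also have "\<dots> = distr (P \<Otimes>\<^sub>M P) P (\<lambda>z. mix (- {0}) (fst z) (snd z))"
      unfolding pair_law by (subst distr_distr) (auto simp: comp_def)
    finally show ?thesis by (simp add: distr_mix)
  qed
  have lawP: "(\<integral>w. h (E w) \<partial>M) = (\<integral>x. h x \<partial>P)" if "h \<in> borel_measurable P" for h :: "_ \<Rightarrow> real"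
    using integral_distr[OF E that] by (simp add: lawE)
  \<comment> \<open>Both dependence measures are instances: h = X_i for the physical one, h = the
    conditional expectation of X_i given {..0} for the predictive one.\<close>
  have pair_norm: "Lnorm M s (\<lambda>w. h (E w) - h (E' w)) = coupled_norm P s 0 h"
    if [measurable]: "h \<in> borel_measurable P" for s h
  proof -
    have "Lnorm M s (\<lambda>w. h (E w) - h (E' w))
        = Lnorm (distr M (P \<Otimes>\<^sub>M P) (\<lambda>w. (E w, E' w))) s (\<lambda>z. h (fst z) - h (snd z))"
      by (subst Lnorm_distr) auto
    also have "\<dots> = coupled_norm P s 0 h"
      unfolding pair_law coupled_norm_def by (subst Lnorm_distr) auto
    finally show ?thesis .
  qed
  have bX: "bshift g e i = (\<lambda>w. X i (E w))" "bshift g (coupled e e0') i = (\<lambda>w. X i (E' w))" for i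
    by (auto simp: bshift_def X_def E_def E'_def)
  have mem: "memLp M s (bshift g e 0) \<longleftrightarrow> memLp P s (X 0)" for s
    using memLp_distr[OF E measurable_X, of s 0] by (simp add: lawE bX)
  have X2: "memLp P 2 (X 0)"
  proof -
    have "bshift g e 0 \<in> borel_measurable M" using mean0[of 0] by auto
    then show ?thesis using L2[of 0] mem[of 2] by (simp add: memLp_2_iff)
  qed
  have mean: "(\<integral>x. X 0 x \<partial>P) = 0" using mean0[of 0] by (simp add: bX lawP)
  have phys: "phys_dep M g e e0' s i = coupled_norm P s 0 (X (int i))" for s i
    unfolding phys_dep_def bX by (rule pair_norm) simp
  \<comment> \<open>The coupled sequence has law \<open>P\<close> as well, so the two conditional
    expectations are one function \<open>cex\<close>, evaluated along E and along E'.\<close>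
  have pred: "pred_dep M N g e e0' 2 i = pdep i" for i
  proof -
    have int: "integrable P (X (int i))"
      using memLp_X[OF X2] by (rule prod.P.memLp_integrable[rotated]) simp
    note ce = real_cond_exp_past_sa[OF assms(1) laws(1) setsQ lawE[unfolded E_def[abs_def]] int]
    note ce' = real_cond_exp_past_sa[OF assms(1) coupled_meas setsQ lawE'[unfolded E'_def[abs_def]] int]
    have "pred_dep M N g e e0' 2 i
        = Lnorm M 2 (\<lambda>w. cex P {..0} (X (int i)) (E w) - cex P {..0} (X (int i)) (E' w))"
      unfolding pred_dep_def bX E_def[abs_def] E'_def[abs_def]
    proof (rule Lnorm_cong_AE)
      show "AE w in M. real_cond_exp M (past_sa M N e 0) (\<lambda>w. X (int i) (\<lambda>j. e j w)) w
          - real_cond_exp M (past_sa M N (coupled e e0') 0) (\<lambda>w. X (int i) (\<lambda>j. coupled e e0' j w)) w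
        = cex P {..0} (X (int i)) (\<lambda>j. e j w) - cex P {..0} (X (int i)) (\<lambda>j. coupled e e0' j w)"
        using ce(1)[of 0] ce'(1)[of 0] by eventually_elim simp
      show "(\<lambda>w. real_cond_exp M (past_sa M N e 0) (\<lambda>w. X (int i) (\<lambda>j. e j w)) w
          - real_cond_exp M (past_sa M N (coupled e e0') 0) (\<lambda>w. X (int i) (\<lambda>j. coupled e e0' j w)) w)
        \<in> borel_measurable M"
        by (intro borel_measurable_diff ce(2) ce'(2))
      show "(\<lambda>w. cex P {..0} (X (int i)) (\<lambda>j. e j w) - cex P {..0} (X (int i)) (\<lambda>j. coupled e e0' j w))
        \<in> borel_measurable M"
        using E[unfolded E_def[abs_def]] E'[unfolded E'_def[abs_def]] by measurable
    qed
    also have "\<dots> = pdep i" unfolding pdep_def by (rule pair_norm) simp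
    finally show ?thesis .
  qed
  define a where "a = (\<lambda>k. \<lfloor>c * real k powr p\<rfloor>)"
  define \<phi> where "\<phi> = 1 + (1 - q) * (1 - 1 / p)"
  have V: "Vn a (bshift g e) n w = sqsum (blk_start a) n (E w)" for n w
    by (simp add: Vn_def blk_sum_def sqsum_def bX)
  have lr: "lrvar M (bshift g e) = lrvar P X"
  proof -
    have "(\<integral>w. (X 0 (E w) - a) * (X k (E w) - b) \<partial>M) = (\<integral>x. (X 0 x - a) * (X k x - b) \<partial>P)" for k a b
      by (rule lawP) simp
    then show ?thesis unfolding lrvar_def bX by (simp add: lawP)
  qed
  have EV: "(\<integral>w. Vn a (bshift g e) n w \<partial>M) = (\<integral>x. sqsum (blk_start a) n x \<partial>P)" for n
    unfolding V by (rule lawP) simp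
  obtain C where C: "C \<ge> 0" "\<And>n. \<bar>(\<integral>x. sqsum (blk_start a) n x \<partial>P) - vn a n * lrvar P X\<bar> \<le> C * real n powr \<phi>"
    by (rule expectation_sqsum_rate[OF X2 mean q omega_sum[unfolded pred] c_pos p_gt, folded a_def \<phi>_def])
      (rule that)
  have part1: "(\<lambda>n. (\<integral>w. Vn a (bshift g e) n w \<partial>M) - vn a n * lrvar M (bshift g e))
      \<in> O(\<lambda>n. real n powr \<phi>)"
    using C(2) by (intro bigoI[of _ C] always_eventually) (simp add: EV lr)
  have part2: "(\<lambda>n. Lnorm M (\<alpha> / 2) (\<lambda>w. Vn a (bshift g e) n w - vn a n * lrvar M (bshift g e)))
      \<in> O(\<lambda>n. real n powr (max (3/2 - 3 / (2 * p) + 2 / \<alpha>) \<phi>))"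
    if \<alpha>: "2 < \<alpha>" "\<alpha> \<le> 4" and int: "\<And>i. integrable M (\<lambda>w. \<bar>bshift g e i w\<bar> powr \<alpha>)"
      and sum: "summable (\<lambda>j. phys_dep M g e e0' \<alpha> j)" for \<alpha>
  proof -
    define r where "r = \<alpha> / 2"
    have r: "1 < r" "r \<le> 2" "2 * r = \<alpha>" "1 / r = 2 / \<alpha>" using \<alpha> by (auto simp: r_def)
    have "bshift g e 0 \<in> borel_measurable M" using mean0[of 0] by auto
    then have X\<alpha>: "memLp P (2 * r) (X 0)" using int[of 0] mem[of \<alpha>] by (simp add: memLp_def r(3))
    have sum': "summable (\<lambda>i. coupled_norm P (2 * r) 0 (X (int i)))"
      using sum by (simp add: phys r(3))
    obtain D where D: "D \<ge> 0" "\<And>n. Lnorm P r (\<lambda>x. sqsum (blk_start a) n x - (\<integral>z. sqsum (blk_start a) n z \<partial>P))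
        \<le> D * real n powr (3/2 - 3 / (2 * p) + 2 / \<alpha>)"
      by (rule deviation_sqsum_rate[OF r(1,2) X\<alpha> mean sum' c_pos p_gt, folded a_def, unfolded r(4)]) (rule that)
    let ?m = "max (3/2 - 3 / (2 * p) + 2 / \<alpha>) \<phi>"
    show ?thesis
    \<comment> \<open>For n \<ge> 1 powers of n increase with the exponent, so both rates lie below
      the maximum.\<close>
    proof (rule bigoI[of _ "D + C"], rule eventually_sequentiallyI[of 1])
      fix n :: nat assume n: "1 \<le> n"
      let ?V = "sqsum (blk_start a) n"
      let ?\<mu> = "\<integral>z. ?V z \<partial>P" and ?v = "vn a n * lrvar P X"
      have mV: "memLp P r ?V"
        unfolding sqsum_def[abs_def] using r by (intro memLp_sum memLp_square memLp_X[OF X\<alpha>]) auto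
      have m1: "memLp P r (\<lambda>x. ?V x - ?\<mu>)" and m2: "memLp P r (\<lambda>x. ?\<mu> - ?v)"
        using r mV by (auto intro!: memLp_diff prod.P.memLp_const)
      have "Lnorm M r (\<lambda>w. ?V (E w) - ?v) = Lnorm P r (\<lambda>x. ?V x - ?v)"
        using Lnorm_distr[OF E, of "\<lambda>x. ?V x - ?v" r] by (simp add: lawE)
      \<comment> \<open>Deviation plus bias; the bias is a constant function, so its norm is its
        absolute value, whatever r.\<close>
      also have "\<dots> = Lnorm P r (\<lambda>x. (?V x - ?\<mu>) + (?\<mu> - ?v))" by simp
      also have "\<dots> \<le> Lnorm P r (\<lambda>x. ?V x - ?\<mu>) + Lnorm P r (\<lambda>x. ?\<mu> - ?v)"
        using r m1 m2 by (intro Lnorm_triangle) auto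
      also have "Lnorm P r (\<lambda>x. ?\<mu> - ?v) = \<bar>?\<mu> - ?v\<bar>"
        using r(1) by (simp add: Lnorm_def powr_powr prod.P.prob_space)
      also have "Lnorm P r (\<lambda>x. ?V x - ?\<mu>) + \<bar>?\<mu> - ?v\<bar>
          \<le> D * real n powr (3/2 - 3 / (2 * p) + 2 / \<alpha>) + C * real n powr \<phi>"
        by (intro add_mono D C)
      also have "\<dots> \<le> D * real n powr ?m + C * real n powr ?m"
        using n C D by (intro add_mono mult_left_mono powr_mono) auto
      finally show "norm (Lnorm M (\<alpha> / 2) (\<lambda>w. Vn a (bshift g e) n w - vn a n * lrvar M (bshift g e)))
          \<le> (D + C) * norm (real n powr ?m)"
        by (simp add: V lr r_def Lnorm_nonneg distrib_right)
    qed
  qed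
  show ?thesis
    using part1 part2 unfolding a_def \<phi>_def by blast
qed

end
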